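(* For $d\ge 2$, the affine span of the set of $\alpha$-$f$-vectors of all convex $d$-polytopes has dimension $2d-3$.
   Context: For a convex $d$-polytope $P\subset\mathbb{R}^d$ (with $d$-dimensional affine span) and a nonempty face $F\subseteq P$ (including $F=P$), the interior angle at $F$ is $\alpha(F,P)=\mathrm{vol}(S_\varepsilon(x)\cap P)/\mathrm{vol}(S_\varepsilon(x))$, where $x$ is in the relative interior of $F$ and $S_\varepsilon(x)$ is the $(d-1)$-sphere of radius $\varepsilon$ centered at $x$, with $\varepsilon>0$ small enough that it meets only faces of $P$ containing $F$. Put $\alpha_i(P)=\sum_{F}\alpha(F,P)$, summed over the $i$-faces $F$ of $P$, and let $f_i(P)$ be the number of $i$-faces of $P$, $0\le i\le d$; so $\alpha_d(P)=f_d(P)=1$. The $\alpha$-$f$-vector of $P$ is $(\alpha_0(P),\ldots,\alpha_d(P),f_0(P),\ldots,f_d(P))\in\mathbb{R}^{2d+2}$. *)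

theory Defs
  imports "HOL-Analysis.Analysis"
begin

text \<open>
  The (unnormalised) spherical Lebesgue measure of a subset \<open>A\<close> of the sphere of radius \<open>\<epsilon>\<close>
  around \<open>x\<close>: the volume of the cone with apex \<open>x\<close> over \<open>A\<close>, times \<open>d / \<epsilon>\<close>, where \<open>d\<close> is
  the dimension of the space. The factor gives the whole sphere its
  \<open>(d - 1)\<close>-dimensional volume \<open>d \<cdot> \<omega> \<cdot> \<epsilon> ^ (d - 1)\<close>, where \<open>\<omega>\<close> is the volume of the unit ball.
\<close>

definition sphere_vol :: "'a::euclidean_space \<Rightarrow> real \<Rightarrow> 'a set \<Rightarrow> real" where
  "sphere_vol x \<epsilon> A =
     real DIM('a) / \<epsilon> * measure lebesgue {x + t *\<^sub>R (y - x) | y t. y \<in> A \<and> 0 < t \<and> t \<le> 1}"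

text \<open>
  Smallness of the radius is required of all smaller radii as well: a sphere so large that it
  misses \<open>P\<close> would meet only faces containing \<open>F\<close> for a vacuous reason.
\<close>

definition small_radius :: "'a::euclidean_space set \<Rightarrow> 'a set \<Rightarrow> 'a \<Rightarrow> real \<Rightarrow> bool" where
  "small_radius F P x \<epsilon> \<longleftrightarrow> 0 < \<epsilon> \<and>
     (\<forall>\<delta> G. 0 < \<delta> \<and> \<delta> \<le> \<epsilon> \<and> G face_of P \<and> G \<inter> sphere x \<delta> \<noteq> {} \<longrightarrow> F \<subseteq> G)"

text \<open>
  For a nonempty face \<open>F\<close> of a full-dimensional polytope \<open>P\<close> the quotient does not depend on the
  choice of \<open>x\<close> and \<open>\<epsilon>\<close>.
\<close>

definition interior_angle :: "'a::euclidean_space set \<Rightarrow> 'a set \<Rightarrow> real" where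
  "interior_angle F P =
     (THE a. \<exists>x \<epsilon>. x \<in> rel_interior F \<and> small_radius F P x \<epsilon> \<and>
        a = sphere_vol x \<epsilon> (sphere x \<epsilon> \<inter> P) / sphere_vol x \<epsilon> (sphere x \<epsilon>))"

definition faces_of_dim :: "nat \<Rightarrow> 'a::euclidean_space set \<Rightarrow> 'a set set" where
  "faces_of_dim i P = {F. F face_of P \<and> aff_dim F = int i}"

definition face_number :: "nat \<Rightarrow> 'a::euclidean_space set \<Rightarrow> nat" where
  "face_number i P = card (faces_of_dim i P)"

definition angle_sum :: "nat \<Rightarrow> 'a::euclidean_space set \<Rightarrow> real" where
  "angle_sum i P = (\<Sum>F\<in>faces_of_dim i P. interior_angle F P)"

text \<open>
  The space \<open>\<real>\<^sup>2\<^sup>d\<^sup>+\<^sup>2\<close> is \<open>real ^ 'm\<close>, where \<open>idx\<close> numbers the coordinates by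
  \<open>0, \<dots>, 2 * d + 1\<close>: the angle sums occupy the positions \<open>0, \<dots>, d\<close> and the face numbers the
  positions \<open>d + 1, \<dots>, 2 * d + 1\<close>.
\<close>

definition alpha_f_vector :: "('m::finite \<Rightarrow> nat) \<Rightarrow> (real ^ 'n) set \<Rightarrow> real ^ 'm" where
  "alpha_f_vector idx P =
     (\<chi> k. if idx k \<le> CARD('n) then angle_sum (idx k) P
           else real (face_number (idx k - (CARD('n) + 1)) P))"

end

theory Submission
  imports Defs "HOL-Computational_Algebra.Polynomial"
begin

text \<open>
  Let \<open>T\<^sub>F\<close> be the cone of directions in which one can leave the relative interior of a face \<open>F\<close>
  without leaving \<open>P\<close>; the interior angle at \<open>F\<close> is the fraction of the unit ball covered by \<open>T\<^sub>F\<close>.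

  Upper bound. \<open>P\<close> is the disjoint union of the relative interiors of its faces. Computing the Euler
  characteristic of this union by slicing along an orthogonal basis gives Euler's relation. For a
  fixed direction \<open>u\<close>, the faces with \<open>u \<in> T\<^sub>F\<close> make up the set of points of \<open>P\<close> that can be moved
  along \<open>u\<close>; it meets every line parallel to \<open>u\<close> in a half-open segment, so its Euler characteristic
  is \<open>0\<close>. Integrating over \<open>u\<close> gives Gram's relation. With \<open>\<alpha>\<^sub>d = f\<^sub>d = 1\<close> and
  \<open>\<alpha>\<^sub>d\<^sub>-\<^sub>1 = f\<^sub>d\<^sub>-\<^sub>1 / 2\<close> these are five independent affine relations.

  Lower bound. Write \<open>\<alpha>\<close> and \<open>f\<close> as polynomials in \<open>t\<close> and look at their order of vanishing at
  \<open>t = -1\<close>. Changing the shape of the \<open>k\<close>-simplex in a product of a \<open>k\<close>-simplex and a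
  \<open>(d - k)\<close>-cube changes \<open>\<alpha>\<close> by a polynomial of order exactly \<open>d - k + 1\<close> and does not change \<open>f\<close>
  (\<open>3 \<le> k \<le> d\<close>), while replacing a simplex by the \<open>(d - m)\<close>-fold pyramid over an \<open>m\<close>-cube changes
  \<open>f\<close> by a polynomial of order exactly \<open>d - m + 1\<close> (\<open>2 \<le> m \<le> d\<close>). Distinct orders of vanishing
  force a linear relation valid for all polytopes to be a combination of the five above.
\<close>

section \<open>Interior angles and cones of feasible directions\<close>

text \<open>By Euler and Gram, a difference of two face polynomials or of two angle polynomials
  vanishes at -1, so only orders from 1 on occur. With \<open>f\<close> fixed, an angle difference
  has degree at most \<open>d - 2\<close>; a face difference has degree at most
  \<open>d - 1\<close>. The two families supply the orders 1 to \<open>d - 2\<close> and 1 to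
  \<open>d - 1\<close>, and (d - 2) + (d - 1) = 2d - 3.

  Angles of higher-dimensional simplices have no usable closed form, and none is computed. For a
  generic direction \<open>u\<close>, the faces whose cone contains \<open>u\<close> contribute
  \<open>t ^ (m - 1) * (1 + t) ^ (d + 1 - m)\<close> to the angle polynomial of simplex times cube,
  where \<open>m\<close> counts the facet forms of the simplex that are negative at
  \<open>u\<close>. The lowest order at -1 is therefore governed by the measure of a single region,
  and only this measure has to be shown to vary with the shape.\<close>

lemma point_in_rel_interior_face:
  fixes P :: "'a::euclidean_space set"
  assumes P: "polytope P" and x: "x \<in> P"
  obtains F where "F face_of P" "x \<in> rel_interior F"
proof -
  let ?S = "{F. F face_of P \<and> x \<in> F}"
  have "finite ?S" using finite_polytope_faces[OF P] by (rule rev_finite_subset) auto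
  moreover have "P \<in> ?S" using P x by (simp add: face_of_refl polytope_imp_convex)
  ultimately have fin: "finite ?S" "?S \<noteq> {}" by auto
  define F where "F = arg_min_on aff_dim ?S"
  have F: "F \<in> ?S" unfolding F_def by (rule arg_min_if_finite(1)[OF fin])
  have min: "\<And>G. G \<in> ?S \<Longrightarrow> aff_dim F \<le> aff_dim G"
    unfolding F_def by (rule arg_min_least[OF fin])
  have "x \<in> rel_interior F"
  proof (rule ccontr)
    assume n: "x \<notin> rel_interior F"
    have pF: "polytope F" using F P by (auto intro: face_of_polytope_polytope)
    have "x \<in> rel_frontier F"
      using F n pF by (simp add: rel_frontier_def polytope_imp_closed)
    then obtain G where G: "G facet_of F" "x \<in> G"
      using rel_frontier_of_polyhedron[OF polytope_imp_polyhedron[OF pF]] by auto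
    then have "G \<in> ?S" using F by (auto simp: facet_of_def intro: face_of_trans)
    moreover have "aff_dim G < aff_dim F" using G by (simp add: facet_of_def)
    ultimately show False using min by force
  qed
  with F show ?thesis using that by blast
qed

definition feasible_dirs :: "'a::euclidean_space set \<Rightarrow> 'a \<Rightarrow> 'a set" where
  "feasible_dirs P x = {u. \<exists>e>0. x + e *\<^sub>R u \<in> P}"

lemma feasible_dirs_le:
  assumes "convex P" "x \<in> P" "x + e *\<^sub>R u \<in> P" "0 \<le> s" "s \<le> (e::real)"
  shows "x + s *\<^sub>R u \<in> P"
proof (cases "e = 0")
  case False
  then have e: "e > 0" using assms by simp
  have "(1 - s/e) *\<^sub>R x + (s/e) *\<^sub>R (x + e *\<^sub>R u) \<in> P"
    using e assms by (intro convexD) auto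
  also have "(1 - s/e) *\<^sub>R x + (s/e) *\<^sub>R (x + e *\<^sub>R u) = x + s *\<^sub>R u"
    using e by (simp add: algebra_simps)
  finally show ?thesis .
qed (use assms in auto)

lemma feasible_dirs_scale: "u \<in> feasible_dirs P x \<Longrightarrow> c > 0 \<Longrightarrow> c *\<^sub>R u \<in> feasible_dirs P x"
proof -
  assume "u \<in> feasible_dirs P x" "c > 0"
  then obtain e where "e > 0" "x + e *\<^sub>R u \<in> P" by (auto simp: feasible_dirs_def)
  with \<open>c > 0\<close> show ?thesis unfolding feasible_dirs_def by (intro CollectI exI[of _ "e / c"]) auto
qed

lemma convex_feasible_dirs:
  assumes "convex P" "x \<in> P" shows "convex (feasible_dirs P x)"
proof (rule convexI)
  fix u v and a b :: real
  assume u: "u \<in> feasible_dirs P x" and v: "v \<in> feasible_dirs P x" and ab: "0 \<le> a" "0 \<le> b" "a + b = 1"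
  obtain e where e: "e > 0" "x + e *\<^sub>R u \<in> P" using u by (auto simp: feasible_dirs_def)
  obtain f where f: "f > 0" "x + f *\<^sub>R v \<in> P" using v by (auto simp: feasible_dirs_def)
  define m where "m = min e f"
  have m: "m > 0" "x + m *\<^sub>R u \<in> P" "x + m *\<^sub>R v \<in> P"
    using feasible_dirs_le[OF assms e(2), of m] feasible_dirs_le[OF assms f(2), of m] e f by (auto simp: m_def)
  have "a *\<^sub>R (x + m *\<^sub>R u) + b *\<^sub>R (x + m *\<^sub>R v) \<in> P"
    using assms m ab by (intro convexD) auto
  also have "a *\<^sub>R (x + m *\<^sub>R u) + b *\<^sub>R (x + m *\<^sub>R v) = (a + b) *\<^sub>R x + m *\<^sub>R (a *\<^sub>R u + b *\<^sub>R v)"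
    by (simp add: algebra_simps)
  finally show "a *\<^sub>R u + b *\<^sub>R v \<in> feasible_dirs P x" using ab m by (auto simp: feasible_dirs_def)
qed

lemma rel_interior_extend:
  fixes F :: "'a::euclidean_space set"
  assumes "convex F" "y \<in> rel_interior F" "x \<in> F"
  obtains l where "0 < l" "y + l *\<^sub>R (y - x) \<in> F"
proof -
  obtain e where "e > 1" "(1 - e) *\<^sub>R x + e *\<^sub>R y \<in> F"
    using convex_rel_interior_if[OF assms(1,2)] hull_inc[OF assms(3), of affine] by blast
  then show ?thesis using that[of "e - 1"] by (simp add: algebra_simps)
qed

text \<open>\<open>y\<close> lies strictly between \<open>x\<close> and a point \<open>?z\<close> of
  \<open>F\<close> or equals them, so the segment from \<open>?z\<close> to \<open>x + e u\<close>
  passes through a point \<open>y + c u\<close> with \<open>c > 0\<close>.\<close>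

lemma feasible_dirs_mono_rel_interior:
  assumes P: "convex P" and F: "F face_of P" and x: "x \<in> F" and y: "y \<in> rel_interior F"
  shows "feasible_dirs P x \<subseteq> feasible_dirs P y"
proof
  fix u assume "u \<in> feasible_dirs P x"
  then obtain e where e: "e > 0" "x + e *\<^sub>R u \<in> P" by (auto simp: feasible_dirs_def)
  obtain l where l: "0 < l" "y + l *\<^sub>R (y - x) \<in> F"
    using rel_interior_extend[OF face_of_imp_convex[OF F] y x] .
  let ?z = "y + l *\<^sub>R (y - x)"
  have "?z \<in> P" using l F face_of_imp_subset by blast
  then have "(1/(1+l)) *\<^sub>R ?z + (l/(1+l)) *\<^sub>R (x + e *\<^sub>R u) \<in> P"
    using l e P by (intro convexD) (auto simp: field_simps)
  also have "(1/(1+l)) *\<^sub>R ?z + (l/(1+l)) *\<^sub>R (x + e *\<^sub>R u) = (1/(1+l) + l/(1+l)) *\<^sub>R y + (l/(1+l) * e) *\<^sub>R u"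
    by (simp add: algebra_simps)
  also have "1/(1+l) + l/(1+l) = 1" using l by (simp add: field_simps)
  finally have "y + (l/(1+l) * e) *\<^sub>R u \<in> P" using l by simp
  moreover have "l/(1+l) * e > 0" using l e by simp
  ultimately show "u \<in> feasible_dirs P y" unfolding feasible_dirs_def by blast
qed

lemma feasible_dirs_rel_interior_eq:
  assumes "convex P" "F face_of P" "x \<in> rel_interior F" "y \<in> rel_interior F"
  shows "feasible_dirs P x = feasible_dirs P y"
  using feasible_dirs_mono_rel_interior[OF assms(1,2)] assms(3,4) rel_interior_subset by blast

definition face_cone :: "'a::euclidean_space set \<Rightarrow> 'a set \<Rightarrow> 'a set" where
  "face_cone F P = feasible_dirs P (SOME x. x \<in> rel_interior F)"

lemma face_cone_eq:
  assumes "convex P" "F face_of P" "x \<in> rel_interior F"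
  shows "face_cone F P = feasible_dirs P x"
  unfolding face_cone_def using assms by (metis feasible_dirs_rel_interior_eq someI)

section \<open>Small spheres, and interior angles as measures of cones\<close>

lemma small_radius_exists:
  fixes P :: "'a::euclidean_space set"
  assumes P: "polytope P" and F: "F face_of P" and x: "x \<in> rel_interior F"
  obtains \<epsilon> where "small_radius F P x \<epsilon>"
proof -
  let ?G = "{G. G face_of P \<and> \<not> F \<subseteq> G}"
  have fin: "finite ?G" using finite_polytope_faces[OF P] by (rule rev_finite_subset) auto
  have "closed (\<Union>?G)"
    using fin P by (intro closed_Union) (auto intro: polytope_imp_closed face_of_polytope_polytope)
  \<comment> \<open>A face that contains a relative interior point of \<open>F\<close> contains all
    of \<open>F\<close>, so \<open>x\<close> avoids the finitely many closed faces in
    \<open>?G\<close>.\<close>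
  moreover have "x \<notin> \<Union>?G"
    using subset_of_face_of[OF _ face_of_imp_subset[OF F]] x by blast
  ultimately obtain e where e: "e > 0" "ball x e \<subseteq> - \<Union>?G"
    using open_contains_ball_eq[of "- \<Union>?G" x] by (auto simp: open_Compl simp del: Union_iff)
  have "small_radius F P x (e/2)"
    unfolding small_radius_def
  proof (intro conjI allI impI)
    fix \<delta> G assume "0 < \<delta> \<and> \<delta> \<le> e / 2 \<and> G face_of P \<and> G \<inter> sphere x \<delta> \<noteq> {}"
    then obtain y where y: "0 < \<delta>" "\<delta> \<le> e/2" "G face_of P" "y \<in> G" "dist x y = \<delta>"
      by (meson disjoint_iff mem_sphere)
    then have "y \<in> ball x e" by auto
    then show "F \<subseteq> G" using e y by blast
  qed (use e in auto)
  then show ?thesis using that by blast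
qed

text \<open>If the ray left \<open>P\<close> at some \<open>s < \<epsilon>\<close>, the exit point
  would lie in the relative interior of a face \<open>G\<close> that meets the sphere of radius
  \<open>s\<close>. Smallness at the radius \<open>s\<close> puts \<open>x\<close> into
  \<open>G\<close>, and then the segment from \<open>x\<close> extends beyond the exit point inside
  \<open>G\<close>.\<close>

lemma small_radius_feasible_dirs:
  fixes P :: "'a::euclidean_space set"
  assumes P: "polytope P" and F: "F face_of P" and x: "x \<in> rel_interior F"
    and r: "small_radius F P x \<epsilon>" and u: "u \<in> feasible_dirs P x" "norm u = 1"
  shows "x + \<epsilon> *\<^sub>R u \<in> P"
proof (rule ccontr)
  assume nP: "x + \<epsilon> *\<^sub>R u \<notin> P"
  have cP: "convex P" "closed P" using P by (auto simp: polytope_imp_convex polytope_imp_closed)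
  have xP: "x \<in> P" using F x face_of_imp_subset rel_interior_subset by blast
  have e0: "\<epsilon> > 0" using r by (simp add: small_radius_def)
  define S where "S = {s. 0 \<le> s \<and> s \<le> \<epsilon> \<and> x + s *\<^sub>R u \<in> P}"
  have Seq: "S = {0..\<epsilon>} \<inter> (\<lambda>s. x + s *\<^sub>R u) -` P" by (auto simp: S_def)
  have "closed S" unfolding Seq using cP
    by (intro continuous_closed_vimage closed_Int closed_atLeastAtMost)
       (auto intro!: continuous_intros)
  moreover have "bounded S" unfolding Seq by (auto intro: bounded_subset[OF bounded_closed_interval])
  ultimately have "compact S" by (simp add: compact_eq_bounded_closed)
  moreover have "0 \<in> S" using xP e0 by (simp add: S_def)
  ultimately obtain s where s: "s \<in> S" and smax: "\<And>t. t \<in> S \<Longrightarrow> t \<le> s"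
    using compact_attains_sup[of S] by blast
  obtain e where e: "e > 0" "x + e *\<^sub>R u \<in> P" using u by (auto simp: feasible_dirs_def)
  have "min e \<epsilon> \<in> S" using feasible_dirs_le[OF cP(1) xP e(2), of "min e \<epsilon>"] e e0 by (auto simp: S_def)
  then have s0: "s > 0" using smax e e0 by force
  have sP: "x + s *\<^sub>R u \<in> P" "s \<le> \<epsilon>" using s by (auto simp: S_def)
  have se: "s < \<epsilon>" using sP nP by (cases "s = \<epsilon>") auto
  obtain G where G: "G face_of P" "x + s *\<^sub>R u \<in> rel_interior G"
    using point_in_rel_interior_face[OF P sP(1)] .
  have "x + s *\<^sub>R u \<in> G \<inter> sphere x s"
    using G(2) rel_interior_subset s0 u by (auto simp: dist_norm)
  then have "F \<subseteq> G" using r s0 sP G(1) unfolding small_radius_def by blast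
  then have "x \<in> G" using x rel_interior_subset by blast
  then obtain l where l: "0 < l" "x + s *\<^sub>R u + l *\<^sub>R (x + s *\<^sub>R u - x) \<in> G"
    using rel_interior_extend[OF face_of_imp_convex[OF G(1)] G(2)] by blast
  then have "x + (s + l * s) *\<^sub>R u \<in> P" using G face_of_imp_subset by (fastforce simp: algebra_simps)
  then have "x + min (s + l * s) \<epsilon> *\<^sub>R u \<in> P"
    using feasible_dirs_le[OF cP(1) xP, of "s + l * s" u "min (s + l * s) \<epsilon>"] l s0 e0 by auto
  then have "min (s + l * s) \<epsilon> \<in> S" using l s0 e0 by (auto simp: S_def)
  then have "min (s + l * s) \<epsilon> \<le> s" by (rule smax)
  moreover have "s + l * s > s" using l s0 by simp
  ultimately show False using se by (simp only: min_le_iff_disj)  linarith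
qed

text \<open>The cone measured by \<open>sphere_vol\<close> lacks its apex because of
  \<open>0 < t\<close>. It is a scaled translate of the part of \<open>T\<close> in the unit ball
  without the origin, and one point has measure 0. Convexity of \<open>T\<close> provides
  measurability.\<close>

lemma sphere_vol_eq:
  fixes x :: "'a::euclidean_space"
  assumes e: "\<epsilon> > 0" and T: "\<And>u c. u \<in> T \<Longrightarrow> c > 0 \<Longrightarrow> c *\<^sub>R u \<in> T"
    and A: "\<And>u. norm u = 1 \<Longrightarrow> x + \<epsilon> *\<^sub>R u \<in> A \<longleftrightarrow> u \<in> T" and As: "A \<subseteq> sphere x \<epsilon>"
    and cT: "convex T"
  shows "sphere_vol x \<epsilon> A = real DIM('a) / \<epsilon> * (\<epsilon> ^ DIM('a) * measure lebesgue (T \<inter> cball 0 1))"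
proof -
  have eq: "{x + t *\<^sub>R (y - x) | y t. y \<in> A \<and> 0 < t \<and> t \<le> 1} = (\<lambda>u. \<epsilon> *\<^sub>R u + x) ` (T \<inter> cball 0 1 - {0})"
    (is "?L = ?R")
  proof (rule set_eqI, rule iffI)
    fix z assume "z \<in> ?L"
    then obtain y t where y: "z = x + t *\<^sub>R (y - x)" "y \<in> A" "0 < t" "t \<le> 1" by blast
    have ny: "norm (y - x) = \<epsilon>" using As y by (auto simp: dist_norm norm_minus_commute)
    define u where "u = (1/\<epsilon>) *\<^sub>R (y - x)"
    have u: "norm u = 1" "y = x + \<epsilon> *\<^sub>R u" using ny e by (auto simp: u_def)
    then have "u \<in> T" using A y by blast
    then have "t *\<^sub>R u \<in> T \<inter> cball 0 1 - {0}" using T y u by auto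
    moreover have "z = \<epsilon> *\<^sub>R (t *\<^sub>R u) + x" using y u by (simp add: algebra_simps)
    ultimately show "z \<in> ?R" by blast
  next
    fix z assume "z \<in> ?R"
    then obtain u where u': "z = \<epsilon> *\<^sub>R u + x" "u \<in> T \<inter> cball 0 1 - {0}" by (rule imageE)
    then have u: "z = \<epsilon> *\<^sub>R u + x" "u \<in> T" "norm u \<le> 1" "u \<noteq> 0" by auto
    define v where "v = (1/norm u) *\<^sub>R u"
    have v: "norm v = 1" "v \<in> T" "u = norm u *\<^sub>R v" using u T by (auto simp: v_def)
    have "x + \<epsilon> *\<^sub>R v \<in> A" using A v by blast
    moreover have "z = x + norm u *\<^sub>R ((x + \<epsilon> *\<^sub>R v) - x)"
    proof -
      have "norm u *\<^sub>R ((x + \<epsilon> *\<^sub>R v) - x) = \<epsilon> *\<^sub>R (norm u *\<^sub>R v)" by simp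
      then show ?thesis using u(1) v(3) by (metis add.commute)
    qed
    moreover have "0 < norm u" using u by simp
    ultimately show "z \<in> ?L" using u(3) by blast
  qed
  have "measure lebesgue (T \<inter> cball 0 1 - {0}) = measure lebesgue (T \<inter> cball 0 1)"
  proof (rule measure_negligible_symdiff)
    show "T \<inter> cball 0 1 \<in> lmeasurable"
      using cT by (intro measurable_convex convex_Int convex_cball) (simp_all add: bounded_Int)
  qed (rule negligible_subset[OF negligible_sing[of 0]], auto)
  then have "measure lebesgue ((\<lambda>u. \<epsilon> *\<^sub>R u + x) ` (T \<inter> cball 0 1 - {0})) =
      \<epsilon> ^ DIM('a) * measure lebesgue (T \<inter> cball 0 1)"
    using e by (simp add: measure_lebesgue_affine)
  then show ?thesis unfolding sphere_vol_def eq by simp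
qed

lemma unit_ball_measure_pos: "measure lebesgue (cball 0 1 :: 'a::euclidean_space set) > 0"
  by (simp add: content_cball_pos)

text \<open>\<open>\<epsilon>\<close> cancels in the quotient and the cone does not depend on
  \<open>x\<close>, so all admissible pairs give one value and the definite description picks
  it.\<close>

lemma interior_angle_eq:
  fixes P :: "'a::euclidean_space set"
  assumes P: "polytope P" and F: "F face_of P" "F \<noteq> {}"
  shows "interior_angle F P = measure lebesgue (face_cone F P \<inter> cball 0 1) / measure lebesgue (cball 0 1 :: 'a set)"
    (is "_ = ?a")
proof -
  have cP: "convex P" using P by (simp add: polytope_imp_convex)
  have main: "sphere_vol x \<epsilon> (sphere x \<epsilon> \<inter> P) / sphere_vol x \<epsilon> (sphere x \<epsilon>) = ?a"
    if x: "x \<in> rel_interior F" and r: "small_radius F P x \<epsilon>" for x \<epsilon>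
  proof -
    have e: "\<epsilon> > 0" using r by (simp add: small_radius_def)
    have fc: "face_cone F P = feasible_dirs P x" using face_cone_eq cP F x by blast
    have 1: "sphere_vol x \<epsilon> (sphere x \<epsilon> \<inter> P) = real DIM('a) / \<epsilon> * (\<epsilon> ^ DIM('a) * measure lebesgue (feasible_dirs P x \<inter> cball 0 1))"
    proof (rule sphere_vol_eq[OF e])
      fix u :: 'a assume u: "norm u = 1"
      show "x + \<epsilon> *\<^sub>R u \<in> sphere x \<epsilon> \<inter> P \<longleftrightarrow> u \<in> feasible_dirs P x"
        using small_radius_feasible_dirs[OF P F(1) x r _ u] u e by (auto simp: feasible_dirs_def dist_norm)
    qed (use F x cP face_of_imp_subset rel_interior_subset in \<open>blast intro: feasible_dirs_scale convex_feasible_dirs\<close>)+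
    have 2: "sphere_vol x \<epsilon> (sphere x \<epsilon>) = real DIM('a) / \<epsilon> * (\<epsilon> ^ DIM('a) * measure lebesgue (UNIV \<inter> cball (0::'a) 1))"
      by (rule sphere_vol_eq[OF e]) (use e in \<open>auto simp: dist_norm\<close>)
    show ?thesis unfolding 1 2 fc using e by simp
  qed
  have "rel_interior F \<noteq> {}"
    using F face_of_imp_convex rel_interior_eq_empty by blast
  then obtain x where x: "x \<in> rel_interior F" by blast
  obtain \<epsilon> where "small_radius F P x \<epsilon>" using small_radius_exists[OF P F(1) x] .
  then have "\<exists>x \<epsilon>. x \<in> rel_interior F \<and> small_radius F P x \<epsilon> \<and>
      ?a = sphere_vol x \<epsilon> (sphere x \<epsilon> \<inter> P) / sphere_vol x \<epsilon> (sphere x \<epsilon>)"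
    using main x by force
  then show ?thesis unfolding interior_angle_def
  proof (rule the_equality)
    fix a assume "\<exists>x \<epsilon>. x \<in> rel_interior F \<and> small_radius F P x \<epsilon> \<and>
      a = sphere_vol x \<epsilon> (sphere x \<epsilon> \<inter> P) / sphere_vol x \<epsilon> (sphere x \<epsilon>)"
    then obtain x \<epsilon> where "x \<in> rel_interior F" "small_radius F P x \<epsilon>"
      and a: "a = sphere_vol x \<epsilon> (sphere x \<epsilon> \<inter> P) / sphere_vol x \<epsilon> (sphere x \<epsilon>)" by (elim exE conjE)
    then show "a = ?a" by (simp only: a main)
  qed
qed

section \<open>The relations of Euler and Gram\<close>

definition gapped :: "real set \<Rightarrow> real \<Rightarrow> bool" where
  "gapped D \<epsilon> \<longleftrightarrow> 0 < \<epsilon> \<and> (\<forall>s\<in>D. \<forall>t\<in>D. s < t \<longrightarrow> s + \<epsilon> < t)"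

lemma gapped_exists:
  assumes "finite D" obtains \<epsilon> where "gapped D \<epsilon>"
proof -
  let ?G = "insert 1 ((\<lambda>(s,t). t - s) ` {(s,t) \<in> D \<times> D. s < t})"
  have fin: "finite ?G" using assms by (intro finite.insertI finite_imageI finite_subset[OF _ finite_cartesian_product]) auto
  define e where "e = Min ?G / 2"
  have pos: "Min ?G > 0" using fin by (subst Min_gr_iff) auto
  have "s + e < t" if "s \<in> D" "t \<in> D" "s < t" for s t
  proof -
    have "t - s \<in> ?G" using that by force
    then have "Min ?G \<le> t - s" using fin by (rule Min_le[rotated])
    then show ?thesis using pos unfolding e_def by linarith
  qed
  then have "gapped D e" using pos by (simp add: gapped_def e_def)
  then show ?thesis using that by blast
qed

text \<open>
  If \<open>D\<close> contains all points of discontinuity of a step function \<open>h\<close>, then \<open>h (t + \<epsilon>)\<close> is its limit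
  from the right at \<open>t\<close>, and the sum is Hadwiger's one-dimensional Euler characteristic of \<open>h\<close>.
\<close>

definition jump_sum :: "real set \<Rightarrow> real \<Rightarrow> (real \<Rightarrow> real) \<Rightarrow> real" where
  "jump_sum D \<epsilon> h = (\<Sum>t\<in>D. h t - h (t + \<epsilon>))"

text \<open>Only a closed right end, with \<open>c\<close>, and an open left end, with
  \<open>- c\<close>, are counted. Here and in the next two lemmas, closed, open and half-open
  intervals therefore give \<open>c\<close>, \<open>- c\<close> and 0.\<close>

lemma jump_sum_closed:
  assumes "finite D" "gapped D \<epsilon>" "l \<in> D" "r \<in> D" "l \<le> r"
  shows "jump_sum D \<epsilon> (\<lambda>t. if l \<le> t \<and> t \<le> r then c else 0) = c"
proof -
  have "jump_sum D \<epsilon> (\<lambda>t. if l \<le> t \<and> t \<le> r then c else 0) = (\<Sum>t\<in>D. if t = r then c else 0)"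
    unfolding jump_sum_def
  proof (rule sum.cong)
    fix t assume t: "t \<in> D"
    have "0 < \<epsilon>" "t < r \<Longrightarrow> t + \<epsilon> < r" "t < l \<Longrightarrow> t + \<epsilon> < l" using assms t by (auto simp: gapped_def)
    then show "(if l \<le> t \<and> t \<le> r then c else 0) - (if l \<le> t + \<epsilon> \<and> t + \<epsilon> \<le> r then c else 0) = (if t = r then c else 0)"
      using assms(5) by (cases t r rule: linorder_cases; cases t l rule: linorder_cases) auto
  qed simp
  then show ?thesis using assms by simp
qed

lemma jump_sum_open:
  assumes "finite D" "gapped D \<epsilon>" "l \<in> D" "r \<in> D" "l < r"
  shows "jump_sum D \<epsilon> (\<lambda>t. if l < t \<and> t < r then c else 0) = - c"
proof -
  have "jump_sum D \<epsilon> (\<lambda>t. if l < t \<and> t < r then c else 0) = (\<Sum>t\<in>D. if t = l then - c else 0)"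
    unfolding jump_sum_def
  proof (rule sum.cong)
    fix t assume t: "t \<in> D"
    have "0 < \<epsilon>" "t < r \<Longrightarrow> t + \<epsilon> < r" "t < l \<Longrightarrow> t + \<epsilon> < l" using assms t by (auto simp: gapped_def)
    then show "(if l < t \<and> t < r then c else 0) - (if l < t + \<epsilon> \<and> t + \<epsilon> < r then c else 0) = (if t = l then - c else 0)"
      using assms(5) by (cases t r rule: linorder_cases; cases t l rule: linorder_cases) auto
  qed simp
  then show ?thesis using assms by simp
qed

lemma jump_sum_half_open:
  assumes "finite D" "gapped D \<epsilon>" "l \<in> D" "r \<in> D"
  shows "jump_sum D \<epsilon> (\<lambda>t. if l \<le> t \<and> t < r then c else 0) = 0"
  unfolding jump_sum_def
proof (rule sum.neutral, rule ballI)
  fix t assume t: "t \<in> D"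
  have "0 < \<epsilon>" "t < r \<Longrightarrow> t + \<epsilon> < r" "t < l \<Longrightarrow> t + \<epsilon> < l" using assms t by (auto simp: gapped_def)
  then show "(if l \<le> t \<and> t < r then c else 0) - (if l \<le> t + \<epsilon> \<and> t + \<epsilon> < r then c else 0) = 0"
    by (cases t r rule: linorder_cases; cases t l rule: linorder_cases) auto
qed

text \<open>Intended for relatively open convex sets, where it is the Euler characteristic with
  compact support, the one that adds up over partitions into such sets.\<close>

definition euler_char :: "'a::euclidean_space set \<Rightarrow> real" where
  "euler_char C = (if C = {} then 0 else (-1) ^ nat (aff_dim C))"

lemma euler_char_empty [simp]: "euler_char {} = 0" by (simp add: euler_char_def)
lemma euler_char_sing [simp]: "euler_char {x} = 1" by (simp add: euler_char_def)

lemma slice_range_open: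
  fixes C :: "'a::euclidean_space set"
  assumes C: "convex C" "rel_interior C = C" "bounded C"
    and x: "x \<in> C" and y: "y \<in> C" "b \<bullet> x \<noteq> b \<bullet> y"
  shows "(\<bullet>) b ` C = {Inf ((\<bullet>) b ` C)<..<Sup ((\<bullet>) b ` C)}"
proof -
  let ?I = "(\<bullet>) b ` C"
  have bd: "bounded ?I" using C(3) by (rule bounded_linear_image) (rule bounded_linear_inner_right)
  then have bdd: "bdd_above ?I" "bdd_below ?I" by (auto intro: bounded_imp_bdd_above bounded_imp_bdd_below)
  have "convex ?I" using C(1) by (intro convex_linear_image bounded_linear.linear bounded_linear_inner_right)
  then have ivl: "is_interval ?I" by (simp add: is_interval_convex_1)
  have ne: "?I \<noteq> {}" using x by blast
  have ext: "(\<exists>s\<in>?I. s < t) \<and> (\<exists>s\<in>?I. t < s)" if t: "t \<in> ?I" for t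
  proof -
    obtain z where z: "z \<in> C" "t = b \<bullet> z" using t by blast
    obtain w where w: "w \<in> C" "b \<bullet> w \<noteq> t" using x y z by metis
    obtain l where l: "0 < l" "z + l *\<^sub>R (z - w) \<in> C"
      using rel_interior_extend[OF C(1) _ w(1), of z] z C(2) by auto
    have eq: "b \<bullet> (z + l *\<^sub>R (z - w)) = t + l * (t - b \<bullet> w)" by (simp add: z algebra_simps)
    have 1: "t + l * (t - b \<bullet> w) \<in> ?I" using l(2) eq by (metis imageI)
    have 2: "b \<bullet> w \<in> ?I" using w by blast
    show ?thesis
    proof (cases "b \<bullet> w < t")
      case True
      then have "l * (t - b \<bullet> w) > 0" using l by simp
      then show ?thesis using True 1 2 by (metis less_add_same_cancel1)
    next
      case False
      then have "l * (t - b \<bullet> w) < 0" using l w by (simp add: mult_less_0_iff)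
      moreover have "t < b \<bullet> w" using False w by simp
      ultimately show ?thesis using 1 2 by (metis add_less_same_cancel1)
    qed
  qed
  show ?thesis
  proof (intro equalityI subsetI)
    fix t assume t: "t \<in> ?I"
    obtain s r where "s \<in> ?I" "s < t" "r \<in> ?I" "t < r" using ext[OF t] by blast
    then show "t \<in> {Inf ?I<..<Sup ?I}"
      using cInf_lower[OF _ bdd(2)] cSup_upper[OF _ bdd(1)] by (meson greaterThanLessThan_iff le_less_trans less_le_trans)
  next
    fix t assume t: "t \<in> {Inf ?I<..<Sup ?I}"
    obtain s where s: "s \<in> ?I" "s < t" using t cInf_lessD[OF ne, of t] by auto
    obtain r where r: "r \<in> ?I" "t < r" using t less_cSupD[OF ne, of t] by auto
    show "t \<in> ?I" using ivl s r unfolding is_interval_1 by (meson less_imp_le)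
  qed
qed

lemma aff_dim_slice:
  fixes C :: "'a::euclidean_space set"
  assumes C: "rel_interior C = C" and x: "x \<in> C" "b \<bullet> x = t" and y: "y \<in> C" "b \<bullet> y \<noteq> t"
  shows "aff_dim (C \<inter> {x. b \<bullet> x = t}) = aff_dim C - 1"
proof -
  let ?H = "{x. b \<bullet> x = t}"
  obtain T where T: "open T" "C = affine hull C \<inter> T"
    using C rel_interior_eq[of C] by (auto simp: openin_open)
  have "C \<inter> ?H = (affine hull C \<inter> ?H) \<inter> T" using T(2) by blast
  then have "aff_dim (C \<inter> ?H) = aff_dim ((affine hull C \<inter> ?H) \<inter> T)" by simp
  also have "\<dots> = aff_dim (affine hull C \<inter> ?H)"
    using T x \<open>C \<inter> ?H = _\<close> by (intro aff_dim_convex_Int_open convex_Int convex_hyperplane affine_imp_convex affine_affine_hull) auto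
  also have "\<dots> = aff_dim (affine hull C) - 1"
    using aff_dim_affine_Int_hyperplane[of "affine hull C" b t] hull_subset[of C affine] x y by auto
  finally show ?thesis by simp
qed

text \<open>If \<open>b\<close> is constant on \<open>C\<close>, the only nonempty slice is
  \<open>C\<close> itself, over a one-point closed interval. Otherwise the nonempty slices lie over
  an open interval and lose one dimension; the sign from the dimension and the sign from the open
  interval cancel.\<close>

lemma euler_char_slice:
  fixes C :: "'a::euclidean_space set"
  assumes C: "convex C" "rel_interior C = C" "bounded C"
    and D: "finite D" "gapped D \<epsilon>" "Inf ((\<bullet>) b ` C) \<in> D" "Sup ((\<bullet>) b ` C) \<in> D"
  shows "euler_char C = jump_sum D \<epsilon> (\<lambda>t. euler_char (C \<inter> {x. b \<bullet> x = t}))"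
proof (cases "C = {}")
  case True
  then show ?thesis by (simp add: jump_sum_def)
next
  case False
  then obtain x where x: "x \<in> C" by blast
  let ?I = "(\<bullet>) b ` C"
  show ?thesis
  proof (cases "\<exists>a. \<forall>y\<in>C. b \<bullet> y = a")
    case True
    then obtain a where a: "\<And>y. y \<in> C \<Longrightarrow> b \<bullet> y = a" by blast
    then have I: "?I = {a}" using x by (intro equalityI subsetI) auto
    have "(\<lambda>t. euler_char (C \<inter> {x. b \<bullet> x = t})) = (\<lambda>t. if a \<le> t \<and> t \<le> a then euler_char C else 0)"
    proof
      fix t
      have "C \<inter> {x. b \<bullet> x = t} = (if t = a then C else {})" using a by auto
      then show "euler_char (C \<inter> {x. b \<bullet> x = t}) = (if a \<le> t \<and> t \<le> a then euler_char C else 0)" by simp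
    qed
    then show ?thesis using D I jump_sum_closed[OF D(1,2), of a a "euler_char C"] by simp
  next
    case False
    then obtain y where y: "y \<in> C" "b \<bullet> x \<noteq> b \<bullet> y" by metis
    let ?l = "Inf ?I" and ?r = "Sup ?I"
    have I: "?I = {?l<..<?r}" by (rule slice_range_open[OF C x y])
    have lr: "?l < ?r" using I x by (metis empty_iff greaterThanLessThan_empty_iff imageI not_le)
    have "euler_char (C \<inter> {x. b \<bullet> x = t}) = (if ?l < t \<and> t < ?r then - euler_char C else 0)" for t
    proof (cases "t \<in> ?I")
      case True
      then obtain z where z: "z \<in> C" "b \<bullet> z = t" by blast
      obtain w where w: "w \<in> C" "b \<bullet> w \<noteq> t" using x y by metis
      have ad: "aff_dim (C \<inter> {x. b \<bullet> x = t}) = aff_dim C - 1" by (rule aff_dim_slice[OF C(2) z w])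
      have ne: "C \<inter> {x. b \<bullet> x = t} \<noteq> {}" using z by auto
      then have "aff_dim (C \<inter> {x. b \<bullet> x = t}) \<ge> 0"
        using aff_dim_empty[of "C \<inter> {x. b \<bullet> x = t}"] aff_dim_geq[of "C \<inter> {x. b \<bullet> x = t}"] by linarith
      then have "nat (aff_dim C) = Suc (nat (aff_dim (C \<inter> {x. b \<bullet> x = t})))" using ad by simp
      then have "euler_char (C \<inter> {x. b \<bullet> x = t}) = - euler_char C" using ne x by (auto simp: euler_char_def)
      moreover have "?l < t \<and> t < ?r" using True I by (metis greaterThanLessThan_iff)
      ultimately show ?thesis by simp
    next
      case False
      then have "C \<inter> {x. b \<bullet> x = t} = {}" by auto
      moreover have "\<not> (?l < t \<and> t < ?r)" using False I by (metis greaterThanLessThan_iff)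
      ultimately show ?thesis by auto
    qed
    then show ?thesis using jump_sum_open[OF D lr, of "- euler_char C"] by simp
  qed
qed

definition relopen_bounded :: "'a::euclidean_space set \<Rightarrow> bool" where
  "relopen_bounded C \<longleftrightarrow> convex C \<and> rel_interior C = C \<and> bounded C"

lemma relopen_bounded_Int_affine:
  assumes "relopen_bounded C" "affine M" shows "relopen_bounded (C \<inter> M)"
proof (cases "C \<inter> M = {}")
  case False
  then show ?thesis
    using assms convex_affine_rel_interior_Int[of C M] unfolding relopen_bounded_def
    by (auto simp: convex_Int affine_imp_convex bounded_Int)
qed (simp add: relopen_bounded_def)

text \<open>\<open>D\<close> has to contain the ends of the ranges of all \<open>C i\<close>, so
  that one step sum serves every summand. \<open>D0\<close> adds the jumps of \<open>h\<close>,
  which the evaluations of \<open>jump_sum\<close> require.\<close>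

lemma euler_char_sum_slice:
  fixes C :: "'i \<Rightarrow> 'a::euclidean_space set"
  assumes I: "finite I" "\<And>i. i \<in> I \<Longrightarrow> relopen_bounded (C i)"
    and h: "\<And>t. (\<Sum>i\<in>I. euler_char (C i \<inter> {x. b \<bullet> x = t})) = h t"
    and D0: "finite D0"
  obtains D \<epsilon> where "finite D" "D0 \<subseteq> D" "gapped D \<epsilon>" "(\<Sum>i\<in>I. euler_char (C i)) = jump_sum D \<epsilon> h"
proof -
  define D where "D = D0 \<union> (\<lambda>i. Inf ((\<bullet>) b ` C i)) ` I \<union> (\<lambda>i. Sup ((\<bullet>) b ` C i)) ` I"
  have D: "finite D" "D0 \<subseteq> D" using I(1) D0 by (auto simp: D_def)
  obtain \<epsilon> where e: "gapped D \<epsilon>" using gapped_exists[OF D(1)] .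
  have "(\<Sum>i\<in>I. euler_char (C i)) = (\<Sum>i\<in>I. jump_sum D \<epsilon> (\<lambda>t. euler_char (C i \<inter> {x. b \<bullet> x = t})))"
  proof (rule sum.cong)
    fix i assume i: "i \<in> I"
    then show "euler_char (C i) = jump_sum D \<epsilon> (\<lambda>t. euler_char (C i \<inter> {x. b \<bullet> x = t}))"
      using I(2)[OF i] D e by (intro euler_char_slice) (auto simp: relopen_bounded_def D_def)
  qed simp
  also have "\<dots> = jump_sum D \<epsilon> h"
    unfolding jump_sum_def h[symmetric] by (subst sum.swap) (simp add: sum_subtractf)
  finally show ?thesis using that D e by blast
qed

lemma euler_char_sum_zero:
  fixes C :: "'i \<Rightarrow> 'a::euclidean_space set"
  assumes "finite I" "\<And>i. i \<in> I \<Longrightarrow> relopen_bounded (C i)"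
    and "\<And>t. (\<Sum>i\<in>I. euler_char (C i \<inter> {x. b \<bullet> x = t})) = 0"
  shows "(\<Sum>i\<in>I. euler_char (C i)) = 0"
proof -
  obtain D \<epsilon> where "(\<Sum>i\<in>I. euler_char (C i)) = jump_sum D \<epsilon> (\<lambda>t. 0)"
    using euler_char_sum_slice[OF assms, of "{}"] by blast
  then show ?thesis by (simp add: jump_sum_def)
qed

lemma euler_char_sum_half_open:
  fixes C :: "'i \<Rightarrow> 'a::euclidean_space set"
  assumes "finite I" "\<And>i. i \<in> I \<Longrightarrow> relopen_bounded (C i)"
    and "\<And>t. (\<Sum>i\<in>I. euler_char (C i \<inter> {x. b \<bullet> x = t})) = (if l \<le> t \<and> t < r then 1 else 0)"
  shows "(\<Sum>i\<in>I. euler_char (C i)) = 0"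
proof -
  obtain D \<epsilon> where "finite D" "{l, r} \<subseteq> D" "gapped D \<epsilon>"
    "(\<Sum>i\<in>I. euler_char (C i)) = jump_sum D \<epsilon> (\<lambda>t. if l \<le> t \<and> t < r then 1 else 0)"
    using euler_char_sum_slice[OF assms, of "{l, r}"] by blast
  then show ?thesis using jump_sum_half_open[of D \<epsilon> l r 1] by simp
qed

lemma euler_char_sum_compact:
  fixes C :: "'i \<Rightarrow> 'a::euclidean_space set"
  assumes I: "finite I" "\<And>i. i \<in> I \<Longrightarrow> relopen_bounded (C i)"
    and P: "compact P" "convex P"
    and s: "\<And>t. (\<Sum>i\<in>I. euler_char (C i \<inter> {x. b \<bullet> x = t})) = (if P \<inter> {x. b \<bullet> x = t} = {} then 0 else 1)"
  shows "(\<Sum>i\<in>I. euler_char (C i)) = (if P = {} then 0 else 1)"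
proof (cases "P = {}")
  case True
  then show ?thesis using euler_char_sum_zero[OF I, where b=b] s by simp
next
  case False
  let ?J = "(\<bullet>) b ` P"
  have "compact ?J" using P(1) by (intro compact_continuous_image continuous_intros)
  moreover have "convex ?J" using P(2) by (intro convex_linear_image bounded_linear.linear bounded_linear_inner_right)
  ultimately obtain l r where J: "?J = {l..r}"
    by (metis connected_compact_interval_1 convex_connected)
  have lr: "l \<le> r" using J False by (metis atLeastatMost_empty_iff image_is_empty)
  have "P \<inter> {x. b \<bullet> x = t} = {} \<longleftrightarrow> \<not> (l \<le> t \<and> t \<le> r)" for t
  proof -
    have "P \<inter> {x. b \<bullet> x = t} = {} \<longleftrightarrow> t \<notin> ?J" by auto
    then show ?thesis unfolding J by simp
  qed
  then have s': "(\<Sum>i\<in>I. euler_char (C i \<inter> {x. b \<bullet> x = t})) = (if l \<le> t \<and> t \<le> r then 1 else 0)" for t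
    unfolding s by simp
  obtain D \<epsilon> where "finite D" "{l, r} \<subseteq> D" "gapped D \<epsilon>"
    "(\<Sum>i\<in>I. euler_char (C i)) = jump_sum D \<epsilon> (\<lambda>t. if l \<le> t \<and> t \<le> r then 1 else 0)"
    using euler_char_sum_slice[OF I s', of "{l, r}"] by blast
  then show ?thesis using jump_sum_closed[of D \<epsilon> l r 1] lr False by simp
qed

section \<open>Euler's relation\<close>

definition nonempty_faces :: "'a::euclidean_space set \<Rightarrow> 'a set set" where
  "nonempty_faces P = {F. F face_of P \<and> F \<noteq> {}}"

lemma finite_nonempty_faces: "polytope P \<Longrightarrow> finite (nonempty_faces P)"
  unfolding nonempty_faces_def by (rule finite_subset[OF _ finite_polytope_faces]) auto

lemma relopen_bounded_face:
  assumes "polytope P" "F face_of P" shows "relopen_bounded (rel_interior F)"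
  using assms unfolding relopen_bounded_def
  by (metis bounded_subset convex_rel_interior face_of_imp_convex face_of_polytope_polytope
      polytope_imp_bounded rel_interior_rel_interior rel_interior_subset)

lemma euler_char_rel_interior:
  assumes "F face_of P" "F \<noteq> {}"
  shows "euler_char (rel_interior F) = (-1) ^ nat (aff_dim F)"
  using assms face_of_imp_convex[OF assms(1)]
  by (simp add: euler_char_def rel_interior_eq_empty rel_interior_aff_dim)

text \<open>Relative interiors of distinct faces are disjoint, so at most one summand differs from
  0.\<close>

lemma euler_char_faces_point:
  fixes P :: "'a::euclidean_space set"
  assumes P: "polytope P"
  shows "(\<Sum>F\<in>{F \<in> nonempty_faces P. Q F}. euler_char (rel_interior F \<inter> {z})) =
    (if \<exists>F. F face_of P \<and> z \<in> rel_interior F \<and> Q F then 1 else 0)"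
proof (cases "\<exists>F. F face_of P \<and> z \<in> rel_interior F \<and> Q F")
  case True
  then obtain F where F: "F face_of P" "z \<in> rel_interior F" "Q F" by blast
  have "F \<noteq> {}" using F(2) by auto
  have "(\<Sum>F\<in>{F \<in> nonempty_faces P. Q F}. euler_char (rel_interior F \<inter> {z})) =
     (\<Sum>G\<in>{F \<in> nonempty_faces P. Q F}. if G = F then 1 else 0)"
  proof (rule sum.cong)
    fix G assume "G \<in> {F \<in> nonempty_faces P. Q F}"
    then have G: "G face_of P" by (simp add: nonempty_faces_def)
    show "euler_char (rel_interior G \<inter> {z}) = (if G = F then 1 else 0)"
    proof (cases "G = F")
      case True
      then have "rel_interior G \<inter> {z} = {z}" using F by auto
      then show ?thesis using True by simp
    next
      case False
      then have "rel_interior G \<inter> {z} = {}" using face_of_eq[OF G F(1)] F(2) by blast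
      then show ?thesis using False by simp
    qed
  qed simp
  also have "\<dots> = 1"
  proof -
    have "F \<in> {F \<in> nonempty_faces P. Q F}" using F \<open>F \<noteq> {}\<close> by (simp add: nonempty_faces_def)
    moreover have "finite {F \<in> nonempty_faces P. Q F}" using finite_nonempty_faces[OF P] by simp
    ultimately show ?thesis by simp
  qed
  finally show ?thesis using True by simp
next
  case False
  have "euler_char (rel_interior F \<inter> {z}) = 0" if "F \<in> {F \<in> nonempty_faces P. Q F}" for F
  proof -
    have "z \<notin> rel_interior F" using that False unfolding nonempty_faces_def by blast
    then have "rel_interior F \<inter> {z} = {}" by blast
    then show ?thesis by simp
  qed
  then have "(\<Sum>F\<in>{F \<in> nonempty_faces P. Q F}. euler_char (rel_interior F \<inter> {z})) = 0" by (rule sum.neutral[OF ballI])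
  then show ?thesis using False by simp
qed

text \<open>
  With \<open>B\<close> running through the subsets of an orthogonal basis, the flats range from points to the
  whole space; the Euler characteristic is computed by releasing one coordinate at a time.
\<close>

definition flat :: "'a::euclidean_space set \<Rightarrow> 'a \<Rightarrow> 'a set" where
  "flat B z = {x. \<forall>b\<in>B. b \<bullet> x = b \<bullet> z}"

lemma affine_flat: "affine (flat B z)"
proof -
  have "flat B z = (\<Inter>b\<in>B. {x. b \<bullet> x = b \<bullet> z})" by (auto simp: flat_def)
  then show ?thesis by (auto intro!: affine_Inter affine_hyperplane)
qed

lemma flat_empty [simp]: "flat {} z = UNIV" by (simp add: flat_def)

lemma flat_span:
  fixes B :: "'a::euclidean_space set"
  assumes "span B = UNIV" shows "flat B z = {z}"
proof -
  have "x = z" if "\<forall>b\<in>B. b \<bullet> x = b \<bullet> z" for x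
  proof -
    have "orthogonal (x - z) y" if "y \<in> span B" for y
      using that \<open>\<forall>b\<in>B. _\<close>
      by (intro orthogonal_to_span[of y B]) (auto simp: orthogonal_def inner_diff_left inner_diff_right inner_commute)
    then have "orthogonal (x - z) (x - z)" using assms by auto
    then show ?thesis by (simp add: orthogonal_def)
  qed
  then show ?thesis by (auto simp: flat_def)
qed

lemma flat_slice:
  fixes b :: "'a::euclidean_space"
  assumes "b \<noteq> 0" "\<forall>c\<in>B. orthogonal c b"
  shows "flat B z \<inter> {x. b \<bullet> x = t} = flat (insert b B) (z + ((t - b \<bullet> z) / (b \<bullet> b)) *\<^sub>R b)"
  using assms by (auto simp: flat_def orthogonal_def inner_add_right)

text \<open>\<open>K\<close> holds the released coordinates. A slice along \<open>b\<close> is a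
  flat with one free coordinate less, but through a shifted base point; hence the induction is over
  all \<open>z\<close>.\<close>

lemma euler_flats:
  fixes P :: "'a::euclidean_space set"
  assumes P: "polytope P" and S: "finite S" "pairwise orthogonal S" "0 \<notin> S" "span S = UNIV"
    and K: "K \<subseteq> S"
  shows "(\<Sum>F\<in>nonempty_faces P. euler_char (rel_interior F \<inter> flat (S - K) z)) = (if P \<inter> flat (S - K) z = {} then 0 else 1)"
  using finite_subset[OF K S(1)] K
proof (induction K arbitrary: z rule: finite_induct)
  case empty
  have "(\<exists>F. F face_of P \<and> z \<in> rel_interior F) \<longleftrightarrow> z \<in> P"
  proof
    assume "z \<in> P"
    then show "\<exists>F. F face_of P \<and> z \<in> rel_interior F" using point_in_rel_interior_face[OF P] by metis
  qed (meson face_of_imp_subset rel_interior_subset subsetD)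
  then have "(\<Sum>F\<in>nonempty_faces P. euler_char (rel_interior F \<inter> {z})) = (if z \<in> P then 1 else 0)"
    using euler_char_faces_point[OF P, where Q="\<lambda>_. True" and z=z] by (simp only: simp_thms Collect_mem_eq)
  then show ?case using flat_span[OF S(4), of z] by simp
next
  case (insert b K)
  let ?B = "S - insert b K"
  have b: "b \<noteq> 0" "\<forall>c\<in>?B. orthogonal c b" and ins: "insert b ?B = S - K"
    using insert S by (auto simp: pairwise_def)
  show ?case
  proof (rule euler_char_sum_compact[where b=b])
    show "finite (nonempty_faces P)" by (rule finite_nonempty_faces[OF P])
    show "relopen_bounded (rel_interior F \<inter> flat ?B z)" if "F \<in> nonempty_faces P" for F
      using that relopen_bounded_face[OF P] by (intro relopen_bounded_Int_affine affine_flat) (auto simp: nonempty_faces_def)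
    show "compact (P \<inter> flat ?B z)"
      using P by (intro compact_Int_closed polytope_imp_compact affine_closed affine_flat)
    show "convex (P \<inter> flat ?B z)"
      using P by (intro convex_Int polytope_imp_convex affine_imp_convex affine_flat)
    fix t
    have sl: "flat ?B z \<inter> {x. b \<bullet> x = t} = flat (S - K) (z + ((t - b \<bullet> z) / (b \<bullet> b)) *\<^sub>R b)"
      using flat_slice[OF b, of z t] ins by simp
    show "(\<Sum>F\<in>nonempty_faces P. euler_char (rel_interior F \<inter> flat ?B z \<inter> {x. b \<bullet> x = t})) =
      (if P \<inter> flat ?B z \<inter> {x. b \<bullet> x = t} = {} then 0 else 1)"
      using insert.IH insert.prems unfolding Int_assoc sl by simp
  qed
qed

theorem euler_polytope:
  fixes P :: "'a::euclidean_space set"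
  assumes P: "polytope P" "P \<noteq> {}"
  shows "(\<Sum>F\<in>nonempty_faces P. (-1) ^ nat (aff_dim F)) = (1::real)"
proof -
  obtain a :: 'a where "a \<noteq> 0" using nonempty_Basis nonzero_Basis by blast
  then obtain S where S: "finite S" "pairwise orthogonal S" "0 \<notin> S" "span S = (UNIV :: 'a set)"
    using vector_in_orthogonal_basis by metis
  have "(\<Sum>F\<in>nonempty_faces P. euler_char (rel_interior F)) = 1"
    using euler_flats[OF P(1) S order_refl] P(2) by simp
  moreover have "(\<Sum>F\<in>nonempty_faces P. euler_char (rel_interior F)) = (\<Sum>F\<in>nonempty_faces P. (-1) ^ nat (aff_dim F))"
    by (intro sum.cong) (auto simp: nonempty_faces_def euler_char_rel_interior[of _ P])
  ultimately show ?thesis by simp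
qed

section \<open>Gram's relation\<close>

lemma feasible_dirs_line_points:
  fixes P :: "'a::euclidean_space set"
  assumes P: "compact P" "convex P" and u: "u \<noteq> 0"
  obtains l r where "\<And>t. z + t *\<^sub>R u \<in> P \<and> u \<in> feasible_dirs P (z + t *\<^sub>R u) \<longleftrightarrow> l \<le> t \<and> t < r"
proof -
  define J where "J = {t. z + t *\<^sub>R u \<in> P}"
  have mem: "z + t *\<^sub>R u \<in> P \<and> u \<in> feasible_dirs P (z + t *\<^sub>R u) \<longleftrightarrow> t \<in> J \<and> (\<exists>e>0. t + e \<in> J)" for t
    by (simp add: J_def feasible_dirs_def algebra_simps)
  have Jeq: "J = (\<lambda>t. z + t *\<^sub>R u) -` P" by (auto simp: J_def)
  have "closed J" unfolding Jeq using P
    by (intro continuous_closed_vimage) (auto intro!: continuous_intros simp: compact_imp_closed)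
  moreover have "bounded J"
  proof -
    obtain B where B: "\<And>x. x \<in> P \<Longrightarrow> norm x \<le> B" using P(1) compact_imp_bounded bounded_iff by metis
    have "\<bar>t\<bar> \<le> (B + norm z) / norm u" if "t \<in> J" for t
    proof -
      have "norm (t *\<^sub>R u) \<le> norm (z + t *\<^sub>R u) + norm z" by (metis add_diff_cancel_left' norm_triangle_ineq4)
      also have "\<dots> \<le> B + norm z" using B that by (simp add: J_def)
      finally show ?thesis using u by (simp add: field_simps)
    qed
    then show ?thesis unfolding bounded_iff by auto
  qed
  ultimately have cJ: "compact J" by (simp add: compact_eq_bounded_closed)
  have conv: "convex J"
  proof (rule convexI)
    fix s t a c :: real assume st: "s \<in> J" "t \<in> J" "0 \<le> a" "0 \<le> c" "a + c = 1"
    have "a *\<^sub>R (z + s *\<^sub>R u) + c *\<^sub>R (z + t *\<^sub>R u) \<in> P"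
      using st P(2) by (intro convexD) (auto simp: J_def)
    also have "a *\<^sub>R (z + s *\<^sub>R u) + c *\<^sub>R (z + t *\<^sub>R u) = (a + c) *\<^sub>R z + (a *\<^sub>R s + c *\<^sub>R t) *\<^sub>R u"
      by (simp add: algebra_simps)
    finally show "a *\<^sub>R s + c *\<^sub>R t \<in> J" using st by (simp add: J_def)
  qed
  \<comment> \<open>If the line misses \<open>P\<close>, then \<open>J\<close> is empty and
    \<open>l > r\<close>. Otherwise the last point of \<open>J\<close> has to be dropped, since it
    cannot be moved along \<open>u\<close>.\<close>
  obtain l r where J: "J = {l..r}"
    using cJ conv by (metis connected_compact_interval_1 convex_connected)
  have "t \<in> J \<and> (\<exists>e>0. t + e \<in> J) \<longleftrightarrow> l \<le> t \<and> t < r" for t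
    unfolding J by (auto intro!: exI[of _ "r - t"])
  then show ?thesis using that mem by simp
qed

text \<open>The direction \<open>u\<close> is released first, while all other coordinates are fixed:
  on a line parallel to \<open>u\<close> the relevant faces cut out a half-open segment, with sum 0.
  For every further coordinate all slices already have sum 0.\<close>

lemma gram_flats:
  fixes P :: "'a::euclidean_space set"
  assumes P: "polytope P" and S: "finite S" "pairwise orthogonal S" "0 \<notin> S" "span S = UNIV"
    and K: "K \<subseteq> S - {u}" and u: "u \<in> S"
  shows "(\<Sum>F\<in>{F \<in> nonempty_faces P. u \<in> face_cone F P}. euler_char (rel_interior F \<inter> flat (S - insert u K) z)) = 0"
  using finite_subset[OF K finite_Diff[OF S(1)]] K
proof (induction K arbitrary: z rule: finite_induct)
  case empty
  have u0: "u \<noteq> 0" "\<forall>c\<in>S - {u}. orthogonal c u" and ins: "insert u (S - {u}) = S"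
    using u S by (auto simp: pairwise_def)
  have cP: "compact P" "convex P" using P by (auto intro: polytope_imp_compact polytope_imp_convex)
  \<comment> \<open>\<open>w\<close> is the point of the line with \<open>u \<bullet> w = 0\<close>,
    and \<open>v\<close> below satisfies \<open>u \<bullet> v = 1\<close>; so the parameter
    \<open>t\<close> is the value of \<open>u\<close> that a slice fixes.\<close>
  define w where "w = z - ((u \<bullet> z) / (u \<bullet> u)) *\<^sub>R u"
  have zw: "z + ((t - u \<bullet> z) / (u \<bullet> u)) *\<^sub>R u = w + t *\<^sub>R ((1 / (u \<bullet> u)) *\<^sub>R u)" for t
    by (simp add: w_def algebra_simps diff_divide_distrib)
  define v where "v = (1 / (u \<bullet> u)) *\<^sub>R u"
  have v0: "v \<noteq> 0" using u0 by (simp add: v_def)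
  have uv: "u = (u \<bullet> u) *\<^sub>R v" "u \<bullet> u > 0" using u0 by (simp_all add: v_def)
  have uvf: "u \<in> feasible_dirs P x \<longleftrightarrow> v \<in> feasible_dirs P x" for x
    using feasible_dirs_scale[of u P x "1 / (u \<bullet> u)"] feasible_dirs_scale[of v P x "u \<bullet> u"] uv v_def by auto
  obtain l r where lr: "\<And>t. w + t *\<^sub>R v \<in> P \<and> v \<in> feasible_dirs P (w + t *\<^sub>R v) \<longleftrightarrow> l \<le> t \<and> t < r"
    using feasible_dirs_line_points[OF cP v0] by blast
  show ?case
  proof (rule euler_char_sum_half_open[where b=u and l=l and r=r])
    show "finite {F \<in> nonempty_faces P. u \<in> face_cone F P}" using finite_nonempty_faces[OF P] by simp
    show "relopen_bounded (rel_interior F \<inter> flat (S - {u}) z)" if "F \<in> {F \<in> nonempty_faces P. u \<in> face_cone F P}" for F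
      using that relopen_bounded_face[OF P] by (intro relopen_bounded_Int_affine affine_flat) (auto simp: nonempty_faces_def)
    fix t
    let ?x = "w + t *\<^sub>R v"
    have "(\<exists>F. F face_of P \<and> ?x \<in> rel_interior F \<and> u \<in> face_cone F P) \<longleftrightarrow> ?x \<in> P \<and> v \<in> feasible_dirs P ?x"
    proof
      assume "\<exists>F. F face_of P \<and> ?x \<in> rel_interior F \<and> u \<in> face_cone F P"
      then obtain F where F: "F face_of P" "?x \<in> rel_interior F" "u \<in> face_cone F P" by blast
      then show "?x \<in> P \<and> v \<in> feasible_dirs P ?x"
        using face_cone_eq[OF cP(2) F(1,2)] uvf face_of_imp_subset[OF F(1)] rel_interior_subset by blast
    next
      assume x: "?x \<in> P \<and> v \<in> feasible_dirs P ?x"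
      then obtain F where F: "F face_of P" "?x \<in> rel_interior F" using point_in_rel_interior_face[OF P] by blast
      then show "\<exists>F. F face_of P \<and> ?x \<in> rel_interior F \<and> u \<in> face_cone F P"
        using face_cone_eq[OF cP(2) F] uvf x by blast
    qed
    then have *: "(\<exists>F. F face_of P \<and> ?x \<in> rel_interior F \<and> u \<in> face_cone F P) \<longleftrightarrow> l \<le> t \<and> t < r"
      using lr by simp
    have "flat (S - {u}) z \<inter> {x. u \<bullet> x = t} = {?x}"
      unfolding flat_slice[OF u0] ins flat_span[OF S(4)] zw v_def ..
    then have "(\<Sum>F\<in>{F \<in> nonempty_faces P. u \<in> face_cone F P}. euler_char (rel_interior F \<inter> flat (S - {u}) z \<inter> {x. u \<bullet> x = t}))
      = (\<Sum>F\<in>{F \<in> nonempty_faces P. u \<in> face_cone F P}. euler_char (rel_interior F \<inter> {?x}))"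
      by (simp add: Int_assoc)
    then show "(\<Sum>F\<in>{F \<in> nonempty_faces P. u \<in> face_cone F P}. euler_char (rel_interior F \<inter> flat (S - {u}) z \<inter> {x. u \<bullet> x = t}))
      = (if l \<le> t \<and> t < r then 1 else 0)"
      unfolding euler_char_faces_point[OF P] * .
  qed
next
  case (insert b K)
  let ?B = "S - insert u (insert b K)"
  have b: "b \<noteq> 0" "\<forall>c\<in>?B. orthogonal c b" and ins: "insert b ?B = S - insert u K"
    using insert S by (auto simp: pairwise_def)
  show ?case
  proof (rule euler_char_sum_zero[where b=b])
    show "finite {F \<in> nonempty_faces P. u \<in> face_cone F P}" using finite_nonempty_faces[OF P] by simp
    show "relopen_bounded (rel_interior F \<inter> flat ?B z)" if "F \<in> {F \<in> nonempty_faces P. u \<in> face_cone F P}" for F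
      using that relopen_bounded_face[OF P] by (intro relopen_bounded_Int_affine affine_flat) (auto simp: nonempty_faces_def)
    fix t
    have sl: "flat ?B z \<inter> {x. b \<bullet> x = t} = flat (S - insert u K) (z + ((t - b \<bullet> z) / (b \<bullet> b)) *\<^sub>R b)"
      using flat_slice[OF b, of z t] ins by simp
    show "(\<Sum>F\<in>{F \<in> nonempty_faces P. u \<in> face_cone F P}. euler_char (rel_interior F \<inter> flat ?B z \<inter> {x. b \<bullet> x = t})) = 0"
      using insert.IH insert.prems unfolding Int_assoc sl by simp
  qed
qed

text \<open>Some orthogonal basis contains \<open>u\<close>, and with all coordinates released the
  flat is the whole space. The direction 0 is a true exception: it lies in the cone of every
  nonempty face, and for nonempty \<open>P\<close> the sum is Euler's 1.\<close>

lemma gram_pointwise: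
  fixes P :: "'a::euclidean_space set"
  assumes P: "polytope P" and u: "u \<noteq> 0"
  shows "(\<Sum>F\<in>nonempty_faces P. (-1) ^ nat (aff_dim F) * indicat_real (face_cone F P) u) = 0"
proof -
  obtain S where S: "u \<in> S" "finite S" "pairwise orthogonal S" "0 \<notin> S" "span S = UNIV"
    using vector_in_orthogonal_basis[OF u] by metis
  have "(\<Sum>F\<in>{F \<in> nonempty_faces P. u \<in> face_cone F P}. euler_char (rel_interior F)) = 0"
    using gram_flats[OF P S(2-5) order_refl S(1)] S(1) by (simp add: insert_absorb)
  moreover have "(\<Sum>F\<in>nonempty_faces P. (-1) ^ nat (aff_dim F) * indicat_real (face_cone F P) u) =
    (\<Sum>F\<in>{F \<in> nonempty_faces P. u \<in> face_cone F P}. euler_char (rel_interior F))"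
    using finite_nonempty_faces[OF P]
    by (intro sum.mono_neutral_cong_right) (auto simp: nonempty_faces_def euler_char_rel_interior[of _ P] indicator_def split: if_splits)
  ultimately show ?thesis by simp
qed

lemma convex_face_cone:
  assumes "convex P" "F face_of P" "F \<noteq> {}" shows "convex (face_cone F P)"
proof -
  obtain x where x: "x \<in> rel_interior F"
    using assms face_of_imp_convex rel_interior_eq_empty by blast
  then have "x \<in> P" using assms face_of_imp_subset rel_interior_subset by blast
  then show ?thesis using convex_feasible_dirs face_cone_eq assms x by metis
qed

lemma lmeasurable_face_cone_ball:
  assumes "convex P" "F face_of P" "F \<noteq> {}" shows "face_cone F P \<inter> cball 0 1 \<in> lmeasurable"
  using convex_face_cone[OF assms] by (intro measurable_convex convex_Int convex_cball) (simp_all add: bounded_Int)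

theorem gram_polytope:
  fixes P :: "'a::euclidean_space set"
  assumes P: "polytope P"
  shows "(\<Sum>F\<in>nonempty_faces P. (-1) ^ nat (aff_dim F) * interior_angle F P) = 0"
proof -
  have cP: "convex P" using P by (rule polytope_imp_convex)
  let ?g = "\<lambda>F. indicat_real (face_cone F P \<inter> cball 0 1)"
  have int: "integrable lebesgue (?g F)" if "F \<in> nonempty_faces P" for F
    using lmeasurable_face_cone_ball[OF cP, of F] that
    by (auto simp: nonempty_faces_def fmeasurable_def)
  have "(\<Sum>F\<in>nonempty_faces P. (-1) ^ nat (aff_dim F) * measure lebesgue (face_cone F P \<inter> cball 0 1))
     = (\<Sum>F\<in>nonempty_faces P. (-1) ^ nat (aff_dim F) * (\<integral>u. ?g F u \<partial>lebesgue))"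
    by simp
  also have "\<dots> = (\<integral>u. (\<Sum>F\<in>nonempty_faces P. (-1) ^ nat (aff_dim F) * ?g F u) \<partial>lebesgue)"
    using int by (subst Bochner_Integration.integral_sum) auto
  also have "\<dots> = (\<integral>u. 0 \<partial>(lebesgue :: 'a measure))"
  proof (rule integral_cong_AE)
    show "AE u in lebesgue. (\<Sum>F\<in>nonempty_faces P. (-1) ^ nat (aff_dim F) * ?g F u) = 0"
    proof (rule AE_I')
      show "{0::'a} \<in> null_sets lebesgue" using negligible_sing negligible_iff_null_sets by blast
      show "{u \<in> space lebesgue. (\<Sum>F\<in>nonempty_faces P. (-1) ^ nat (aff_dim F) * ?g F u) \<noteq> 0} \<subseteq> {0}"
      proof
        fix u assume u: "u \<in> {u \<in> space lebesgue. (\<Sum>F\<in>nonempty_faces P. (-1) ^ nat (aff_dim F) * ?g F u) \<noteq> 0}"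
        have "(\<Sum>F\<in>nonempty_faces P. (-1) ^ nat (aff_dim F) * ?g F u) =
          (\<Sum>F\<in>nonempty_faces P. (-1) ^ nat (aff_dim F) * indicat_real (face_cone F P) u) * indicat_real (cball 0 1) u"
          unfolding sum_distrib_right by (intro sum.cong) (auto simp: indicator_def)
        then show "u \<in> {0}" using u gram_pointwise[OF P, of u] by auto
      qed
    qed
    show "(\<lambda>u. \<Sum>F\<in>nonempty_faces P. (-1) ^ nat (aff_dim F) * ?g F u) \<in> borel_measurable lebesgue"
      using int by (intro borel_measurable_integrable Bochner_Integration.integrable_sum) auto
  qed auto
  finally have *: "(\<Sum>F\<in>nonempty_faces P. (-1) ^ nat (aff_dim F) * measure lebesgue (face_cone F P \<inter> cball 0 1)) = 0"
    by simp
  have "(\<Sum>F\<in>nonempty_faces P. (-1) ^ nat (aff_dim F) * interior_angle F P) =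
    (\<Sum>F\<in>nonempty_faces P. (-1) ^ nat (aff_dim F) * measure lebesgue (face_cone F P \<inter> cball 0 1)) /
      measure lebesgue (cball 0 1 :: 'a set)"
    unfolding sum_divide_distrib by (intro sum.cong) (auto simp: nonempty_faces_def interior_angle_eq[OF P])
  then show ?thesis using * by simp
qed

section \<open>Face numbers and angle sums by dimension; the two top angle sums\<close>

lemma faces_of_dim_mem:
  fixes P :: "'a::euclidean_space set"
  shows "F \<in> faces_of_dim i P \<longleftrightarrow> F \<in> nonempty_faces P \<and> nat (aff_dim F) = i"
\<comment> \<open>\<open>nat\<close> sends the dimension -1 of the empty face to 0; unless excluded,
  the empty set would count as a vertex.\<close>
proof (cases "F = {}")
  case False
  then have "aff_dim F \<ge> 0" using aff_dim_empty[of F] aff_dim_geq[of F] by linarith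
  then show ?thesis using False by (auto simp: faces_of_dim_def nonempty_faces_def)
qed (auto simp: faces_of_dim_def nonempty_faces_def)

lemma sum_nonempty_faces:
  fixes P :: "'a::euclidean_space set" and h :: "'a set \<Rightarrow> 'b::comm_monoid_add"
  assumes "polytope P"
  shows "(\<Sum>i\<le>DIM('a). \<Sum>F\<in>faces_of_dim i P. h F) = (\<Sum>F\<in>nonempty_faces P. h F)"
proof -
  have "nat (aff_dim F) \<le> DIM('a)" for F :: "'a set" using aff_dim_le_DIM[of F] by simp
  then have "(\<Sum>i\<le>DIM('a). \<Sum>F\<in>{F \<in> nonempty_faces P. nat (aff_dim F) = i}. h F) = (\<Sum>F\<in>nonempty_faces P. h F)"
    using finite_nonempty_faces[OF assms] by (intro sum.group) auto
  moreover have "{F \<in> nonempty_faces P. nat (aff_dim F) = i} = faces_of_dim i P" for i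
    by (auto simp: faces_of_dim_mem)
  ultimately show ?thesis by simp
qed

lemma euler_relation:
  fixes P :: "'a::euclidean_space set"
  assumes P: "polytope P" "P \<noteq> {}"
  shows "(\<Sum>i\<le>DIM('a). (-1) ^ i * real (face_number i P)) = 1"
proof -
  have "(\<Sum>i\<le>DIM('a). (-1) ^ i * real (face_number i P))
    = (\<Sum>i\<le>DIM('a). \<Sum>F\<in>faces_of_dim i P. (-1) ^ nat (aff_dim F))"
    by (intro sum.cong) (auto simp: faces_of_dim_mem face_number_def)
  then show ?thesis using sum_nonempty_faces[OF P(1)] euler_polytope[OF P] by metis
qed

lemma gram_relation:
  fixes P :: "'a::euclidean_space set"
  assumes P: "polytope P"
  shows "(\<Sum>i\<le>DIM('a). (-1) ^ i * angle_sum i P) = 0"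
proof -
  have "(\<Sum>i\<le>DIM('a). (-1) ^ i * angle_sum i P)
    = (\<Sum>i\<le>DIM('a). \<Sum>F\<in>faces_of_dim i P. (-1) ^ nat (aff_dim F) * interior_angle F P)"
    unfolding angle_sum_def sum_distrib_left by (intro sum.cong) (auto simp: faces_of_dim_mem)
  then show ?thesis using sum_nonempty_faces[OF P] gram_polytope[OF P] by metis
qed

lemma faces_of_full_dim:
  fixes P :: "'a::euclidean_space set"
  assumes "convex P" "aff_dim P = int DIM('a)"
  shows "faces_of_dim DIM('a) P = {P}"
proof (intro equalityI subsetI)
  fix F assume "F \<in> faces_of_dim DIM('a) P"
  then show "F \<in> {P}" using face_of_aff_dim_lt[OF assms(1), of F] assms(2) by (auto simp: faces_of_dim_def)
qed (use assms in \<open>auto simp: faces_of_dim_def face_of_refl\<close>)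

lemma face_number_full: 
  fixes P :: "'a::euclidean_space set"
  assumes "convex P" "aff_dim P = int DIM('a)"
  shows "face_number DIM('a) P = 1"
  by (simp add: face_number_def faces_of_full_dim[OF assms])

lemma step_in_ball:
  fixes u :: "'a::real_normed_vector"
  assumes "e > 0" obtains s where "s > 0" "x + s *\<^sub>R u \<in> ball x e"
proof (cases "u = 0")
  case True
  then show ?thesis using that[of 1] assms by simp
next
  case False
  then show ?thesis using that[of "e / (2 * norm u)"] assms by (simp add: dist_norm)
qed

lemma angle_sum_full:
  fixes P :: "'a::euclidean_space set"
  assumes P: "polytope P" and d: "aff_dim P = int DIM('a)"
  shows "angle_sum DIM('a) P = 1"
proof -
  have cP: "convex P" using P by (rule polytope_imp_convex)
  have ne: "P \<noteq> {}" using d by auto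
  then obtain x where x: "x \<in> rel_interior P" using cP rel_interior_eq_empty by blast
  have "feasible_dirs P x = UNIV"
  proof -
    have "interior P = rel_interior P"
      using d by (simp add: interior_rel_interior_gen)
    then obtain e where e: "e > 0" "ball x e \<subseteq> P" using x mem_interior by blast
    have "\<exists>s>0. x + s *\<^sub>R u \<in> P" for u
    proof -
      obtain s where "s > 0" "x + s *\<^sub>R u \<in> ball x e" using step_in_ball[OF e(1)] .
      then show ?thesis using e by blast
    qed
    then show ?thesis unfolding feasible_dirs_def by blast
  qed
  then have "interior_angle P P = 1"
    using interior_angle_eq[OF P face_of_refl[OF cP] ne] face_cone_eq[OF cP face_of_refl[OF cP] x]
      unit_ball_measure_pos[where 'a='a] by simp
  then show ?thesis by (simp add: angle_sum_def faces_of_full_dim[OF cP d])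
qed

text \<open>Two halfspaces that differ by a null set suffice for the angle. A direction
  \<open>u\<close> with \<open>a \<bullet> u < 0\<close> is the sum of a direction within the facet
  and a positive multiple of the direction to a point \<open>z\<close> of \<open>P\<close> off the
  facet.\<close>

lemma facet_feasible_dirs:
  fixes P :: "'a::euclidean_space set"
  assumes P: "polytope P" and d: "aff_dim P = int DIM('a)"
    and F: "F face_of P" "aff_dim F = int DIM('a) - 1" and x: "x \<in> rel_interior F"
  obtains a where "a \<noteq> 0" "{u. a \<bullet> u < 0} \<subseteq> feasible_dirs P x" "feasible_dirs P x \<subseteq> {u. a \<bullet> u \<le> 0}"
proof -
  have cP: "convex P" using P by (rule polytope_imp_convex)
  have "F \<noteq> P" "F \<noteq> {}" using F d x by auto
  moreover have "F exposed_face_of P"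
    using exposed_face_of_polyhedron[OF polytope_imp_polyhedron[OF P]] F(1) by blast
  ultimately obtain a b where a: "a \<noteq> 0" "P \<subseteq> {x. a \<bullet> x \<le> b}" "F = P \<inter> {x. a \<bullet> x = b}"
    unfolding exposed_face_of by blast
  have xF: "x \<in> F" using x rel_interior_subset by blast
  have xb: "a \<bullet> x = b" "x \<in> P" using xF a(3) by auto
  have hull: "affine hull F = {x. a \<bullet> x = b}"
  proof (rule affine_dim_equal)
    show "affine hull F \<subseteq> {x. a \<bullet> x = b}" using a(3) by (intro hull_minimal affine_hyperplane) auto
    show "aff_dim (affine hull F) = aff_dim {x. a \<bullet> x = b}" using F a(1) by (simp add: aff_dim_hyperplane)
  qed (use \<open>F \<noteq> {}\<close> in \<open>auto simp: affine_hyperplane\<close>)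
  obtain z where z: "z \<in> P" "a \<bullet> z < b"
  proof -
    obtain z where "z \<in> P" "z \<notin> F" using \<open>F \<noteq> P\<close> a(3) by blast
    then show ?thesis using that[of z] a by force
  qed
  show ?thesis
  proof (rule that[OF a(1)])
    show "feasible_dirs P x \<subseteq> {u. a \<bullet> u \<le> 0}"
    proof
      fix u assume "u \<in> feasible_dirs P x"
      then obtain e where e: "e > 0" "x + e *\<^sub>R u \<in> P" by (auto simp: feasible_dirs_def)
      then have "a \<bullet> (x + e *\<^sub>R u) \<le> b" using a(2) by blast
      then have "e * (a \<bullet> u) \<le> 0" using xb by (simp add: inner_add_right)
      then show "u \<in> {u. a \<bullet> u \<le> 0}" using e by (simp add: mult_le_0_iff)
    qed
    show "{u. a \<bullet> u < 0} \<subseteq> feasible_dirs P x"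
    proof
      fix u assume "u \<in> {u. a \<bullet> u < 0}"
      then have u: "a \<bullet> u < 0" by simp
      define l where "l = (a \<bullet> u) / (a \<bullet> (z - x))"
      have azx: "a \<bullet> (z - x) < 0" using z xb by (simp add: inner_diff_right)
      have l: "l > 0" using u azx by (simp add: l_def divide_neg_neg)
      define w where "w = u - l *\<^sub>R (z - x)"
      have aw: "a \<bullet> w = 0" using azx by (simp add: w_def l_def inner_diff_right[of a u])
      obtain e where e: "e > 0" "ball x e \<inter> affine hull F \<subseteq> F" using x mem_rel_interior_ball by blast
      obtain s where s: "s > 0" "x + s *\<^sub>R w \<in> ball x e" using step_in_ball[OF e(1)] .
      note s(2)
      moreover have "x + s *\<^sub>R w \<in> affine hull F" unfolding hull using aw xb by (simp add: inner_add_right)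
      ultimately have "x + s *\<^sub>R w \<in> P" using e face_of_imp_subset[OF F(1)] by blast
      then have wf: "w \<in> feasible_dirs P x" using s unfolding feasible_dirs_def by blast
      have "x + 1 *\<^sub>R (z - x) \<in> P" using z by simp
      then have "z - x \<in> feasible_dirs P x" unfolding feasible_dirs_def using zero_less_one by blast
      then have "l *\<^sub>R (z - x) \<in> feasible_dirs P x" using l by (rule feasible_dirs_scale)
      then have "(1/2) *\<^sub>R w + (1/2) *\<^sub>R (l *\<^sub>R (z - x)) \<in> feasible_dirs P x"
        using wf by (intro convexD convex_feasible_dirs cP xb) auto
      then have "2 *\<^sub>R ((1/2) *\<^sub>R w + (1/2) *\<^sub>R (l *\<^sub>R (z - x))) \<in> feasible_dirs P x" by (rule feasible_dirs_scale) simp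
      moreover have "2 *\<^sub>R ((1/2) *\<^sub>R w + (1/2) *\<^sub>R (l *\<^sub>R (z - x))) = w + l *\<^sub>R (z - x)"
        unfolding scaleR_add_right by simp
      ultimately show "u \<in> feasible_dirs P x" by (simp add: w_def)
    qed
  qed
qed

text \<open>Up to the null hyperplane \<open>a \<bullet> u = 0\<close>, the ball consists of an open
  half ball and its reflection at the origin.\<close>

lemma measure_half_ball:
  fixes a :: "'a::euclidean_space"
  assumes a: "a \<noteq> 0" and T: "{u. a \<bullet> u < 0} \<subseteq> T" "T \<subseteq> {u. a \<bullet> u \<le> 0}"
  shows "measure lebesgue (T \<inter> cball 0 1) = measure lebesgue (cball 0 1 :: 'a set) / 2"
proof -
  define H where "H = {u. a \<bullet> u < 0} \<inter> cball 0 1"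
  have neg: "negligible {u. a \<bullet> u = 0}" using a by (intro negligible_hyperplane) auto
  have Hm: "H \<in> lmeasurable" unfolding H_def
    by (intro measurable_convex convex_Int convex_cball convex_halfspace_lt) (simp_all add: bounded_Int)
  have HT: "measure lebesgue (T \<inter> cball 0 1) = measure lebesgue H"
  proof (rule measure_negligible_symdiff[OF Hm])
    show "negligible (H - T \<inter> cball 0 1 \<union> (T \<inter> cball 0 1 - H))"
      by (rule negligible_subset[OF neg]) (use T in \<open>auto simp: H_def\<close>)
  qed
  have mH: "(\<lambda>u. (-1) *\<^sub>R u + 0) ` H = {u. a \<bullet> u > 0} \<inter> cball 0 1"
  proof (intro equalityI subsetI)
    fix u assume "u \<in> {u. a \<bullet> u > 0} \<inter> cball 0 1"
    then have "- u \<in> H" by (simp add: H_def)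
    then have "(-1) *\<^sub>R (- u) + 0 \<in> (\<lambda>u. (-1) *\<^sub>R u + 0) ` H" by (rule imageI)
    then show "u \<in> (\<lambda>u. (-1) *\<^sub>R u + 0) ` H" by simp
  qed (auto simp: H_def)
  have "measure lebesgue ({u. a \<bullet> u > 0} \<inter> cball 0 1) = measure lebesgue H"
    unfolding mH[symmetric] measure_lebesgue_affine by simp
  moreover have H'm: "{u. a \<bullet> u > 0} \<inter> cball 0 1 \<in> lmeasurable"
    by (intro measurable_convex convex_Int convex_cball convex_halfspace_gt) (simp_all add: bounded_Int)
  moreover have "measure lebesgue (H \<union> {u. a \<bullet> u > 0} \<inter> cball 0 1) =
      measure lebesgue H + measure lebesgue ({u. a \<bullet> u > 0} \<inter> cball 0 1)"
  proof -
    have "{u. a \<bullet> u > 0} \<inter> cball 0 1 - H = {u. a \<bullet> u > 0} \<inter> cball 0 1" by (auto simp: H_def)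
    then show ?thesis using measure_Un2[OF Hm H'm] by simp
  qed
  moreover have "measure lebesgue (cball 0 1 :: 'a set) = measure lebesgue (H \<union> {u. a \<bullet> u > 0} \<inter> cball 0 1)"
  proof (rule measure_negligible_symdiff)
    show "H \<union> {u. a \<bullet> u > 0} \<inter> cball 0 1 \<in> lmeasurable" using Hm H'm by (rule fmeasurable.Un)
    show "negligible (H \<union> {u. 0 < a \<bullet> u} \<inter> cball 0 1 - cball 0 1 \<union> (cball 0 1 - (H \<union> {u. 0 < a \<bullet> u} \<inter> cball 0 1)))"
      by (rule negligible_subset[OF neg]) (auto simp: H_def)
  qed
  ultimately show ?thesis using HT by simp
qed

lemma angle_sum_facets:
  fixes P :: "'a::euclidean_space set"
  assumes P: "polytope P" and d: "aff_dim P = int DIM('a)"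
  shows "angle_sum (DIM('a) - 1) P = real (face_number (DIM('a) - 1) P) / 2"
proof -
  have cP: "convex P" using P by (rule polytope_imp_convex)
  have "interior_angle F P = 1/2" if "F \<in> faces_of_dim (DIM('a) - 1) P" for F
  proof -
    have F: "F face_of P" "aff_dim F = int DIM('a) - 1" using that
      by (auto simp: faces_of_dim_def of_nat_diff Suc_le_eq)
    have ne: "F \<noteq> {}" using that by (auto simp: faces_of_dim_def)
    then obtain x where x: "x \<in> rel_interior F"
      using face_of_imp_convex[OF F(1)] rel_interior_eq_empty by blast
    obtain a where a: "a \<noteq> 0" "{u. a \<bullet> u < 0} \<subseteq> feasible_dirs P x" "feasible_dirs P x \<subseteq> {u. a \<bullet> u \<le> 0}"
      using facet_feasible_dirs[OF P d F x] .
    show ?thesis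
      using interior_angle_eq[OF P F(1) ne] face_cone_eq[OF cP F(1) x] measure_half_ball[OF a]
        unit_ball_measure_pos[where 'a='a] by simp
  qed
  then have "angle_sum (DIM('a) - 1) P = (\<Sum>F\<in>faces_of_dim (DIM('a) - 1) P. 1/2)"
    unfolding angle_sum_def by (rule sum.cong[OF refl])
  then show ?thesis by (simp add: face_number_def)
qed

section \<open>Faces of polyhedra given by inequalities\<close>

lemma active_ball:
  fixes a :: "'i \<Rightarrow> 'a::euclidean_space"
  assumes "finite I" "\<forall>i\<in>I. a i \<bullet> x < \<beta> i"
  obtains e where "e > 0" "\<forall>y\<in>ball x e. \<forall>i\<in>I. a i \<bullet> y < \<beta> i"
proof -
  have "open (\<Inter>i\<in>I. {y. a i \<bullet> y < \<beta> i})" using assms(1) by (intro open_INT) (auto intro: open_halfspace_lt)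
  moreover have "x \<in> (\<Inter>i\<in>I. {y. a i \<bullet> y < \<beta> i})" using assms(2) by auto
  ultimately obtain e where "e > 0" "ball x e \<subseteq> (\<Inter>i\<in>I. {y. a i \<bullet> y < \<beta> i})"
    by (meson open_contains_ball)
  then show ?thesis using that[of e] by blast
qed

context
  fixes a :: "'i \<Rightarrow> 'a::euclidean_space" and \<beta> :: "'i \<Rightarrow> real" and I :: "'i set"
begin

definition hpoly :: "'a set" where "hpoly = {x. \<forall>i\<in>I. a i \<bullet> x \<le> \<beta> i}"

definition active :: "'a \<Rightarrow> 'i set" where "active x = {i \<in> I. a i \<bullet> x = \<beta> i}"

definition act_face :: "'i set \<Rightarrow> 'a set" where "act_face S = {x \<in> hpoly. \<forall>i\<in>S. a i \<bullet> x = \<beta> i}"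

definition act_dim :: "'i set \<Rightarrow> nat" where "act_dim S = dim {u. \<forall>i\<in>S. a i \<bullet> u = 0}"

definition act_cone :: "'i set \<Rightarrow> 'a set" where "act_cone S = {u. \<forall>i\<in>S. a i \<bullet> u \<le> 0}"

context
  assumes finI: "finite I"
begin

lemma polyhedron_hpoly: "polyhedron hpoly"
proof -
  have "hpoly = \<Inter>((\<lambda>i. {x. a i \<bullet> x \<le> \<beta> i}) ` I)" by (auto simp: hpoly_def)
  then show ?thesis using finI by (auto intro: polyhedron_Inter polyhedron_halfspace_le)
qed

lemma convex_hpoly: "convex hpoly"
  by (rule polyhedron_imp_convex[OF polyhedron_hpoly])

lemma act_face_face:
  assumes "S \<subseteq> I" shows "act_face S face_of hpoly"
proof -
  have "act_face S = \<Inter>(insert hpoly ((\<lambda>i. hpoly \<inter> {x. a i \<bullet> x = \<beta> i}) ` S))"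
    by (auto simp: act_face_def)
  also have "\<dots> face_of hpoly"
  proof (rule face_of_Inter)
    fix T assume "T \<in> insert hpoly ((\<lambda>i. hpoly \<inter> {x. a i \<bullet> x = \<beta> i}) ` S)"
    then consider "T = hpoly" | i where "i \<in> S" "T = hpoly \<inter> {x. a i \<bullet> x = \<beta> i}" by blast
    then show "T face_of hpoly"
    proof cases
      case 2
      show ?thesis unfolding 2(2)
        by (rule face_of_Int_supporting_hyperplane_le[OF convex_hpoly]) (use 2(1) assms in \<open>auto simp: hpoly_def\<close>)
    qed (simp add: face_of_refl convex_hpoly)
  qed simp
  finally show ?thesis .
qed

lemma inactive_ball:
  assumes x: "x \<in> hpoly"
  obtains e where "e > 0" "\<And>y. y \<in> ball x e \<Longrightarrow> (\<And>i. i \<in> active x \<Longrightarrow> a i \<bullet> y \<le> \<beta> i) \<Longrightarrow> y \<in> hpoly"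
proof -
  have "\<forall>i\<in>I - active x. a i \<bullet> x < \<beta> i" using x by (force simp: active_def hpoly_def)
  then obtain e where e: "e > 0" "\<forall>y\<in>ball x e. \<forall>i\<in>I - active x. a i \<bullet> y < \<beta> i"
    using active_ball[of "I - active x"] finI by blast
  show ?thesis
  proof (rule that[OF e(1)])
    fix y assume y: "y \<in> ball x e" "\<And>i. i \<in> active x \<Longrightarrow> a i \<bullet> y \<le> \<beta> i"
    have "a i \<bullet> y \<le> \<beta> i" if "i \<in> I" for i
      using e(2) y that by (cases "i \<in> active x") (auto intro: less_imp_le)
    then show "y \<in> hpoly" by (simp add: hpoly_def)
  qed
qed

text \<open>Near \<open>x\<close> the inactive constraints hold strictly, so the face coincides
  there with the affine space \<open>?H\<close> cut out by the active ones.\<close>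

lemma act_face_rel_interior:
  assumes x: "x \<in> hpoly"
  shows "x \<in> rel_interior (act_face (active x))" and "aff_dim (act_face (active x)) = int (act_dim (active x))"
proof -
  let ?S = "active x" and ?F = "act_face (active x)"
  let ?H = "{y. \<forall>i\<in>active x. a i \<bullet> y = \<beta> i}"
  have "?H = (\<Inter>i\<in>?S. {y. a i \<bullet> y = \<beta> i})" by blast
  then have affH: "affine ?H" by (auto intro!: affine_Inter affine_hyperplane)
  have xF: "x \<in> ?F" using x by (auto simp: act_face_def active_def)
  then have xH: "x \<in> ?H" by (simp add: act_face_def)
  obtain e where e: "e > 0" "\<And>y. y \<in> ball x e \<Longrightarrow> (\<And>i. i \<in> active x \<Longrightarrow> a i \<bullet> y \<le> \<beta> i) \<Longrightarrow> y \<in> hpoly"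
    using inactive_ball[OF x] by blast
  have sub: "?H \<inter> ball x e \<subseteq> ?F" using e by (auto simp: act_face_def)
  have "?F \<subseteq> ?H" by (auto simp: act_face_def)
  then have h1: "affine hull ?F \<subseteq> ?H" using affH by (rule hull_minimal)
  then have "ball x e \<inter> affine hull ?F \<subseteq> ?F" using sub by blast
  then show "x \<in> rel_interior ?F" using xF e(1) mem_rel_interior_ball by blast
  have "affine hull (?H \<inter> ball x e) = affine hull ?H"
    using xH e(1) by (intro affine_hull_affine_Int_open affH open_ball) auto
  then have "?H \<subseteq> affine hull ?F" using hull_mono[OF sub, of affine] hull_subset[of ?H affine] by simp
  with h1 have "affine hull ?F = ?H" by (rule subset_antisym)
  then have "aff_dim ?F = aff_dim ?H" using aff_dim_affine_hull[of ?F] by simp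
  also have "\<dots> = int (dim ((\<lambda>y. y - x) ` ?H))" using affH xH by (rule aff_dim_dim_affine_diffs)
  also have "(\<lambda>y. y - x) ` ?H = {u. \<forall>i\<in>?S. a i \<bullet> u = 0}"
  proof (intro equalityI subsetI)
    fix u assume u: "u \<in> {u. \<forall>i\<in>?S. a i \<bullet> u = 0}"
    then have "x + u \<in> ?H" using xH by (simp add: inner_add_right)
    then have "(x + u) - x \<in> (\<lambda>y. y - x) ` ?H" by (rule imageI)
    then show "u \<in> (\<lambda>y. y - x) ` ?H" by simp
  qed (use xH in \<open>auto simp: inner_diff_right\<close>)
  finally show "aff_dim ?F = int (act_dim ?S)" by (simp add: act_dim_def)
qed

lemma feasible_dirs_hpoly:
  assumes x: "x \<in> hpoly"
  shows "feasible_dirs hpoly x = act_cone (active x)"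
proof (intro equalityI subsetI)
  fix u assume "u \<in> feasible_dirs hpoly x"
  then obtain e where e: "e > 0" "x + e *\<^sub>R u \<in> hpoly" by (auto simp: feasible_dirs_def)
  have "a i \<bullet> u \<le> 0" if "i \<in> active x" for i
  proof -
    have "a i \<bullet> (x + e *\<^sub>R u) \<le> \<beta> i" "a i \<bullet> x = \<beta> i" using e that by (auto simp: hpoly_def active_def)
    then have "e * (a i \<bullet> u) \<le> 0" by (simp add: inner_add_right)
    then show ?thesis using e(1) by (simp add: mult_le_0_iff)
  qed
  then show "u \<in> act_cone (active x)" by (simp add: act_cone_def)
next
  fix u assume u: "u \<in> act_cone (active x)"
  obtain e where e: "e > 0" "\<And>y. y \<in> ball x e \<Longrightarrow> (\<And>i. i \<in> active x \<Longrightarrow> a i \<bullet> y \<le> \<beta> i) \<Longrightarrow> y \<in> hpoly"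
    using inactive_ball[OF x] by blast
  obtain s where s: "s > 0" "x + s *\<^sub>R u \<in> ball x e" using step_in_ball[OF e(1)] .
  have "x + s *\<^sub>R u \<in> hpoly"
  proof (rule e(2)[OF s(2)])
    fix i assume "i \<in> active x"
    then have "a i \<bullet> x = \<beta> i" "a i \<bullet> u \<le> 0" using u by (auto simp: active_def act_cone_def)
    then show "a i \<bullet> (x + s *\<^sub>R u) \<le> \<beta> i" using s(1) by (simp add: inner_add_right mult_le_0_iff)
  qed
  then show "u \<in> feasible_dirs hpoly x" using s(1) unfolding feasible_dirs_def by blast
qed

text \<open>A nonempty face is recovered from the active set of any of its relative interior points,
  as two faces whose relative interiors meet are equal. Conversely, the active set consists of the
  constraints that are tight on the whole face.\<close>

lemma bij_act_face: "bij_betw act_face (active ` hpoly) (nonempty_faces hpoly)"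
proof (rule bij_betw_imageI)
  have sub: "active x \<subseteq> I" for x by (auto simp: active_def)
  show "inj_on act_face (active ` hpoly)"
  proof (rule inj_on_inverseI[where g="\<lambda>F. {i \<in> I. \<forall>y\<in>F. a i \<bullet> y = \<beta> i}"])
    fix S assume "S \<in> active ` hpoly"
    then obtain x where x: "x \<in> hpoly" "S = active x" by blast
    have "x \<in> act_face S" using x by (auto simp: act_face_def active_def)
    then show "{i \<in> I. \<forall>y\<in>act_face S. a i \<bullet> y = \<beta> i} = S" using x by (auto simp: act_face_def active_def)
  qed
  show "act_face ` active ` hpoly = nonempty_faces hpoly"
  proof (intro equalityI subsetI)
    fix F assume "F \<in> act_face ` active ` hpoly"
    then obtain x where x: "x \<in> hpoly" "F = act_face (active x)" by blast
    have "x \<in> F" using act_face_rel_interior(1)[OF x(1)] x(2) rel_interior_subset by blast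
    then show "F \<in> nonempty_faces hpoly" using act_face_face[OF sub] x by (auto simp: nonempty_faces_def)
  next
    fix F assume "F \<in> nonempty_faces hpoly"
    then have F: "F face_of hpoly" "F \<noteq> {}" by (auto simp: nonempty_faces_def)
    obtain x where x: "x \<in> rel_interior F" using F face_of_imp_convex rel_interior_eq_empty by blast
    then have xP: "x \<in> hpoly" using face_of_imp_subset[OF F(1)] rel_interior_subset by blast
    have "F = act_face (active x)"
      using face_of_eq[OF F(1) act_face_face[OF sub]] x act_face_rel_interior(1)[OF xP] by blast
    then show "F \<in> act_face ` active ` hpoly" using xP by blast
  qed
qed

text \<open>Face numbers and angle sums depend on a face only through its dimension and its cone;
  \<open>h\<close> covers both uses and makes the sum run over combinatorial data, the realised
  active sets.\<close>

lemma sum_faces_hpoly: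
  "(\<Sum>F\<in>nonempty_faces hpoly. h (nat (aff_dim F)) (face_cone F hpoly)) = (\<Sum>S\<in>active ` hpoly. h (act_dim S) (act_cone S))"
proof -
  have "(\<Sum>F\<in>nonempty_faces hpoly. h (nat (aff_dim F)) (face_cone F hpoly)) =
    (\<Sum>S\<in>active ` hpoly. h (nat (aff_dim (act_face S))) (face_cone (act_face S) hpoly))"
    by (rule sum.reindex_bij_betw[OF bij_act_face, symmetric])
  also have "\<dots> = (\<Sum>S\<in>active ` hpoly. h (act_dim S) (act_cone S))"
  proof (rule sum.cong[OF refl])
    fix S assume "S \<in> active ` hpoly"
    then obtain x where x: "x \<in> hpoly" "S = active x" by blast
    have "S \<subseteq> I" using x by (auto simp: active_def)
    then have "face_cone (act_face S) hpoly = act_cone S"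
      using face_cone_eq[OF convex_hpoly act_face_face, of S x] act_face_rel_interior(1)[OF x(1)] feasible_dirs_hpoly[OF x(1)] x(2)
      by simp
    then show "h (nat (aff_dim (act_face S))) (face_cone (act_face S) hpoly) = h (act_dim S) (act_cone S)"
      using act_face_rel_interior(2)[OF x(1)] x(2) by simp
  qed
  finally show ?thesis .
qed

lemma aff_dim_hpoly:
  assumes "{} \<in> active ` hpoly" shows "aff_dim hpoly = int DIM('a)"
proof -
  obtain x where x: "x \<in> hpoly" "active x = {}" using assms by auto
  have "act_face {} = hpoly" by (simp add: act_face_def)
  then show ?thesis using act_face_rel_interior(2)[OF x(1)] x(2) by (simp add: act_dim_def)
qed

end

end

section \<open>Iterated pyramids and prisms over cubes\<close>

text \<open>
  With \<open>C\<close> the complement of \<open>A \<union> B\<close>, the polytope \<open>pyramid_prism A B w\<close> is given by \<open>0 \<le> x\<^sub>i\<close> for all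
  \<open>i\<close>, by \<open>x\<^sub>i + (\<Sum>j\<in>B. w\<^sub>j x\<^sub>j) \<le> 1\<close> for \<open>i \<in> A\<close> and by \<open>x\<^sub>i \<le> 1\<close> for \<open>i \<in> C\<close>. It is the product of the
  \<open>C\<close>-cube with the \<open>card B\<close>-fold pyramid over the \<open>A\<close>-cube whose apexes lie on the axes of \<open>B\<close> at
  heights \<open>1 / w\<^sub>j\<close>; for a singleton \<open>A\<close> this pyramid is a simplex. The constraint \<open>(i, False)\<close> is the
  lower and \<open>(i, True)\<close> the upper one for \<open>x\<^sub>i\<close>.
\<close>

definition wvec :: "'n::finite set \<Rightarrow> ('n \<Rightarrow> real) \<Rightarrow> real ^ 'n" where
  "wvec B w = (\<chi> j. if j \<in> B then w j else 0)"

definition fnormal :: "'n::finite set \<Rightarrow> 'n set \<Rightarrow> ('n \<Rightarrow> real) \<Rightarrow> 'n \<times> bool \<Rightarrow> real ^ 'n" where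
  "fnormal A B w = (\<lambda>(i, b). if b then axis i 1 + (if i \<in> A then wvec B w else 0) else - axis i 1)"

definition fbound :: "'n \<times> bool \<Rightarrow> real" where "fbound = (\<lambda>(i, b). if b then 1 else 0)"

definition findex :: "'n set \<Rightarrow> ('n \<times> bool) set" where "findex B = {(i, b). b \<longrightarrow> i \<notin> B}"

definition pyramid_prism :: "'n::finite set \<Rightarrow> 'n set \<Rightarrow> ('n \<Rightarrow> real) \<Rightarrow> (real ^ 'n) set" where
  "pyramid_prism A B w = hpoly (fnormal A B w) fbound (findex B)"

lemma fnormal_False [simp]: "fnormal A B w (i, False) \<bullet> x = - x $ i"
  by (simp add: fnormal_def inner_axis')

lemma fnormal_True [simp]: "fnormal A B w (i, True) \<bullet> x = x $ i + (if i \<in> A then wvec B w \<bullet> x else 0)"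
  by (simp add: fnormal_def inner_axis' inner_add_left)

lemma finite_findex: "finite (findex B :: ('n::finite \<times> bool) set)" by simp

lemma wvec_inner: "wvec B w \<bullet> x = (\<Sum>j\<in>B. w j * x $ j)"
proof -
  have "wvec B w \<bullet> x = (\<Sum>j\<in>UNIV. if j \<in> B then w j * x $ j else 0)"
    unfolding inner_vec_def wvec_def by (intro sum.cong) auto
  also have "\<dots> = (\<Sum>j\<in>B. w j * x $ j)" by (simp add: sum.If_cases)
  finally show ?thesis .
qed

lemma pyramid_prism_iff:
  "x \<in> pyramid_prism A B w \<longleftrightarrow> (\<forall>i. 0 \<le> x $ i) \<and> (\<forall>i. i \<notin> B \<longrightarrow> x $ i + (if i \<in> A then wvec B w \<bullet> x else 0) \<le> 1)"
proof -
  have "x \<in> pyramid_prism A B w \<longleftrightarrow> (\<forall>i b. (i,b) \<in> findex B \<longrightarrow> fnormal A B w (i,b) \<bullet> x \<le> fbound (i,b))"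
    by (auto simp: pyramid_prism_def hpoly_def)
  also have "\<dots> \<longleftrightarrow> (\<forall>i. 0 \<le> x $ i) \<and> (\<forall>i. i \<notin> B \<longrightarrow> x $ i + (if i \<in> A then wvec B w \<bullet> x else 0) \<le> 1)"
    unfolding all_bool_eq findex_def fbound_def by (simp del: if_split) blast
  finally show ?thesis .
qed

abbreviation "factive A B w \<equiv> active (fnormal A B w) fbound (findex B)"

lemma factive_False: "(i, False) \<in> factive A B w x \<longleftrightarrow> x $ i = 0"
  by (simp add: active_def findex_def fbound_def)

lemma factive_True: "(i, True) \<in> factive A B w x \<longleftrightarrow> i \<notin> B \<and> x $ i + (if i \<in> A then wvec B w \<bullet> x else 0) = 1"
  by (simp add: active_def findex_def fbound_def)

section \<open>Encoding of the faces by patterns of active constraints\<close>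

definition pat :: "'n::finite set \<Rightarrow> 'n set \<Rightarrow> ('n \<Rightarrow> real) \<Rightarrow> real ^ 'n \<Rightarrow> 'n \<Rightarrow> bool set" where
  "pat A B w x i = {b. (i, b) \<in> factive A B w x}"

lemma factive_pat: "factive A B w x = Sigma UNIV (pat A B w x)"
  by (auto simp: pat_def)

lemma bool_set_cases:
  fixes s :: "bool set"
  obtains "s = {}" | "s = {False}" | "s = {True}" | "s = UNIV"
proof -
  have "s \<in> Pow {False, True}" by (auto simp: UNIV_bool[symmetric])
  then show thesis using that by (auto simp: Pow_insert UNIV_bool insert_commute)
qed

definition opts0 :: "'n set \<Rightarrow> 'n \<Rightarrow> bool set set" where
  "opts0 B i = (if i \<in> B then {{}, {False}} else {{}, {False}, {True}})"

definition opts1 :: "'n set \<Rightarrow> 'n set \<Rightarrow> 'n \<Rightarrow> bool set set" where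
  "opts1 A B i = (if i \<in> A then {UNIV} else opts0 B i)"

text \<open>These are the patterns of \<open>opts1\<close> in which every apex coordinate is 0.
  Their weighted sum would be 0 where it has to be 1, so no point realises them.\<close>

definition opts2 :: "'n set \<Rightarrow> 'n set \<Rightarrow> 'n \<Rightarrow> bool set set" where
  "opts2 A B i = (if i \<in> A then {UNIV} else if i \<in> B then {{False}} else {{}, {False}, {True}})"

text \<open>
  A face is encoded by the map that sends each coordinate to the set of its active constraints:
  \<open>pats0\<close> describes the faces that contain a point with \<open>(\<Sum>j\<in>B. w\<^sub>j x\<^sub>j) < 1\<close>, and \<open>pats1\<close> those
  spanned by apexes, where the cube has shrunk to a point and both constraints of each \<open>i \<in> A\<close> are
  active.
\<close>

definition pats0 :: "'n set \<Rightarrow> ('n \<Rightarrow> bool set) set" where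
  "pats0 B = PiE UNIV (opts0 B)"

definition pats1 :: "'n set \<Rightarrow> 'n set \<Rightarrow> ('n \<Rightarrow> bool set) set" where
  "pats1 A B = PiE UNIV (opts1 A B) - PiE UNIV (opts2 A B)"

lemma opts0_iff: "s \<in> opts0 B i \<longleftrightarrow> \<not> (True \<in> s \<and> (False \<in> s \<or> i \<in> B))"
  by (rule bool_set_cases[of s]) (auto simp: opts0_def)

lemma pats0_iff: "g \<in> pats0 B \<longleftrightarrow> (\<forall>i. \<not> (True \<in> g i \<and> (False \<in> g i \<or> i \<in> B)))"
  by (simp add: pats0_def PiE_iff opts0_iff)

lemma pats1_iff:
  assumes "A \<inter> B = {}"
  shows "g \<in> pats1 A B \<longleftrightarrow> (\<forall>i\<in>A. g i = UNIV) \<and> (\<forall>i. i \<notin> A \<longrightarrow> \<not> (True \<in> g i \<and> (False \<in> g i \<or> i \<in> B))) \<and> (\<exists>j\<in>B. g j = {})"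
proof -
  have 1: "g \<in> PiE UNIV (opts1 A B) \<longleftrightarrow> (\<forall>i\<in>A. g i = UNIV) \<and> (\<forall>i. i \<notin> A \<longrightarrow> \<not> (True \<in> g i \<and> (False \<in> g i \<or> i \<in> B)))"
    unfolding PiE_iff opts1_def by (auto simp: opts0_iff)
  have 2: "g \<in> PiE UNIV (opts2 A B) \<longleftrightarrow> g \<in> PiE UNIV (opts1 A B) \<and> (\<forall>i\<in>B. g i = {False})"
    unfolding PiE_iff opts2_def opts1_def using assms by (auto simp: opts0_def split: if_splits)
  have 3: "g i = {} \<or> g i = {False}" if "g \<in> PiE UNIV (opts1 A B)" "i \<in> B" for i
    using that assms unfolding PiE_iff opts1_def opts0_def by (auto split: if_splits)
  show ?thesis
  proof (cases "g \<in> PiE UNIV (opts1 A B)")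
    case True
    then have "(\<exists>j\<in>B. g j = {}) \<longleftrightarrow> \<not> (\<forall>i\<in>B. g i = {False})"
      using 3[OF True] by (metis insert_not_empty)
    then show ?thesis using True 1 unfolding pats1_def Diff_iff 2 by metis
  next
    case False
    then show ?thesis using 1 unfolding pats1_def by blast
  qed
qed

lemma pat_False: "False \<in> pat A B w x i \<longleftrightarrow> x $ i = 0"
  by (simp add: pat_def factive_False)

lemma pat_True: "True \<in> pat A B w x i \<longleftrightarrow> i \<notin> B \<and> x $ i + (if i \<in> A then wvec B w \<bullet> x else 0) = 1"
  by (simp add: pat_def factive_True)

lemma pat_eqI:
  assumes "\<And>i. False \<in> g i \<longleftrightarrow> x $ i = 0"
    and "\<And>i. True \<in> g i \<longleftrightarrow> i \<notin> B \<and> x $ i + (if i \<in> A then wvec B w \<bullet> x else 0) = 1"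
  shows "pat A B w x = g"
proof (rule ext, rule set_eqI)
  fix i b show "b \<in> pat A B w x i \<longleftrightarrow> b \<in> g i"
    using assms by (cases b) (simp_all only: pat_False pat_True)
qed

text \<open>As \<open>A\<close> is nonempty, the weighted sum \<open>s\<close> is at most 1. For
  \<open>s < 1\<close> the cube over \<open>A\<close> has positive width \<open>1 - s\<close> at
  this level, so no coordinate has both constraints active; for \<open>s = 1\<close> all coordinates
  in \<open>A\<close> vanish.\<close>

lemma pat_pyramid_prism_subset:
  assumes AB: "A \<inter> B = {}" "A \<noteq> {}" and w': "\<forall>j\<in>B. w j > 0" and x: "x \<in> pyramid_prism A B w"
  shows "pat A B w x \<in> pats0 B \<union> pats1 A B"
proof -
  have w: "\<And>j. j \<in> B \<Longrightarrow> w j > 0" using w' by blast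
  define s where "s = wvec B w \<bullet> x"
  have x0: "\<And>i. 0 \<le> x $ i" and x1: "\<And>i. i \<notin> B \<Longrightarrow> x $ i + (if i \<in> A then s else 0) \<le> 1"
    using x by (auto simp: pyramid_prism_iff s_def)
  obtain k where k: "k \<in> A" using AB by blast
  then have "k \<notin> B" using AB by blast
  then have "s \<le> 1" using x0[of k] x1[of k] k by simp
  then consider "s < 1" | "s = 1" by linarith
  then show ?thesis
  proof cases
    case 1
    then have "pat A B w x \<in> pats0 B"
      unfolding pats0_iff pat_False pat_True s_def[symmetric] by auto
    then show ?thesis by blast
  next
    case 2
    have A0: "x $ i = 0" if "i \<in> A" for i
    proof -
      have "i \<notin> B" using that AB by blast
      then show ?thesis using x0[of i] x1[of i] that 2 by simp
    qed
    have "pat A B w x i = UNIV" if "i \<in> A" for i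
    proof -
      have "False \<in> pat A B w x i" "True \<in> pat A B w x i"
        using A0[OF that] that AB 2 unfolding pat_False pat_True s_def by auto
      then show ?thesis by (metis (full_types) UNIV_eq_I)
    qed
    moreover have "\<exists>j\<in>B. pat A B w x j = {}"
    proof (rule ccontr)
      assume "\<not> (\<exists>j\<in>B. pat A B w x j = {})"
      then have "x $ j = 0" if "j \<in> B" for j
        using that pat_False[of A B w x j] pat_True[of A B w x j] by (metis (full_types) all_not_in_conv)
      then have "s = 0" unfolding s_def wvec_inner by (intro sum.neutral) simp
      then show False using 2 by simp
    qed
    moreover have "\<not> (True \<in> pat A B w x i \<and> (False \<in> pat A B w x i \<or> i \<in> B))" if "i \<notin> A" for i
      unfolding pat_False pat_True using that by auto
    ultimately show ?thesis unfolding Un_iff pats1_iff[OF AB(1)] by blast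
  qed
qed

lemma pats0_realized:
  assumes AB: "A \<inter> B = {}" and w': "\<forall>j\<in>B. w j > 0" and g: "g \<in> pats0 B"
  obtains x where "x \<in> pyramid_prism A B w" "pat A B w x = g"
proof -
  have w: "\<And>j. j \<in> B \<Longrightarrow> w j > 0" using w' by blast
  define W where "W = (\<Sum>j\<in>B. w j)"
  have W0: "W \<ge> 0" unfolding W_def using w by (intro sum_nonneg) (simp add: less_imp_le)
  \<comment> \<open>Small enough to keep the weighted sum below 1 whichever apex coordinates are
    free: \<open>W * \<delta> < 1 / 2\<close>.\<close>
  define \<delta> where "\<delta> = 1 / (2 * (1 + W))"
  have d0: "\<delta> > 0" using W0 by (simp add: \<delta>_def)
  define s where "s = (\<Sum>j\<in>B. w j * (if False \<in> g j then 0 else \<delta>))"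
  have s0: "s \<ge> 0" unfolding s_def using w d0 by (intro sum_nonneg) (simp add: less_imp_le)
  have "s \<le> (\<Sum>j\<in>B. w j * \<delta>)" unfolding s_def using w d0 by (intro sum_mono) (auto simp: less_imp_le)
  also have "\<dots> = W * \<delta>" by (simp add: W_def sum_distrib_right)
  also have "\<dots> < 1" using W0 by (simp add: \<delta>_def field_simps)
  finally have s1: "s < 1" .
  define c where "c i = (if i \<in> A then 1 - s else 1)" for i
  have c0: "c i > 0" for i using s1 by (simp add: c_def)
  define x :: "real ^ 'a" where "x = (\<chi> i. if i \<in> B then (if False \<in> g i then 0 else \<delta>)
    else if False \<in> g i then 0 else if True \<in> g i then c i else c i / 2)"
  have xs: "wvec B w \<bullet> x = s" unfolding wvec_inner s_def x_def by (intro sum.cong) auto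
  have "x \<in> pyramid_prism A B w"
    unfolding pyramid_prism_iff xs
  proof (intro conjI allI impI)
    fix i
    show "0 \<le> x $ i" using d0 c0[of i] by (auto simp: x_def)
    assume "i \<notin> B"
    then have "x $ i \<le> c i" using c0[of i] by (auto simp: x_def)
    then show "x $ i + (if i \<in> A then s else 0) \<le> 1" by (auto simp: c_def split: if_splits)
  qed
  moreover have "pat A B w x = g"
  proof (rule pat_eqI)
    fix i
    show "False \<in> g i \<longleftrightarrow> x $ i = 0" using d0 c0[of i] by (auto simp: x_def)
    have "True \<in> g i \<longleftrightarrow> i \<notin> B \<and> x $ i = c i"
      using g c0[of i] unfolding pats0_iff by (auto simp: x_def)
    also have "x $ i = c i \<longleftrightarrow> x $ i + (if i \<in> A then s else 0) = 1" by (auto simp: c_def)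
    finally show "True \<in> g i \<longleftrightarrow> i \<notin> B \<and> x $ i + (if i \<in> A then wvec B w \<bullet> x else 0) = 1" unfolding xs .
  qed
  ultimately show ?thesis using that by blast
qed

lemma pats1_realized:
  assumes AB: "A \<inter> B = {}" and w': "\<forall>j\<in>B. w j > 0" and g: "g \<in> pats1 A B"
  obtains x where "x \<in> pyramid_prism A B w" "pat A B w x = g"
proof -
  have w: "\<And>j. j \<in> B \<Longrightarrow> w j > 0" using w' by blast
  have gA: "\<And>i. i \<in> A \<Longrightarrow> g i = UNIV"
    and gB: "\<And>i. i \<notin> A \<Longrightarrow> \<not> (True \<in> g i \<and> (False \<in> g i \<or> i \<in> B))" and "\<exists>j\<in>B. g j = {}"
    using g unfolding pats1_iff[OF AB] by auto
  then obtain k where k: "k \<in> B" "g k = {}" by blast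
  \<comment> \<open>The free apex coordinates all receive the value \<open>1 / m\<close>, which
    makes the weighted sum exactly 1.\<close>
  define m where "m = (\<Sum>j\<in>B. if g j = {} then w j else 0)"
  have "w k = (if g k = {} then w k else 0)" using k by simp
  also have "\<dots> \<le> m" unfolding m_def using w k(1)
    by (intro member_le_sum[of k B "\<lambda>j. if g j = {} then w j else 0"]) (auto simp: less_imp_le)
  finally have m0: "m > 0" using w[OF k(1)] by linarith
  define x :: "real ^ 'a" where "x = (\<chi> i. if i \<in> B then (if g i = {} then 1 / m else 0)
    else if i \<in> A \<or> False \<in> g i then 0 else if True \<in> g i then 1 else 1 / 2)"
  have "wvec B w \<bullet> x = (\<Sum>j\<in>B. (if g j = {} then w j else 0) * (1 / m))"
    unfolding wvec_inner x_def by (intro sum.cong) auto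
  also have "\<dots> = 1" using m0 unfolding sum_distrib_right[symmetric] m_def[symmetric] by simp
  finally have xs: "wvec B w \<bullet> x = 1" .
  have gB2: "False \<in> g i \<longleftrightarrow> g i \<noteq> {}" if "i \<in> B" for i
    using gB[of i] that AB by (metis (full_types) Int_iff all_not_in_conv)
  have "x \<in> pyramid_prism A B w"
    unfolding pyramid_prism_iff xs using m0 by (auto simp: x_def)
  moreover have "pat A B w x = g"
  proof (rule pat_eqI)
    fix i
    show "False \<in> g i \<longleftrightarrow> x $ i = 0" using m0 gA[of i] gB2[of i] AB by (auto simp: x_def)
    show "True \<in> g i \<longleftrightarrow> i \<notin> B \<and> x $ i + (if i \<in> A then wvec B w \<bullet> x else 0) = 1"
      unfolding xs using gA[of i] gB[of i] AB by (auto simp: x_def)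
  qed
  ultimately show ?thesis using that by blast
qed

lemma factive_pyramid_prism:
  assumes AB: "A \<inter> B = {}" "A \<noteq> {}" and w': "\<forall>j\<in>B. w j > 0"
  shows "factive A B w ` pyramid_prism A B w = Sigma UNIV ` (pats0 B \<union> pats1 A B)"
proof -
  have "pat A B w ` pyramid_prism A B w = pats0 B \<union> pats1 A B"
  proof (intro equalityI subsetI)
    fix g assume "g \<in> pats0 B \<union> pats1 A B"
    then consider "g \<in> pats0 B" | "g \<in> pats1 A B" by blast
    then obtain x where "x \<in> pyramid_prism A B w" "pat A B w x = g"
    proof cases
      case 1 show ?thesis by (rule pats0_realized[OF AB(1) w' 1]) (rule that)
    next
      case 2 show ?thesis by (rule pats1_realized[OF AB(1) w' 2]) (rule that)
    qed
    then show "g \<in> pat A B w ` pyramid_prism A B w" by blast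
  next
    fix g assume "g \<in> pat A B w ` pyramid_prism A B w"
    then obtain x where "x \<in> pyramid_prism A B w" "g = pat A B w x" by blast
    then show "g \<in> pats0 B \<union> pats1 A B" using pat_pyramid_prism_subset[OF AB w'] by simp
  qed
  then show ?thesis unfolding factive_pat by (metis image_image)
qed

section \<open>Dimensions of the faces\<close>

lemma dim_coordinate_subspace:
  fixes D :: "'n::finite set"
  shows "dim {v :: real ^ 'n. \<forall>i. i \<in> D \<longrightarrow> v $ i = 0} = card (- D)"
proof -
  have "{v :: real ^ 'n. \<forall>i. i \<in> D \<longrightarrow> v $ i = 0} = {v. \<forall>b\<in>Basis. b \<notin> (\<lambda>i. axis i 1) ` (- D) \<longrightarrow> v \<bullet> b = 0}"
    by (auto simp: Basis_vec_def inner_axis axis_eq_axis)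
  also have "dim \<dots> = card ((\<lambda>i. axis i (1::real) :: real ^ 'n) ` (- D))"
    by (rule dim_substandard) (auto simp: Basis_vec_def)
  also have "\<dots> = card (- D)" by (rule card_image) (auto simp: inj_on_def axis_eq_axis)
  finally show ?thesis .
qed

lemma subspace_coordinate: "subspace {v :: real ^ 'n::finite. \<forall>i. i \<in> D \<longrightarrow> v $ i = 0}"
  by (auto simp: subspace_def)

lemma fdim_space:
  "{u. \<forall>s\<in>Sigma UNIV g. fnormal A B w s \<bullet> u = 0} =
    {u. (\<forall>i. False \<in> g i \<longrightarrow> u $ i = 0) \<and> (\<forall>i. True \<in> g i \<longrightarrow> u $ i + (if i \<in> A then wvec B w \<bullet> u else 0) = 0)}"
proof -
  have "(\<forall>s\<in>Sigma UNIV g. fnormal A B w s \<bullet> u = 0) \<longleftrightarrow> (\<forall>i b. b \<in> g i \<longrightarrow> fnormal A B w (i, b) \<bullet> u = 0)" for u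
    by auto
  then show ?thesis unfolding all_bool_eq by (simp only: fnormal_False fnormal_True neg_equal_0_iff_equal) blast
qed

text \<open>An active upper constraint at \<open>i\<close> in \<open>A\<close> ties
  \<open>u $ i\<close> to the apex coordinates. The shear \<open>\<Psi>\<close> produces this tie:
  it maps the space of the free coordinates onto the solution space and preserves the weighted sum,
  as \<open>A\<close> and \<open>B\<close> are disjoint.\<close>

lemma act_dim_pats0:
  assumes AB: "A \<inter> B = {}" and g: "g \<in> pats0 B"
  shows "act_dim (fnormal A B w) (Sigma UNIV g) = card {i. g i = {}}"
proof -
  let ?E = "{v :: real ^ 'a. \<forall>i. i \<in> {i. g i \<noteq> {}} \<longrightarrow> v $ i = 0}"
  define \<Psi> :: "real ^ 'a \<Rightarrow> real ^ 'a" where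
    "\<Psi> v = (\<chi> i. if True \<in> g i \<and> i \<in> A then v $ i - wvec B w \<bullet> v else v $ i)" for v
  have lin: "linear \<Psi>"
    by (rule linearI) (auto simp: \<Psi>_def vec_eq_iff inner_add_right algebra_simps)
  have gi: "\<not> (True \<in> g i \<and> (False \<in> g i \<or> i \<in> B))" for i using g by (simp add: pats0_iff)
  have wP: "wvec B w \<bullet> \<Psi> v = wvec B w \<bullet> v" for v
    unfolding wvec_inner using AB by (intro sum.cong) (auto simp: \<Psi>_def)
  have "inj \<Psi>"
  proof (rule injI)
    fix u v assume e: "\<Psi> u = \<Psi> v"
    then have "wvec B w \<bullet> u = wvec B w \<bullet> v" using wP by metis
    moreover have "\<Psi> u $ i = \<Psi> v $ i" for i using e by simp
    then have "(if True \<in> g i \<and> i \<in> A then u $ i - wvec B w \<bullet> u else u $ i) =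
      (if True \<in> g i \<and> i \<in> A then v $ i - wvec B w \<bullet> v else v $ i)" for i by (simp add: \<Psi>_def)
    ultimately have "u $ i = v $ i" for i by (metis diff_add_cancel)
    then show "u = v" by (simp add: vec_eq_iff)
  qed
  have "{u. \<forall>s\<in>Sigma UNIV g. fnormal A B w s \<bullet> u = 0} = \<Psi> ` ?E"
    unfolding fdim_space
  proof (intro equalityI subsetI)
    fix u assume "u \<in> \<Psi> ` ?E"
    then obtain v where v: "u = \<Psi> v" "\<And>i. g i \<noteq> {} \<Longrightarrow> v $ i = 0" by blast
    have "u $ i = 0" if "False \<in> g i" for i using v(2)[of i] gi[of i] that by (auto simp: v(1) \<Psi>_def)
    moreover have "u $ i + (if i \<in> A then wvec B w \<bullet> u else 0) = 0" if "True \<in> g i" for i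
      using v(2)[of i] that unfolding v(1) wP by (auto simp: \<Psi>_def)
    ultimately show "u \<in> {u. (\<forall>i. False \<in> g i \<longrightarrow> u $ i = 0) \<and> (\<forall>i. True \<in> g i \<longrightarrow> u $ i + (if i \<in> A then wvec B w \<bullet> u else 0) = 0)}"
      by blast
  next
    fix u assume "u \<in> {u. (\<forall>i. False \<in> g i \<longrightarrow> u $ i = 0) \<and> (\<forall>i. True \<in> g i \<longrightarrow> u $ i + (if i \<in> A then wvec B w \<bullet> u else 0) = 0)}"
    then have uF: "\<And>i. False \<in> g i \<Longrightarrow> u $ i = 0"
      and uT: "\<And>i. True \<in> g i \<Longrightarrow> u $ i + (if i \<in> A then wvec B w \<bullet> u else 0) = 0" by auto
    define v :: "real ^ 'a" where "v = (\<chi> i. if g i \<noteq> {} then 0 else u $ i)"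
    have wv: "wvec B w \<bullet> v = wvec B w \<bullet> u"
      unfolding wvec_inner
    proof (rule sum.cong[OF refl])
      fix j assume "j \<in> B"
      then have "g j = {} \<or> False \<in> g j" using gi[of j] by (metis (full_types) all_not_in_conv)
      then show "w j * v $ j = w j * u $ j" using uF[of j] by (auto simp: v_def)
    qed
    have "\<Psi> v $ i = u $ i" for i
    proof (cases "True \<in> g i \<and> i \<in> A")
      case True
      then have "v $ i = 0" by (auto simp: v_def)
      moreover have "\<Psi> v $ i = v $ i - wvec B w \<bullet> v" using True by (simp add: \<Psi>_def)
      moreover have "u $ i + wvec B w \<bullet> u = 0" using uT[of i] True by simp
      ultimately show ?thesis using wv by linarith
    next
      case False
      then have "\<Psi> v $ i = v $ i" unfolding \<Psi>_def by auto
      also have "\<dots> = u $ i"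
      proof (cases "g i = {}")
        case True
        then show ?thesis by (simp add: v_def)
      next
        case ne: False
        then have "True \<in> g i \<or> False \<in> g i" by (metis (full_types) all_not_in_conv)
        then have "u $ i = 0" using uF[of i] uT[of i] False by (metis add.right_neutral)
        then show ?thesis using ne by (simp add: v_def)
      qed
      finally show ?thesis .
    qed
    then have "u = \<Psi> v" by (simp add: vec_eq_iff)
    moreover have "v \<in> ?E" by (simp add: v_def)
    ultimately show "u \<in> \<Psi> ` ?E" by blast
  qed
  then have "act_dim (fnormal A B w) (Sigma UNIV g) = dim (\<Psi> ` ?E)" by (simp add: act_dim_def)
  also have "\<dots> = dim ?E" using lin \<open>inj \<Psi>\<close> by (intro dim_image_eq) (auto intro: inj_on_subset)
  also have "\<dots> = card (- {i. g i \<noteq> {}})" by (rule dim_coordinate_subspace)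
  also have "- {i. g i \<noteq> {}} = {i. g i = {}}" by auto
  finally show ?thesis .
qed

lemma dim_subspace_Int_hyperplane:
  fixes E :: "'a::euclidean_space set"
  assumes E: "subspace E" and v: "v \<in> E" "a \<bullet> v \<noteq> 0"
  shows "Suc (dim (E \<inter> {x. a \<bullet> x = 0})) = dim E"
proof -
  have "\<not> E \<subseteq> {x. a \<bullet> x = 0}" using v by blast
  moreover have "0 \<in> E \<inter> {x. a \<bullet> x = 0}" using E by (simp add: subspace_0)
  then have "E \<inter> {x. a \<bullet> x = 0} \<noteq> {}" by blast
  ultimately have "aff_dim (E \<inter> {x. a \<bullet> x = 0}) = aff_dim E - 1"
    by (simp only: aff_dim_affine_Int_hyperplane[OF subspace_imp_affine[OF E], of a 0] if_False)
  then show ?thesis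
    using E subspace_inter[OF E subspace_hyperplane[of a]] by (simp add: aff_dim_subspace)
qed

text \<open>Both constraints being active at some \<open>i\<close> in \<open>A\<close> forces the
  weighted sum of a direction to be 0. This equation is independent of the others because an apex
  coordinate is free, so one dimension is lost.\<close>

lemma act_dim_pats1:
  assumes AB: "A \<inter> B = {}" "A \<noteq> {}" and w: "\<forall>j\<in>B. w j > 0" and g: "g \<in> pats1 A B"
  shows "Suc (act_dim (fnormal A B w) (Sigma UNIV g)) = card {i. g i = {}}"
proof -
  let ?E = "{v :: real ^ 'a. \<forall>i. i \<in> {i. g i \<noteq> {}} \<longrightarrow> v $ i = 0}"
  let ?H = "{v. wvec B w \<bullet> v = 0}"
  have gA: "\<And>i. i \<in> A \<Longrightarrow> g i = UNIV" and "\<exists>j\<in>B. g j = {}"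
    using g unfolding pats1_iff[OF AB(1)] by auto
  then obtain k where k: "k \<in> B" "g k = {}" by blast
  obtain a where a: "a \<in> A" using AB by blast
  have eq: "{u. \<forall>s\<in>Sigma UNIV g. fnormal A B w s \<bullet> u = 0} = ?E \<inter> ?H"
    unfolding fdim_space
  proof (intro equalityI subsetI)
    fix u assume "u \<in> {u. (\<forall>i. False \<in> g i \<longrightarrow> u $ i = 0) \<and> (\<forall>i. True \<in> g i \<longrightarrow> u $ i + (if i \<in> A then wvec B w \<bullet> u else 0) = 0)}"
    then have uF: "\<And>i. False \<in> g i \<Longrightarrow> u $ i = 0"
      and uT: "\<And>i. True \<in> g i \<Longrightarrow> u $ i + (if i \<in> A then wvec B w \<bullet> u else 0) = 0" by auto
    have H: "wvec B w \<bullet> u = 0" using uF[of a] uT[of a] gA[OF a] a by simp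
    have "u $ i = 0" if "g i \<noteq> {}" for i
      using that uF[of i] uT[of i] H by (cases rule: bool_set_cases[of "g i"]) (auto split: if_splits)
    then show "u \<in> ?E \<inter> ?H" using H by simp
  next
    fix u assume "u \<in> ?E \<inter> ?H"
    then have "\<And>i. g i \<noteq> {} \<Longrightarrow> u $ i = 0" "wvec B w \<bullet> u = 0" by auto
    moreover have "b \<in> g i \<Longrightarrow> g i \<noteq> {}" for b i by blast
    ultimately show "u \<in> {u. (\<forall>i. False \<in> g i \<longrightarrow> u $ i = 0) \<and> (\<forall>i. True \<in> g i \<longrightarrow> u $ i + (if i \<in> A then wvec B w \<bullet> u else 0) = 0)}"
      by simp
  qed
  have sE: "subspace ?E" by (rule subspace_coordinate)
  have wk: "wvec B w \<bullet> axis k 1 = w k" using k by (simp add: inner_axis wvec_def)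
  have "axis k 1 \<in> ?E" using k by (auto simp: axis_def)
  moreover have "wvec B w \<bullet> axis k 1 \<noteq> 0" unfolding wk using bspec[OF w k(1)] by simp
  ultimately have "Suc (dim (?E \<inter> ?H)) = dim ?E" by (rule dim_subspace_Int_hyperplane[OF sE])
  moreover have "dim ?E = card (- {i. g i \<noteq> {}})" by (rule dim_coordinate_subspace)
  moreover have "- {i. g i \<noteq> {}} = {i. g i = {}}" by auto
  moreover have "act_dim (fnormal A B w) (Sigma UNIV g) = dim (?E \<inter> ?H)" unfolding act_dim_def eq ..
  ultimately show ?thesis by (simp only:)
qed

section \<open>The weighted face sum as a combination of products\<close>

definition pweight :: "'r::comm_ring_1 \<Rightarrow> ('n \<times> bool \<Rightarrow> 'r) \<Rightarrow> 'n \<Rightarrow> bool set \<Rightarrow> 'r" where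
  "pweight t v i s = (if s = {} then t else 1) * (\<Prod>b\<in>s. v (i, b))"

lemma prod_pweight:
  fixes g :: "'n::finite \<Rightarrow> bool set" and t :: "'r::comm_ring_1"
  shows "(\<Prod>i\<in>UNIV. pweight t v i (g i)) = t ^ card {i. g i = {}} * (\<Prod>s\<in>Sigma UNIV g. v s)"
proof -
  have "(\<Prod>i\<in>UNIV. if g i = {} then t else 1) = t ^ card {i. g i = {}}"
    by (simp add: prod.If_cases Collect_conv_if)
  moreover have "(\<Prod>s\<in>Sigma UNIV g. v s) = (\<Prod>i\<in>UNIV. \<Prod>b\<in>g i. v (i, b))"
    by (subst prod.Sigma) auto
  ultimately show ?thesis by (simp add: pweight_def prod.distrib)
qed

lemma inj_Sigma_UNIV: "inj (Sigma UNIV :: ('n \<Rightarrow> 'b set) \<Rightarrow> _)"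
proof (rule injI)
  fix g h :: "'n \<Rightarrow> 'b set" assume "Sigma UNIV g = Sigma UNIV h"
  then have "(i, b) \<in> Sigma UNIV g \<longleftrightarrow> (i, b) \<in> Sigma UNIV h" for i b by simp
  then show "g = h" by (auto simp: fun_eq_iff)
qed

text \<open>\<open>pats0\<close> is a product set and \<open>pats1\<close> a difference of two
  product sets, so the sums factor over the coordinates. The factor \<open>t\<close> makes up for
  the lost dimension in \<open>pats1\<close>. Weights \<open>v = 1\<close> count faces; indicators
  of the halfspaces given by the constraints select the cones that contain a fixed
  direction.\<close>

lemma pyramid_prism_sum:
  fixes t :: "'r::comm_ring_1" and A B :: "'n::finite set"
  assumes AB: "A \<inter> B = {}" "A \<noteq> {}" and w: "\<forall>j\<in>B. w j > 0"
  shows "t * (\<Sum>S\<in>factive A B w ` pyramid_prism A B w. t ^ act_dim (fnormal A B w) S * (\<Prod>s\<in>S. v s)) =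
     t * (\<Prod>i\<in>UNIV. if i \<in> B then t + v (i, False) else t + v (i, False) + v (i, True))
     + (\<Prod>i\<in>UNIV. if i \<in> A then v (i, False) * v (i, True) else if i \<in> B then t + v (i, False) else t + v (i, False) + v (i, True))
     - (\<Prod>i\<in>UNIV. if i \<in> A then v (i, False) * v (i, True) else if i \<in> B then v (i, False) else t + v (i, False) + v (i, True))"
proof -
  let ?d = "\<lambda>g. act_dim (fnormal A B w) (Sigma UNIV g)"
  let ?V = "\<lambda>g. \<Prod>s\<in>Sigma UNIV g. v s"
  have fin0: "finite (pats0 B)" by (rule finite)
  have disj: "pats0 B \<inter> pats1 A B = {}"
  proof -
    obtain a where a: "a \<in> A" using AB by blast
    have "g a = UNIV" if "g \<in> pats1 A B" for g using that a unfolding pats1_iff[OF AB(1)] by blast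
    moreover have "g a \<noteq> UNIV" if "g \<in> pats0 B" for g using that unfolding pats0_iff by blast
    ultimately show ?thesis by blast
  qed
  have "(\<Sum>S\<in>factive A B w ` pyramid_prism A B w. t ^ act_dim (fnormal A B w) S * (\<Prod>s\<in>S. v s)) =
    (\<Sum>g\<in>pats0 B \<union> pats1 A B. t ^ ?d g * ?V g)"
    unfolding factive_pyramid_prism[OF AB w]
    by (subst sum.reindex) (auto intro: inj_on_subset[OF inj_Sigma_UNIV])
  also have "\<dots> = (\<Sum>g\<in>pats0 B. t ^ ?d g * ?V g) + (\<Sum>g\<in>pats1 A B. t ^ ?d g * ?V g)"
    by (rule sum.union_disjoint) (use disj in auto)
  finally have "t * (\<Sum>S\<in>factive A B w ` pyramid_prism A B w. t ^ act_dim (fnormal A B w) S * (\<Prod>s\<in>S. v s)) =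
     t * (\<Sum>g\<in>pats0 B. t ^ ?d g * ?V g) + (\<Sum>g\<in>pats1 A B. t ^ Suc (?d g) * ?V g)"
    by (simp add: distrib_left sum_distrib_left mult.assoc)
  also have "(\<Sum>g\<in>pats0 B. t ^ ?d g * ?V g) = (\<Sum>g\<in>PiE UNIV (opts0 B). \<Prod>i\<in>UNIV. pweight t v i (g i))"
    unfolding pats0_def[symmetric] prod_pweight
    by (rule sum.cong) (simp_all add: act_dim_pats0[OF AB(1)])
  also have "\<dots> = (\<Prod>i\<in>UNIV. \<Sum>s\<in>opts0 B i. pweight t v i s)"
    by (rule prod_sum_PiE[symmetric]) auto
  also have "\<dots> = (\<Prod>i\<in>UNIV. if i \<in> B then t + v (i, False) else t + v (i, False) + v (i, True))"
    by (rule prod.cong) (auto simp: opts0_def pweight_def)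
  also have "(\<Sum>g\<in>pats1 A B. t ^ Suc (?d g) * ?V g) = (\<Sum>g\<in>pats1 A B. \<Prod>i\<in>UNIV. pweight t v i (g i))"
    unfolding prod_pweight by (rule sum.cong) (simp_all only: act_dim_pats1[OF AB w])
  also have "\<dots> = (\<Sum>g\<in>PiE UNIV (opts1 A B). \<Prod>i\<in>UNIV. pweight t v i (g i)) - (\<Sum>g\<in>PiE UNIV (opts2 A B). \<Prod>i\<in>UNIV. pweight t v i (g i))"
    unfolding pats1_def
  proof (rule sum_diff)
    show "PiE UNIV (opts2 A B) \<subseteq> PiE UNIV (opts1 A B)"
      by (rule PiE_mono) (auto simp: opts1_def opts2_def opts0_def)
  qed (rule finite)
  also have "(\<Sum>g\<in>PiE UNIV (opts1 A B). \<Prod>i\<in>UNIV. pweight t v i (g i)) = (\<Prod>i\<in>UNIV. \<Sum>s\<in>opts1 A B i. pweight t v i s)"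
    by (rule prod_sum_PiE[symmetric]) auto
  also have "\<dots> = (\<Prod>i\<in>UNIV. if i \<in> A then v (i, False) * v (i, True) else if i \<in> B then t + v (i, False) else t + v (i, False) + v (i, True))"
    by (rule prod.cong) (auto simp: opts1_def opts0_def pweight_def UNIV_bool)
  also have "(\<Sum>g\<in>PiE UNIV (opts2 A B). \<Prod>i\<in>UNIV. pweight t v i (g i)) = (\<Prod>i\<in>UNIV. \<Sum>s\<in>opts2 A B i. pweight t v i s)"
    by (rule prod_sum_PiE[symmetric]) auto
  also have "\<dots> = (\<Prod>i\<in>UNIV. if i \<in> A then v (i, False) * v (i, True) else if i \<in> B then v (i, False) else t + v (i, False) + v (i, True))"
    by (rule prod.cong) (auto simp: opts2_def pweight_def UNIV_bool)
  finally show ?thesis by (simp add: algebra_simps)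
qed

section \<open>Linear forms vanishing on polynomials of all orders at \<open>-1\<close>\<close>

lemma dvd_one_plus_X_iff: "[:1, 1:] dvd p \<longleftrightarrow> poly p (-1) = (0::real)"
  using poly_eq_0_iff_dvd[of p "-1"] by simp

text \<open>Subtracting a multiple of the given polynomial of order exactly \<open>j\<close> raises
  the order of \<open>q\<close> at -1 and does not change \<open>L q\<close>. Beyond order
  \<open>n\<close> the degree bound leaves only 0, hence the induction runs downwards from
  \<open>j = n + 1\<close>.\<close>

lemma flag_vanish:
  fixes L :: "real poly \<Rightarrow> real"
  assumes add: "\<And>p q. L (p + q) = L p + L q" and smult: "\<And>c p. L (smult c p) = c * L p"
    and g: "\<And>j. 1 \<le> j \<Longrightarrow> j \<le> n \<Longrightarrow> \<exists>h. poly h (-1) \<noteq> 0 \<and> degree ([:1,1:] ^ j * h) \<le> n \<and> L ([:1,1:] ^ j * h) = 0"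
    and q: "degree q \<le> n" "poly q (-1) = 0"
  shows "L q = 0"
proof -
  have L0: "L 0 = 0" using smult[of 0 0] by simp
  have main: "L q = 0" if "[:1,1:] ^ j dvd q" "degree q \<le> n" "1 \<le> j" "j \<le> Suc n" for j q
    using that
  proof (induction "Suc n - j" arbitrary: j q)
    case 0
    then have "j = Suc n" by simp
    have "q = 0"
    proof (rule ccontr)
      assume "q \<noteq> 0"
      then have "degree ([:1,1:] ^ j :: real poly) \<le> degree q" using 0 by (intro dvd_imp_degree_le) auto
      moreover have "degree ([:1,1:] ^ j :: real poly) = j" by (subst degree_power_eq) auto
      ultimately show False using 0 \<open>j = Suc n\<close> by simp
    qed
    then show ?case using L0 by simp
  next
    case (Suc m)
    then have j: "1 \<le> j" "j \<le> n" by auto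
    obtain r where r: "q = [:1,1:] ^ j * r" using Suc.prems(1) by (rule dvdE)
    obtain h where h: "poly h (-1) \<noteq> 0" "degree ([:1,1:] ^ j * h) \<le> n" "L ([:1,1:] ^ j * h) = 0"
      using g[OF j] by blast
    define c where "c = poly r (-1) / poly h (-1)"
    define q' where "q' = q + smult (- c) ([:1,1:] ^ j * h)"
    have q': "q' = [:1,1:] ^ j * (r - smult c h)" by (simp add: q'_def r algebra_simps)
    have "[:1,1:] dvd (r - smult c h)" unfolding dvd_one_plus_X_iff using h by (simp add: c_def)
    then have "[:1,1:] ^ Suc j dvd q'" unfolding q' power_Suc2 by (intro mult_dvd_mono) auto
    moreover have "degree q' \<le> n" unfolding q'_def using Suc.prems(2) h(2)
      by (intro degree_add_le) (auto intro: order_trans[OF degree_smult_le])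
    ultimately have "L q' = 0" using Suc.hyps j by (intro Suc.hyps(1)[of "Suc j"]) auto
    moreover have "L q' = L q + (- c) * L ([:1,1:] ^ j * h)" unfolding q'_def add smult ..
    ultimately show ?case using h(3) by simp
  qed
  show ?thesis using main[of 1 q] q dvd_one_plus_X_iff[of q] by simp
qed

section \<open>Simplices with different vertex angles\<close>

lemma measure_flip:
  fixes s :: "'n::finite \<Rightarrow> real" and S :: "(real ^ 'n) set"
  assumes s: "\<And>j. \<bar>s j\<bar> = 1" and S: "S \<in> sets borel"
  shows "measure lborel ((\<lambda>x. \<chi> j. s j * x $ j) -` S) = measure lborel S"
proof -
  define T :: "real ^ 'n \<Rightarrow> real ^ 'n" where "T x = (\<chi> j. s j * x $ j)" for x
  define c :: "real ^ 'n \<Rightarrow> real" where "c b = (\<Sum>i\<in>UNIV. s i * b $ i)" for b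
  have c: "c (axis i 1) = s i" for i
  proof -
    have "c (axis i 1) = (\<Sum>k\<in>UNIV. if k = i then s k else 0)"
      unfolding c_def by (intro sum.cong) (auto simp: axis_def)
    then show ?thesis by simp
  qed
  have T: "T x = 0 + (\<Sum>b\<in>Basis. (c b * (x \<bullet> b)) *\<^sub>R b)" for x
  proof -
    have "(\<Sum>b\<in>Basis. (c b * (x \<bullet> b)) *\<^sub>R b) = (\<Sum>i\<in>UNIV. (s i * x $ i) *\<^sub>R axis i 1)"
      unfolding Basis_vec_def by (simp add: UNION_singleton_eq_range sum.reindex inj_on_def axis_eq_axis c inner_axis)
    also have "\<dots> = T x"
      by (simp add: vec_eq_iff T_def axis_def if_distrib cong: if_cong)
    finally show ?thesis by simp
  qed
  have cB: "\<bar>c b\<bar> = 1" if "b \<in> Basis" for b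
    using that s by (auto simp: Basis_vec_def c)
  have "lborel = density (distr lborel borel T) (\<lambda>_. (\<Prod>j\<in>Basis. \<bar>c j\<bar>))"
    unfolding T[abs_def] by (rule lborel_affine_euclidean) (use cB in force)
  also have "\<dots> = distr lborel borel T" using cB by (simp add: density_1)
  finally have "measure lborel S = measure (distr lborel borel T) S" by simp
  also have "\<dots> = measure lborel (T -` S)"
    using S by (subst measure_distr) (auto simp: T[abs_def])
  finally show ?thesis by (simp add: T_def[abs_def])
qed

text \<open>In terms of the \<open>card K + 1\<close> facet forms of the simplex: only the form
  \<open>u $ i\<close> is nonnegative, all others, including minus the weighted sum, are
  negative.\<close>

definition one_pos :: "'n set \<Rightarrow> ('n \<Rightarrow> real) \<Rightarrow> 'n \<Rightarrow> (real ^ 'n::finite) set" where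
  "one_pos K w i = {u \<in> cball 0 1. 0 \<le> u $ i \<and> (\<forall>j\<in>K - {i}. u $ j < 0) \<and> 0 < (\<Sum>j\<in>K. w j * u $ j)}"

definition dominant :: "'n set \<Rightarrow> ('n \<Rightarrow> real) \<Rightarrow> 'n \<Rightarrow> (real ^ 'n::finite) set" where
  "dominant K w i = {y \<in> cball 0 1. (\<forall>j\<in>K. 0 < y $ j) \<and> (\<Sum>j\<in>K - {i}. w j * y $ j) < w i * y $ i}"

lemma borel_one_pos: "one_pos K w i \<in> sets borel"
proof -
  have "one_pos K w i = cball 0 1 \<inter> ({u. 0 \<le> u $ i} \<inter> (\<Inter>j\<in>K - {i}. {u. u $ j < 0}) \<inter> {u. 0 < (\<Sum>j\<in>K. w j * u $ j)})"
    by (auto simp: one_pos_def)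
  also have "\<dots> \<in> sets borel"
    by (intro sets.Int borel_closed closed_cball closed_Collect_le borel_open open_INT open_Collect_less continuous_intros ballI) auto
  finally show ?thesis .
qed

lemma borel_dominant: "dominant K w i \<in> sets borel"
proof -
  have "dominant K w i = cball 0 1 \<inter> ((\<Inter>j\<in>K. {u. 0 < u $ j}) \<inter> {u. (\<Sum>j\<in>K - {i}. w j * u $ j) < w i * u $ i})"
    by (auto simp: dominant_def)
  also have "\<dots> \<in> sets borel"
    by (intro sets.Int borel_closed closed_cball borel_open open_INT open_Collect_less continuous_intros ballI) auto
  finally show ?thesis .
qed

text \<open>Changing the signs in \<open>K - {i}\<close> turns one region into the other. That
  \<open>u $ i\<close> is strictly positive is automatic, since no other term of the positive
  weighted sum is positive.\<close>

lemma measure_one_pos: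
  assumes w: "\<forall>j\<in>K. 0 < w j" and i: "i \<in> K"
  shows "measure lborel (one_pos K w i) = measure lborel (dominant K w i)"
proof -
  define s :: "'a \<Rightarrow> real" where "s j = (if j \<in> K - {i} then -1 else 1)" for j
  let ?T = "\<lambda>x :: real ^ 'a. \<chi> j. s j * x $ j"
  have nT: "norm (?T x) = norm x" for x :: "real ^ 'a"
  proof -
    have "norm ((?T x) $ j) = norm (x $ j)" for j by (simp add: s_def)
    then show ?thesis unfolding norm_vec_def by presburger
  qed
  have "one_pos K w i = ?T -` dominant K w i"
  proof (intro equalityI subsetI)
    fix u assume "u \<in> one_pos K w i"
    then have u: "norm u \<le> 1" "0 \<le> u $ i" "\<forall>j\<in>K - {i}. u $ j < 0" "0 < (\<Sum>j\<in>K. w j * u $ j)"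
      by (auto simp: one_pos_def)
    have split: "(\<Sum>j\<in>K. w j * u $ j) = w i * u $ i + (\<Sum>j\<in>K - {i}. w j * u $ j)"
      using i by (intro sum.remove) auto
    have "(\<Sum>j\<in>K - {i}. w j * u $ j) \<le> 0"
      using w u(3) by (intro sum_nonpos) (auto simp: mult_le_0_iff less_imp_le)
    then have "0 < w i * u $ i" using split u(4) by linarith
    then have "0 < u $ i" using u(2) by (auto simp: zero_less_mult_iff)
    moreover have "(\<Sum>j\<in>K - {i}. w j * (?T u) $ j) = - (\<Sum>j\<in>K - {i}. w j * u $ j)"
      unfolding sum_negf[symmetric] by (intro sum.cong) (auto simp: s_def)
    moreover have "(?T u) $ i = u $ i" by (simp add: s_def)
    ultimately show "u \<in> ?T -` dominant K w i"
      using u nT[of u] split unfolding dominant_def by (auto simp: s_def)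
  next
    fix u assume "u \<in> ?T -` dominant K w i"
    then have u: "norm (?T u) \<le> 1" "\<forall>j\<in>K. 0 < (?T u) $ j" "(\<Sum>j\<in>K - {i}. w j * (?T u) $ j) < w i * (?T u) $ i"
      by (auto simp: dominant_def)
    have split: "(\<Sum>j\<in>K. w j * u $ j) = w i * u $ i + (\<Sum>j\<in>K - {i}. w j * u $ j)"
      using i by (intro sum.remove) auto
    have "(\<Sum>j\<in>K - {i}. w j * (?T u) $ j) = - (\<Sum>j\<in>K - {i}. w j * u $ j)"
      unfolding sum_negf[symmetric] by (intro sum.cong) (auto simp: s_def)
    moreover have "(?T u) $ i = u $ i" by (simp add: s_def)
    moreover have "u $ j < 0" if "j \<in> K - {i}" for j using bspec[OF u(2), of j] that by (auto simp: s_def)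
    moreover have "0 < u $ i" using bspec[OF u(2) i] by (simp add: s_def)
    ultimately show "u \<in> one_pos K w i"
      using u nT[of u] split unfolding one_pos_def by auto
  qed
  then show ?thesis using measure_flip[OF _ borel_dominant, of s K w i] by (simp add: s_def)
qed

lemma dominant_disjoint:
  assumes w: "\<forall>j\<in>K. 0 < w j"
  shows "disjoint_family_on (dominant K w) K"
  unfolding disjoint_family_on_def
proof (intro ballI impI equals0I)
  fix i k y assume ik: "i \<in> K" "k \<in> K" "i \<noteq> k" and "y \<in> dominant K w i \<inter> dominant K w k"
  then have y: "\<forall>j\<in>K. 0 < y $ j" "(\<Sum>j\<in>K - {i}. w j * y $ j) < w i * y $ i" "(\<Sum>j\<in>K - {k}. w j * y $ j) < w k * y $ k"
    by (auto simp: dominant_def)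
  have "w k * y $ k \<le> (\<Sum>j\<in>K - {i}. w j * y $ j)"
    using ik w y(1) by (intro member_le_sum[of k]) (auto simp: less_imp_le)
  moreover have "w i * y $ i \<le> (\<Sum>j\<in>K - {k}. w j * y $ j)"
    using ik w y(1) by (intro member_le_sum[of i]) (auto simp: less_imp_le)
  ultimately show False using y by linarith
qed

lemma fmeasurable_sub_cball:
  assumes "S \<in> sets borel" "S \<subseteq> cball 0 1" shows "S \<in> fmeasurable (lborel :: (real ^ 'n::finite) measure)"
proof (rule fmeasurableI2)
  show "cball 0 1 \<in> fmeasurable (lborel :: (real ^ 'n) measure)"
    using emeasure_lborel_cball_finite[of "0 :: real ^ 'n" 1] by (auto simp: fmeasurable_def)
qed (use assms in auto)

text \<open>
  With equal weights and at least three coordinates, a definite part of the positive orthant has no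
  dominant coordinate; letting one weight tend to infinity makes that coordinate dominant almost
  everywhere.
\<close>

lemma one_pos_measure_varies:
  fixes K :: "'n::finite set"
  assumes K: "3 \<le> card K" and a: "a \<in> K"
  obtains w w' where "\<forall>j\<in>K. 0 < w j" "w a = 1" "\<forall>j\<in>K. 0 < w' j" "w' a = 1"
    "(\<Sum>i\<in>K. measure lborel (one_pos K w i)) \<noteq> (\<Sum>i\<in>K. measure lborel (one_pos K w' i))"
proof -
  define d where "d = CARD('n)"
  have d0: "d > 0" by (simp add: d_def)
  \<comment> \<open>Points of the box \<open>E\<close> below have l1 norm at most
    \<open>d * (3 / 2 * c) = 3 / 4\<close>, which keeps the box inside the ball.\<close>
  define c where "c = 1 / (2 * real d)"
  have c0: "c > 0" using d0 by (simp add: c_def)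
  define O' :: "(real ^ 'n) set" where "O' = {y \<in> cball 0 1. \<forall>j\<in>K. 0 < y $ j}"
  have Ob: "O' \<in> sets borel"
  proof -
    have "O' = cball 0 1 \<inter> (\<Inter>j\<in>K. {u. 0 < u $ j})" by (auto simp: O'_def)
    also have "\<dots> \<in> sets borel"
      by (intro sets.Int borel_closed closed_cball borel_open open_INT open_Collect_less continuous_intros ballI) auto
    finally show ?thesis .
  qed
  have Of: "O' \<in> fmeasurable lborel" using Ob by (rule fmeasurable_sub_cball) (auto simp: O'_def)
  \<comment> \<open>On this box any two coordinates add up to at least \<open>2 * c\<close>, which
    exceeds every third one; so with equal weights and \<open>card K\<close> at least 3 no
    coordinate dominates.\<close>
  define E :: "(real ^ 'n) set" where "E = cbox (\<chi> i. c) (\<chi> i. 3 / 2 * c)"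
  have Emem: "y \<in> E \<longleftrightarrow> (\<forall>i. c \<le> y $ i \<and> y $ i \<le> 3 / 2 * c)" for y
    by (auto simp: E_def mem_box_cart)
  have "(\<chi> i. c) \<in> E" using c0 by (simp add: Emem)
  then have "E \<noteq> {}" by blast
  then have "measure lborel E = (\<Prod>i\<in>(UNIV :: 'n set). 3 / 2 * c - c)"
    unfolding E_def by (simp add: content_cbox_cart)
  then have Epos: "measure lborel E > 0" using c0 by (simp add: prod_pos)
  define \<eta> where "\<eta> = measure lborel E"
  have EO: "E \<subseteq> O'"
  proof
    fix y assume y: "y \<in> E"
    have "norm y \<le> (\<Sum>i\<in>UNIV. \<bar>y $ i\<bar>)" by (rule norm_le_l1_cart)
    also have "\<dots> \<le> (\<Sum>i\<in>(UNIV :: 'n set). 3 / 2 * c)"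
    proof (rule sum_mono)
      fix i show "\<bar>y $ i\<bar> \<le> 3 / 2 * c" using y c0 unfolding Emem by (smt (verit))
    qed
    also have "\<dots> \<le> 1" using d0 by (simp add: c_def d_def)
    finally have "norm y \<le> 1" .
    moreover have "0 < y $ j" for j using y c0 unfolding Emem by (meson less_le_trans)
    ultimately show "y \<in> O'" by (simp add: O'_def)
  qed
  define w :: "'n \<Rightarrow> real" where "w j = 1" for j
  have w: "\<forall>j\<in>K. 0 < w j" by (simp add: w_def)
  have domO: "dominant K v i \<subseteq> O'" for v i by (auto simp: dominant_def O'_def)
  have domf: "dominant K v i \<in> fmeasurable lborel" for v i
    by (rule fmeasurable_sub_cball[OF borel_dominant]) (auto simp: dominant_def)
  let ?D = "\<Union>i\<in>K. dominant K w i"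
  have sum1: "measure lborel ?D = (\<Sum>i\<in>K. measure lborel (dominant K w i))"
  proof (rule measure_finite_Union)
    show "emeasure lborel (dominant K w i) \<noteq> \<infinity>" for i using fmeasurableD2[OF domf] by simp
  qed (use dominant_disjoint[OF w] borel_dominant in auto)
  have "?D \<inter> E = {}"
  proof (rule equals0I)
    fix y assume "y \<in> ?D \<inter> E"
    then obtain i where i: "i \<in> K" "y \<in> dominant K w i" "y \<in> E" by blast
    have "real (card (K - {i})) * c \<le> (\<Sum>j\<in>K - {i}. y $ j)"
      using i(3) by (intro sum_bounded_below) (auto simp: Emem)
    also have "\<dots> < y $ i" using i(2) by (simp add: dominant_def w_def)
    also have "\<dots> \<le> 3 / 2 * c" using i(3) by (simp add: Emem)
    finally have "real (card (K - {i})) < 3 / 2" using c0 by simp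
    moreover have "card (K - {i}) \<ge> 2" using i(1) K by simp
    ultimately show False by linarith
  qed
  moreover have Df: "?D \<in> fmeasurable lborel" using domf by (intro fmeasurable.finite_UN) auto
  moreover have Ef: "E \<in> fmeasurable lborel" unfolding E_def by (rule fmeasurable_cbox)
  ultimately have "measure lborel (?D \<union> E) = measure lborel ?D + \<eta>"
    unfolding \<eta>_def by (intro measure_Union) (auto dest: fmeasurableD fmeasurableD2)
  moreover have "measure lborel (?D \<union> E) \<le> measure lborel O'"
    using domO EO Df Ef Of by (intro measure_mono_fmeasurable Un_least UN_least sets.Un) (auto dest: fmeasurableD)
  ultimately have up: "(\<Sum>i\<in>K. measure lborel (dominant K w i)) + \<eta> \<le> measure lborel O'" using sum1 by simp
  have "card K \<noteq> 1" using K by simp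
  then obtain k where k: "k \<in> K" "k \<noteq> a" using a by (metis is_singletonI' is_singleton_altdef empty_iff)
  \<comment> \<open>All points of \<open>O'\<close> at which \<open>k\<close> does not dominate lie
    in the slab \<open>Z\<close>, and this \<open>W\<close> gives the slab measure
    \<open>\<eta> / 2\<close>, less than the loss \<open>\<eta>\<close> under equal weights. As
    \<open>k\<close> differs from \<open>a\<close>, the normalisation at \<open>a\<close>
    survives.\<close>
  define W where "W = real d * 2 ^ d / \<eta>"
  have W0: "W > 0" using d0 Epos by (simp add: W_def \<eta>_def)
  define w' where "w' j = (if j = k then W else 1)" for j
  have w': "\<forall>j\<in>K. 0 < w' j" using W0 by (simp add: w'_def)
  define Z :: "(real ^ 'n) set" where "Z = cbox (\<chi> i. if i = k then 0 else -1) (\<chi> i. if i = k then real d / W else 1)"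
  have Zne: "Z \<noteq> {}"
  proof -
    have "0 \<in> Z" using W0 by (simp add: Z_def mem_box_cart)
    then show ?thesis by blast
  qed
  have "measure lborel Z = (\<Prod>i\<in>(UNIV :: 'n set). if i = k then real d / W else 2)"
    using Zne unfolding Z_def by (simp add: content_cbox_cart if_distrib cong: if_cong)
  also have "\<dots> = (real d / W) * 2 ^ (d - 1)"
    by (subst prod.remove[of _ k]) (auto simp: d_def)
  also have "\<dots> = \<eta> * (2 ^ (d - 1) / 2 ^ d)" using d0 Epos by (simp add: W_def \<eta>_def)
  also have "(2 ^ (d - 1) / 2 ^ d :: real) = 1 / 2"
    using d0 by (cases d) auto
  finally have Zm: "measure lborel Z = \<eta> / 2" by simp
  have "O' \<subseteq> dominant K w' k \<union> Z"
  proof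
    fix y assume y: "y \<in> O'"
    have y1: "\<bar>y $ j\<bar> \<le> 1" for j using y component_le_norm_cart[of y j] by (simp add: O'_def)
    show "y \<in> dominant K w' k \<union> Z"
    proof (cases "(\<Sum>j\<in>K - {k}. w' j * y $ j) < w' k * y $ k")
      case True
      then show ?thesis using y by (simp add: dominant_def O'_def)
    next
      case False
      have "W * y $ k \<le> (\<Sum>j\<in>K - {k}. w' j * y $ j)" using False by (simp add: w'_def)
      also have "\<dots> \<le> (\<Sum>j\<in>K - {k}. 1)"
      proof (rule sum_mono)
        fix j assume "j \<in> K - {k}"
        then show "w' j * y $ j \<le> 1" using y1[of j] by (simp add: w'_def)
      qed
      also have "\<dots> \<le> real d" unfolding d_def by (simp add: card_mono)
      finally have "y $ k \<le> real d / W" using W0 by (simp add: field_simps)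
      moreover have "0 \<le> y $ k" using y k by (auto simp: O'_def less_imp_le)
      moreover have "- 1 \<le> y $ i \<and> y $ i \<le> 1" for i using y1[of i] by linarith
      ultimately have "y \<in> Z" by (simp add: Z_def mem_box_cart)
      then show ?thesis by blast
    qed
  qed
  moreover have Zf: "Z \<in> fmeasurable lborel" unfolding Z_def by (rule fmeasurable_cbox)
  ultimately have "measure lborel O' \<le> measure lborel (dominant K w' k \<union> Z)"
    using Ob domf by (intro measure_mono_fmeasurable fmeasurable.Un) auto
  also have "\<dots> \<le> measure lborel (dominant K w' k) + measure lborel Z"
    using Zf domf by (intro measure_Un_le) (auto simp: fmeasurable_def)
  also have "measure lborel (dominant K w' k) \<le> (\<Sum>i\<in>K. measure lborel (dominant K w' i))"
    using k by (intro member_le_sum[of k K "\<lambda>i. measure lborel (dominant K w' i)"]) auto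
  finally have lo: "measure lborel O' \<le> (\<Sum>i\<in>K. measure lborel (dominant K w' i)) + \<eta> / 2" using Zm by simp
  have "\<eta> > 0" using Epos by (simp add: \<eta>_def)
  then have "(\<Sum>i\<in>K. measure lborel (dominant K w i)) \<noteq> (\<Sum>i\<in>K. measure lborel (dominant K w' i))"
    using up lo by linarith
  moreover have "(\<Sum>i\<in>K. measure lborel (one_pos K v i)) = (\<Sum>i\<in>K. measure lborel (dominant K v i))"
    if "\<forall>j\<in>K. 0 < v j" for v
    using measure_one_pos[OF that] by (intro sum.cong) auto
  ultimately show ?thesis using that[of w w'] w w' k by (simp add: w_def w'_def)
qed

section \<open>The polynomials of face numbers and of angle sums\<close>

abbreviation X1 :: "real poly" where "X1 \<equiv> [:1, 1:]"
abbreviation X0 :: "real poly" where "X0 \<equiv> [:0, 1:]"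

definition fpoly :: "'a::euclidean_space set \<Rightarrow> real poly" where
  "fpoly P = (\<Sum>i\<le>DIM('a). monom (real (face_number i P)) i)"

definition apoly :: "'a::euclidean_space set \<Rightarrow> real poly" where
  "apoly P = (\<Sum>i\<le>DIM('a). monom (angle_sum i P) i)"

lemma coeff_sum_monom: "coeff (\<Sum>i\<le>n. monom (c i) i) k = (if k \<le> n then c k else 0)"
  by (simp add: coeff_sum if_distrib cong: if_cong)

lemma coeff_fpoly: "coeff (fpoly (P :: 'a::euclidean_space set)) k = (if k \<le> DIM('a) then real (face_number k P) else 0)"
  by (simp add: fpoly_def coeff_sum_monom)

lemma coeff_apoly: "coeff (apoly (P :: 'a::euclidean_space set)) k = (if k \<le> DIM('a) then angle_sum k P else 0)"
  by (simp add: apoly_def coeff_sum_monom)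

section \<open>Pyramids and prisms as full-dimensional polytopes, and their face polynomials\<close>

lemma bounded_pyramid_prism:
  assumes AB: "A \<inter> B = {}" "A \<noteq> {}" and w: "\<forall>j\<in>B. w j > 0"
  shows "bounded (pyramid_prism A B w)"
proof (rule bounded_subset[OF bounded_cbox])
  show "pyramid_prism A B w \<subseteq> cbox 0 (\<chi> i. if i \<in> B then 1 / w i else 1)"
  proof
    fix x assume x: "x \<in> pyramid_prism A B w"
    then have x0: "\<And>i. 0 \<le> x $ i" and x1: "\<And>i. i \<notin> B \<Longrightarrow> x $ i + (if i \<in> A then wvec B w \<bullet> x else 0) \<le> 1"
      by (auto simp: pyramid_prism_iff)
    obtain a where a: "a \<in> A" "a \<notin> B" using AB by blast
    have s1: "wvec B w \<bullet> x \<le> 1" using x0[of a] x1[OF a(2)] a(1) by simp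
    have nn: "0 \<le> w j * x $ j" if "j \<in> B" for j using w x0 that by (simp add: less_imp_le)
    then have s0: "0 \<le> wvec B w \<bullet> x" unfolding wvec_inner by (rule sum_nonneg)
    have "x $ i \<le> (if i \<in> B then 1 / w i else 1)" for i
    proof (cases "i \<in> B")
      case True
      have "w i * x $ i \<le> wvec B w \<bullet> x"
        unfolding wvec_inner using True nn by (intro member_le_sum[of i B "\<lambda>j. w j * x $ j"]) auto
      then have "w i * x $ i \<le> 1" using s1 by linarith
      then show ?thesis using True bspec[OF w True] by (simp add: field_simps)
    next
      case False
      then show ?thesis using x1[OF False] s0 by (cases "i \<in> A") auto
    qed
    then show "x \<in> cbox 0 (\<chi> i. if i \<in> B then 1 / w i else 1)" using x0 by (simp add: mem_box_cart)
  qed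
qed

lemma polytope_pyramid_prism:
  assumes "A \<inter> B = {}" "A \<noteq> {}" "\<forall>j\<in>B. w j > 0"
  shows "polytope (pyramid_prism A B w)"
  using bounded_pyramid_prism[OF assms] polyhedron_hpoly[OF finite_findex, of "fnormal A B w" fbound B]
  by (simp add: polytope_eq_bounded_polyhedron pyramid_prism_def)

lemma aff_dim_pyramid_prism:
  fixes A B :: "'n::finite set"
  assumes "A \<inter> B = {}" "A \<noteq> {}" "\<forall>j\<in>B. w j > 0"
  shows "aff_dim (pyramid_prism A B w) = int CARD('n)"
proof -
  have "(\<lambda>_. {}) \<in> pats0 B" by (simp add: pats0_iff)
  then have "Sigma UNIV (\<lambda>_. {}) \<in> factive A B w ` pyramid_prism A B w"
    unfolding factive_pyramid_prism[OF assms] by blast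
  then have "{} \<in> factive A B w ` hpoly (fnormal A B w) fbound (findex B)" by (simp add: pyramid_prism_def)
  then show ?thesis using aff_dim_hpoly[OF finite_findex, of "fnormal A B w" fbound B] unfolding pyramid_prism_def by simp
qed

text \<open>All weights \<open>v\<close> are 1 here, and the factor \<open>X0\<close> is the factor
  \<open>t\<close> of \<open>pyramid_prism_sum\<close>. The absence of \<open>w\<close> on the right
  is what allows the shape to change with fixed face numbers.\<close>

lemma fpoly_pyramid_prism:
  fixes A B :: "'n::finite set"
  assumes AB: "A \<inter> B = {}" "A \<noteq> {}" and w: "\<forall>j\<in>B. w j > 0"
  shows "X0 * fpoly (pyramid_prism A B w) = X0 * (\<Prod>i\<in>UNIV. if i \<in> B then X1 else [:2, 1:])
     + (\<Prod>i\<in>UNIV. if i \<in> A then 1 else if i \<in> B then X1 else [:2, 1:])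
     - (\<Prod>i\<in>UNIV. if i \<in> A \<or> i \<in> B then 1 else [:2, 1:])"
proof -
  have P: "polytope (pyramid_prism A B w)" by (rule polytope_pyramid_prism[OF assms])
  have "fpoly (pyramid_prism A B w) = (\<Sum>i\<le>CARD('n). \<Sum>F\<in>faces_of_dim i (pyramid_prism A B w). X0 ^ nat (aff_dim F))"
    unfolding fpoly_def face_number_def
    by (intro sum.cong) (auto simp: faces_of_dim_mem monom_altdef of_nat_poly)
  also have "\<dots> = (\<Sum>F\<in>nonempty_faces (pyramid_prism A B w). X0 ^ nat (aff_dim F))"
    using sum_nonempty_faces[OF P, of "\<lambda>F. X0 ^ nat (aff_dim F)"] by simp
  also have "\<dots> = (\<Sum>S\<in>factive A B w ` pyramid_prism A B w. X0 ^ act_dim (fnormal A B w) S)"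
    using sum_faces_hpoly[OF finite_findex, of "\<lambda>n T. X0 ^ n" "fnormal A B w" fbound B] unfolding pyramid_prism_def .
  finally have "X0 * fpoly (pyramid_prism A B w) = X0 * (\<Sum>S\<in>factive A B w ` pyramid_prism A B w. X0 ^ act_dim (fnormal A B w) S * (\<Prod>s\<in>S. 1))"
    by simp
  also have "\<dots> = X0 * (\<Prod>i\<in>UNIV. if i \<in> B then X1 else [:2, 1:])
     + (\<Prod>i\<in>UNIV. if i \<in> A then 1 else if i \<in> B then X1 else [:2, 1:])
     - (\<Prod>i\<in>UNIV. if i \<in> A \<or> i \<in> B then 1 else [:2, 1:])"
  proof -
    have e: "X0 + 1 = X1" "X1 + 1 = [:2, 1:]" by (simp_all add: one_pCons)
    have e3: "(if i \<in> A then 1 else if i \<in> B then 1 else [:2, 1:]) = (if i \<in> A \<or> i \<in> B then 1 else [:2, 1 :: real:])" for i by simp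
    show ?thesis using pyramid_prism_sum[OF assms, of X0 "\<lambda>_. 1"] by (simp only: mult_1_left e e3)
  qed
  finally show ?thesis .
qed

lemma fpoly_pyramid_prism_weight:
  fixes A B :: "'n::finite set"
  assumes "A \<inter> B = {}" "A \<noteq> {}" "\<forall>j\<in>B. w j > 0" "\<forall>j\<in>B. w' j > 0"
  shows "fpoly (pyramid_prism A B w) = fpoly (pyramid_prism A B w')"
proof -
  have "X0 * fpoly (pyramid_prism A B w) = X0 * fpoly (pyramid_prism A B w')"
    using fpoly_pyramid_prism[OF assms(1,2,3)] fpoly_pyramid_prism[OF assms(1,2,4)] by simp
  then show ?thesis by simp
qed

lemma prod_if_const:
  "(\<Prod>i\<in>(UNIV :: 'n::finite set). if i \<in> B then c else d) = c ^ card B * (d :: 'r::comm_semiring_1) ^ card (- B)"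
proof -
  have "(\<Prod>i\<in>(UNIV :: 'n set). if i \<in> B then c else d) = (\<Prod>i\<in>UNIV \<inter> {i. i \<in> B}. c) * (\<Prod>i\<in>UNIV \<inter> - {i. i \<in> B}. d)"
    by (rule prod.If_cases) simp
  then show ?thesis by simp
qed

lemma fpoly_pyramid_prism_full:
  fixes A :: "'n::finite set"
  assumes A: "A \<noteq> {}" and w: "\<forall>j\<in>-A. w j > 0"
  shows "X0 * fpoly (pyramid_prism A (- A) w) = X1 ^ card (- A) * (1 + X0 * [:2, 1:] ^ card A) - 1"
proof -
  have "X0 * fpoly (pyramid_prism A (- A) w) = X0 * (\<Prod>i\<in>UNIV. if i \<in> - A then X1 else [:2, 1:])
     + (\<Prod>i\<in>UNIV. if i \<in> A then 1 else if i \<in> - A then X1 else [:2, 1:])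
     - (\<Prod>i\<in>UNIV. if i \<in> A \<or> i \<in> - A then 1 else [:2, 1:])"
    using A w by (intro fpoly_pyramid_prism) auto
  also have "(\<lambda>i. if i \<in> A then 1 else if i \<in> - A then X1 else [:2, 1:]) = (\<lambda>i. if i \<in> A then 1 else X1)" by auto
  also have "(\<lambda>i. if i \<in> A \<or> i \<in> - A then 1 else [:2, 1:]) = (\<lambda>i. 1 :: real poly)" by auto
  finally show ?thesis unfolding prod_if_const by (simp add: algebra_simps)
qed

text \<open>With the empty face counted, passing to a pyramid multiplies \<open>1 + t * f\<close> by
  \<open>1 + t\<close>. For the \<open>m\<close>-cube this expression is
  \<open>1 + t * (2 + t) ^ m\<close>, with a simple zero at -1 if \<open>m \<ge> 2\<close>; for the
  simplex it is \<open>(1 + t) ^ (d + 1)\<close>.\<close>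

lemma fpoly_difference:
  fixes j :: nat
  assumes d: "2 \<le> CARD('n::finite)" and j: "1 \<le> j" "j \<le> CARD('n) - 1"
  obtains P Q :: "(real ^ 'n) set" and h where "polytope P" "polytope Q"
    "aff_dim P = int CARD('n)" "aff_dim Q = int CARD('n)"
    "fpoly P - fpoly Q = X1 ^ j * h" "poly h (-1) \<noteq> 0"
proof -
  define m where "m = CARD('n) - j + 1"
  have m: "2 \<le> m" "m \<le> CARD('n)" "CARD('n) - m = j - 1" using j d by (auto simp: m_def)
  obtain A :: "'n set" where A: "card A = m" using m(2) obtain_subset_with_card_n[of m UNIV] by auto
  obtain A1 :: "'n set" where A1: "card A1 = 1" using d obtain_subset_with_card_n[of 1 "UNIV :: 'n set"] by auto
  have ne: "A \<noteq> {}" "A1 \<noteq> {}" using A A1 m by auto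
  have cA: "card (- A) = j - 1" "card (- A1) = CARD('n) - 1" using A A1 m by (simp_all add: Compl_eq_Diff_UNIV card_Diff_subset)
  define P where "P = pyramid_prism A (- A) (\<lambda>_. 1)"
  define Q where "Q = pyramid_prism A1 (- A1) (\<lambda>_. 1)"
  define G where "G = 1 + X0 * [:2, 1:] ^ m"
  have "poly G (-1) = 0" by (simp add: G_def)
  then obtain H where H: "G = X1 * H" using dvd_one_plus_X_iff by (meson dvdE)
  have "pderiv G = X1 * pderiv H + H" unfolding H by (simp only: pderiv_mult) (simp add: pderiv_pCons)
  then have "poly H (-1) = poly (pderiv G) (-1)" by simp
  also have "\<dots> = 1 - real m"
    unfolding G_def
    by (simp only: pderiv_add pderiv_mult pderiv_power poly_add poly_mult poly_smult poly_power) (simp add: pderiv_pCons)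
  finally have Hm: "poly H (-1) = 1 - real m" .
  \<comment> \<open>Both \<open>H\<close> and \<open>X1 ^ m\<close> are 1 at 0, so the factor
    \<open>X0\<close> can be divided out of their difference without affecting the order at
    -1.\<close>
  have "poly G 0 = 1" by (simp add: G_def)
  then have "poly H 0 = 1" unfolding H by simp
  then have "poly (H - X1 ^ m) 0 = 0" by simp
  then obtain h where h: "H - X1 ^ m = X0 * h" using poly_eq_0_iff_dvd[of "H - X1 ^ m" 0] by (auto elim: dvdE)
  have "poly (H - X1 ^ m) (-1) = - poly h (-1)" unfolding h by simp
  then have hm: "poly h (-1) = real m - 1" using Hm m(1) by (simp add: power_0_left)
  have "X0 * fpoly P = X1 ^ (j - 1) * G - 1"
    unfolding P_def G_def using fpoly_pyramid_prism_full[OF ne(1), of "\<lambda>_. 1"] A cA by simp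
  moreover have "X0 * fpoly Q = X1 ^ (CARD('n) - 1) * (1 + X0 * [:2, 1:]) - 1"
    unfolding Q_def using fpoly_pyramid_prism_full[OF ne(2), of "\<lambda>_. 1"] A1 cA by simp
  moreover have "1 + X0 * [:2, 1:] = X1 ^ 2" by (simp add: power2_eq_square one_pCons)
  moreover have "X1 ^ (CARD('n) - 1) * X1 ^ 2 = X1 ^ j * X1 ^ m"
    unfolding power_add[symmetric] using j d by (simp add: m_def)
  moreover have "X1 ^ (j - 1) * G = X1 ^ j * H" unfolding H using j by (cases j) (auto simp: algebra_simps)
  ultimately have "X0 * (fpoly P - fpoly Q) = X1 ^ j * (H - X1 ^ m)" by (simp only: right_diff_distrib)
  also have "\<dots> = X0 * (X1 ^ j * h)" unfolding h by (simp only: mult.left_commute)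
  finally have "fpoly P - fpoly Q = X1 ^ j * h" by simp
  moreover have "poly h (-1) \<noteq> 0" using hm m by simp
  moreover have "polytope P" "aff_dim P = int CARD('n)" "polytope Q" "aff_dim Q = int CARD('n)"
    unfolding P_def Q_def using ne by (auto intro!: polytope_pyramid_prism aff_dim_pyramid_prism)
  ultimately show ?thesis using that by blast
qed

section \<open>Angle polynomials of products of a simplex and a cube\<close>

text \<open>
  Up to positive factors, the \<open>card K + 1\<close> linear forms \<open>u\<^sub>i\<close> (\<open>i \<in> K\<close>) and \<open>- (\<Sum>j\<in>K. w\<^sub>j u\<^sub>j)\<close> are the
  inner facet normals of the simplex, and \<open>neg_forms\<close> counts how many of them are negative at \<open>u\<close>.
\<close>

definition neg_forms :: "'n::finite set \<Rightarrow> ('n \<Rightarrow> real) \<Rightarrow> real ^ 'n \<Rightarrow> nat" where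
  "neg_forms K w u = card {i \<in> K. u $ i < 0} + (if 0 < (\<Sum>j\<in>K. w j * u $ j) then 1 else 0)"

definition neg_measure :: "'n::finite set \<Rightarrow> ('n \<Rightarrow> real) \<Rightarrow> nat \<Rightarrow> real" where
  "neg_measure K w m = measure lborel {u \<in> cball 0 1. neg_forms K w u = m}"

lemma borel_neg_forms: "{u \<in> cball 0 1. neg_forms K w u = m} \<in> sets borel"
proof -
  define f :: "real ^ 'a \<Rightarrow> real" where
    "f u = (\<Sum>i\<in>K. if u $ i < 0 then 1 else 0) + (if 0 < (\<Sum>j\<in>K. w j * u $ j) then 1 else 0)" for u
  have "real (neg_forms K w u) = f u" for u
    by (simp add: neg_forms_def f_def sum.If_cases Collect_conj_eq)
  then have "{u \<in> cball 0 1. neg_forms K w u = m} = cball 0 1 \<inter> (f -` {real m} \<inter> space borel)"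
    by (auto simp: of_nat_eq_iff[symmetric, where 'a=real] simp del: of_nat_eq_iff)
  moreover have "f \<in> borel_measurable borel"
    unfolding f_def by measurable
  then have "f -` {real m} \<inter> space borel \<in> sets borel" by (rule measurable_sets) simp
  ultimately show ?thesis by (simp add: borel_closed)
qed

text \<open>The forms \<open>u $ i\<close> and minus their weighted sum satisfy a linear dependence
  with positive coefficients, so off the coordinate hyperplanes they are neither all negative nor
  all nonnegative.\<close>

lemma neg_forms_range:
  fixes K :: "'n::finite set"
  assumes w: "\<forall>j\<in>K. 0 < w j" and K: "K \<noteq> {}" and u: "\<forall>i. u $ i \<noteq> 0"
  shows "neg_forms K w u \<in> {1..card K}"
proof -
  have le: "card {i \<in> K. u $ i < 0} \<le> card K" by (rule card_mono) auto
  show ?thesis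
  proof (cases "0 < (\<Sum>j\<in>K. w j * u $ j)")
    case True
    have "{i \<in> K. u $ i < 0} \<noteq> K"
    proof
      assume eq: "{i \<in> K. u $ i < 0} = K"
      have "u $ i < 0" if "i \<in> K" for i using that eq by blast
      then have "(\<Sum>j\<in>K. w j * u $ j) \<le> 0"
        using w by (intro sum_nonpos) (auto simp: mult_le_0_iff less_imp_le)
      then show False using True by simp
    qed
    then have "card {i \<in> K. u $ i < 0} < card K" by (intro psubset_card_mono) auto
    then show ?thesis using True by (simp add: neg_forms_def)
  next
    case False
    have "{i \<in> K. u $ i < 0} \<noteq> {}"
    proof
      assume "{i \<in> K. u $ i < 0} = {}"
      then have "0 < u $ i" if "i \<in> K" for i using u that by (metis (mono_tags, lifting) empty_Collect_eq linorder_neqE_linordered_idom)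
      then have "0 < (\<Sum>j\<in>K. w j * u $ j)" using w K by (intro sum_pos) auto
      then show False using False by simp
    qed
    then have "card {i \<in> K. u $ i < 0} > 0" by (simp add: card_gt_0_iff)
    then show ?thesis using False le by (simp add: neg_forms_def)
  qed
qed

lemma prod_indicator_forms:
  fixes K :: "'n::finite set"
  shows "(\<Prod>i\<in>K. if u $ i < 0 then X0 else X1) = X0 ^ card {i \<in> K. u $ i < 0} * X1 ^ (card K - card {i \<in> K. u $ i < 0})"
proof -
  have "(\<Prod>i\<in>K. if u $ i < 0 then X0 else X1) = (\<Prod>i\<in>K \<inter> {i. u $ i < 0}. X0) * (\<Prod>i\<in>K \<inter> - {i. u $ i < 0}. X1)"
    by (rule prod.If_cases) simp
  moreover have "K \<inter> {i. u $ i < 0} = {i \<in> K. u $ i < 0}" "K \<inter> - {i. u $ i < 0} = K - {i \<in> K. u $ i < 0}" by auto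
  moreover have "card (K - {i \<in> K. u $ i < 0}) = card K - card {i \<in> K. u $ i < 0}"
    by (rule card_Diff_subset) auto
  ultimately show ?thesis by simp
qed

lemma of_bool_conj_prod: "finite S \<Longrightarrow> (\<Prod>s\<in>S. of_bool (Q s) :: 'r::comm_ring_1) = of_bool (\<forall>s\<in>S. Q s)"
  by (induction S rule: finite_induct) auto

text \<open>Every facet form of the simplex contributes a factor \<open>X0\<close> if it is negative
  at \<open>u\<close> and \<open>X1\<close> otherwise. Each remaining cube coordinate contributes
  \<open>X1\<close> for either sign, since exactly one of its two constraints admits
  \<open>u\<close>. So only the number of negative forms matters.\<close>

lemma cone_poly_simplex_cube:
  fixes B :: "'n::finite set"
  assumes a: "a \<notin> B" and w: "\<forall>j\<in>B. w j > 0" "w a = 1" and u: "\<forall>i. u $ i \<noteq> 0"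
  defines "K \<equiv> insert a B"
  shows "(\<Sum>S\<in>factive {a} B w ` pyramid_prism {a} B w. X0 ^ act_dim (fnormal {a} B w) S * of_bool (u \<in> act_cone (fnormal {a} B w) S))
     = X0 ^ (neg_forms K w u - 1) * X1 ^ (CARD('n) + 1 - neg_forms K w u)"
proof -
  have wK: "\<forall>j\<in>K. w j > 0" using w by (auto simp: K_def)
  define v :: "'n \<times> bool \<Rightarrow> real poly" where "v s = of_bool (fnormal {a} B w s \<bullet> u \<le> 0)" for s
  define \<sigma> where "\<sigma> = (\<Sum>j\<in>K. w j * u $ j)"
  have \<sigma>: "\<sigma> = u $ a + wvec B w \<bullet> u"
    using a w by (simp add: \<sigma>_def K_def wvec_inner)
  define l where "l i = v (i, False)" for i
  define r where "r i = v (i, True)" for i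
  have l: "l i = (if u $ i < 0 then 0 else 1)" for i using u by (auto simp: l_def v_def)
  have ra: "r a = (if 0 < \<sigma> then 0 else 1)" by (auto simp: r_def v_def \<sigma>)
  have lr: "X0 + l i + r i = X1" if "i \<noteq> a" for i
  proof -
    have "r i = (if u $ i < 0 then 1 else 0)" using that u by (auto simp: r_def v_def le_less)
    then show ?thesis using l[of i] by (simp add: one_pCons)
  qed
  have lX: "X0 + l i = (if u $ i < 0 then X0 else X1)" for i by (simp add: l one_pCons)
  have rX: "X0 + r a = (if 0 < \<sigma> then X0 else X1)" by (simp add: ra one_pCons)
  let ?C = "- K"
  have split: "(\<Prod>i\<in>UNIV. if i = a then x else if i \<in> B then y i else X1) = x * (\<Prod>i\<in>B. y i) * X1 ^ card ?C" for x and y :: "'n \<Rightarrow> real poly"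
  proof -
    have U: "(UNIV :: 'n set) = insert a (B \<union> ?C)" "a \<notin> B \<union> ?C" "B \<inter> ?C = {}" using a by (auto simp: K_def)
    define f where "f i = (if i = a then x else if i \<in> B then y i else X1)" for i
    have "prod f UNIV = prod f (insert a (B \<union> ?C))" by (rule arg_cong[OF U(1)])
    also have "\<dots> = f a * (prod f B * prod f ?C)"
      using U(2,3) by (subst prod.insert) (auto simp: prod.union_disjoint)
    finally have "(\<Prod>i\<in>UNIV. if i = a then x else if i \<in> B then y i else X1) =
      x * ((\<Prod>i\<in>B. if i = a then x else if i \<in> B then y i else X1) * (\<Prod>i\<in>?C. if i = a then x else if i \<in> B then y i else X1))"
      by (simp add: f_def)
    moreover have "(\<Prod>i\<in>B. if i = a then x else if i \<in> B then y i else X1) = (\<Prod>i\<in>B. y i)"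
      using a by (intro prod.cong) auto
    moreover have "(\<Prod>i\<in>?C. if i = a then x else if i \<in> B then y i else X1) = (\<Prod>i\<in>?C. X1)"
      by (intro prod.cong) (auto simp: K_def)
    ultimately show ?thesis by (simp add: mult.assoc)
  qed
  \<comment> \<open>A nonzero product would mean that \<open>u\<close> satisfies all constraints of
    the simplex at once, but positive coordinates make the weighted sum positive.\<close>
  have zero: "l a * r a * (\<Prod>i\<in>B. l i) = 0"
  proof (rule ccontr)
    assume nz: "l a * r a * (\<Prod>i\<in>B. l i) \<noteq> 0"
    then have "(\<Prod>i\<in>B. l i) \<noteq> 0" by auto
    then have "l i \<noteq> 0" if "i \<in> B" for i using that by (metis finite prod_zero)
    then have "l i \<noteq> 0" if "i \<in> K" for i using that nz by (cases "i = a") (auto simp: K_def)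
    then have "0 < u $ i" if "i \<in> K" for i using that u l[of i] by (metis linorder_neqE_linordered_idom)
    then have "0 < \<sigma>" unfolding \<sigma>_def using wK by (intro sum_pos) (auto simp: K_def)
    then show False using nz ra by simp
  qed
  have S: "(\<Prod>s\<in>S. v s) = of_bool (u \<in> act_cone (fnormal {a} B w) S)" for S
    unfolding v_def act_cone_def by (subst of_bool_conj_prod) auto
  have "X0 * (\<Sum>S\<in>factive {a} B w ` pyramid_prism {a} B w. X0 ^ act_dim (fnormal {a} B w) S * (\<Prod>s\<in>S. v s)) =
     X0 * (\<Prod>i\<in>UNIV. if i \<in> B then X0 + l i else X0 + l i + r i)
     + (\<Prod>i\<in>UNIV. if i \<in> {a} then l i * r i else if i \<in> B then X0 + l i else X0 + l i + r i)
     - (\<Prod>i\<in>UNIV. if i \<in> {a} then l i * r i else if i \<in> B then l i else X0 + l i + r i)"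
    unfolding l_def r_def using a w by (intro pyramid_prism_sum) auto
  also have "(\<Prod>i\<in>UNIV. if i \<in> B then X0 + l i else X0 + l i + r i) =
      (\<Prod>i\<in>UNIV. if i = a then X0 + l a + r a else if i \<in> B then X0 + l i else X1)"
    by (rule prod.cong) (use a lr in auto)
  also have "(\<Prod>i\<in>UNIV. if i \<in> {a} then l i * r i else if i \<in> B then X0 + l i else X0 + l i + r i) =
      (\<Prod>i\<in>UNIV. if i = a then l a * r a else if i \<in> B then X0 + l i else X1)"
    by (rule prod.cong) (use lr in auto)
  also have "(\<Prod>i\<in>UNIV. if i \<in> {a} then l i * r i else if i \<in> B then l i else X0 + l i + r i) =
      (\<Prod>i\<in>UNIV. if i = a then l a * r a else if i \<in> B then l i else X1)"
    by (rule prod.cong) (use lr in auto)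
  \<comment> \<open>The first two products combine by
    \<open>t * (t + l + r) + l * r = (t + l) * (t + r)\<close>.\<close>
  also have "X0 * (\<Prod>i\<in>UNIV. if i = a then X0 + l a + r a else if i \<in> B then X0 + l i else X1) +
      (\<Prod>i\<in>UNIV. if i = a then l a * r a else if i \<in> B then X0 + l i else X1) -
      (\<Prod>i\<in>UNIV. if i = a then l a * r a else if i \<in> B then l i else X1) =
      ((X0 + l a) * (\<Prod>i\<in>B. X0 + l i)) * (X0 + r a) * X1 ^ card ?C"
  proof -
    have "l a * r a * (\<Prod>i\<in>B. l i) * X1 ^ card ?C = 0" unfolding zero by simp
    then show ?thesis unfolding split by (simp only: diff_zero) (simp only: distrib_right distrib_left mult.assoc mult.left_commute mult.commute add.assoc)
  qed
  also have "(X0 + l a) * (\<Prod>i\<in>B. X0 + l i) = (\<Prod>i\<in>K. X0 + l i)" using a by (simp add: K_def)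
  also have "\<dots> = X0 ^ card {i \<in> K. u $ i < 0} * X1 ^ (card K - card {i \<in> K. u $ i < 0})"
    unfolding lX by (rule prod_indicator_forms)
  finally have main: "X0 * (\<Sum>S\<in>factive {a} B w ` pyramid_prism {a} B w. X0 ^ act_dim (fnormal {a} B w) S * (\<Prod>s\<in>S. v s)) =
    X0 ^ card {i \<in> K. u $ i < 0} * X1 ^ (card K - card {i \<in> K. u $ i < 0}) * (X0 + r a) * X1 ^ card ?C" .
  let ?p = "card {i \<in> K. u $ i < 0}"
  let ?N = "neg_forms K w u"
  have N: "?N \<in> {1..card K}" using wK u by (intro neg_forms_range) (auto simp: K_def)
  have pK: "?p \<le> card K" by (rule card_mono) auto
  have C: "card ?C = CARD('n) - card K" "card K \<le> CARD('n)"
    by (simp_all add: Compl_eq_Diff_UNIV card_Diff_subset card_mono)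
  have "X0 ^ ?p * X1 ^ (card K - ?p) * (X0 + r a) * X1 ^ card ?C = X0 ^ ?N * X1 ^ (CARD('n) + 1 - ?N)"
  proof (cases "0 < \<sigma>")
    case True
    then have NN: "?N = Suc ?p" by (simp add: neg_forms_def \<sigma>_def)
    have "CARD('n) + 1 - ?N = (card K - ?p) + card ?C" using NN pK C by simp
    then show ?thesis using True by (simp add: rX NN power_add)
  next
    case False
    then have NN: "?N = ?p" by (simp add: neg_forms_def \<sigma>_def)
    have "CARD('n) + 1 - ?N = Suc ((card K - ?p) + card ?C)" using NN pK C by simp
    then show ?thesis using False by (simp only: rX NN if_False power_add power_Suc) (simp only: mult.assoc mult.left_commute mult.commute)
  qed
  also have "X0 ^ ?N = X0 * X0 ^ (?N - 1)" using N by (cases ?N) auto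
  finally have "X0 * (\<Sum>S\<in>factive {a} B w ` pyramid_prism {a} B w. X0 ^ act_dim (fnormal {a} B w) S * (\<Prod>s\<in>S. v s)) =
     X0 * (X0 ^ (?N - 1) * X1 ^ (CARD('n) + 1 - ?N))"
    using main by (simp only: mult.assoc)
  then show ?thesis unfolding S by (simp only: mult_cancel_left) simp
qed

lemma coeff_X0_power: "coeff (X0 ^ n) i = (if n = i then 1 else 0)"
  using coeff_monom[of "1::real" n i] by (simp add: monom_altdef)

lemma coeff_apoly_faces:
  fixes P :: "'a::euclidean_space set"
  assumes P: "polytope P"
  shows "coeff (apoly P) i = (\<Sum>F\<in>nonempty_faces P. if nat (aff_dim F) = i then interior_angle F P else 0)"
proof -
  have eq: "{F \<in> nonempty_faces P. nat (aff_dim F) = i} = faces_of_dim i P" by (auto simp: faces_of_dim_mem)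
  have "(\<Sum>F\<in>nonempty_faces P. if nat (aff_dim F) = i then interior_angle F P else 0) = angle_sum i P"
    unfolding angle_sum_def eq[symmetric] by (rule sum.inter_filter[symmetric, OF finite_nonempty_faces[OF P]])
  moreover have "angle_sum i P = 0" if "DIM('a) < i"
  proof -
    have "F \<notin> faces_of_dim i P" for F using aff_dim_le_DIM[of F] that by (auto simp: faces_of_dim_def)
    then have "faces_of_dim i P = {}" by blast
    then show ?thesis by (simp add: angle_sum_def)
  qed
  ultimately show ?thesis by (simp add: coeff_apoly)
qed

lemma lmeasurable_act_cone_ball: "act_cone v S \<inter> cball 0 1 \<in> lmeasurable"
proof (intro measurable_convex convex_Int convex_cball)
  have "act_cone v S = (\<Inter>i\<in>S. {u. v i \<bullet> u \<le> 0})" by (auto simp: act_cone_def)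
  then show "convex (act_cone v S)" by (auto intro: convex_INT convex_halfspace_le)
qed (simp add: bounded_Int)

lemma null_coordinates: "{u :: real ^ 'n::finite. \<exists>i. u $ i = 0} \<in> null_sets lebesgue"
proof -
  have "{u :: real ^ 'n. \<exists>i. u $ i = 0} = (\<Union>i\<in>UNIV. {u. u $ i = 0})" by auto
  also have "negligible \<dots>"
    by (rule negligible_Union) (auto intro: negligible_standard_hyperplane_cart)
  finally show ?thesis by (simp add: negligible_iff_null_sets)
qed

text \<open>This is \<open>cone_poly_simplex_cube\<close> integrated over the unit ball; directions
  with a zero coordinate form a null set. The shape \<open>w\<close> enters only through the masses
  \<open>neg_measure\<close>.\<close>

lemma apoly_simplex_cube:
  fixes B :: "'n::finite set"
  assumes a: "a \<notin> B" and w: "\<forall>j\<in>B. w j > 0" "w a = 1"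
  defines "K \<equiv> insert a B"
  shows "smult (measure lebesgue (cball 0 1 :: (real ^ 'n) set)) (apoly (pyramid_prism {a} B w)) =
    (\<Sum>m\<in>{1..card K}. smult (neg_measure K w m) (X0 ^ (m - 1) * X1 ^ (CARD('n) + 1 - m)))"
proof (rule poly_eqI)
  fix i
  let ?V = "measure lebesgue (cball 0 1 :: (real ^ 'n) set)"
  let ?P = "pyramid_prism {a} B w"
  let ?R = "factive {a} B w ` ?P"
  let ?d = "act_dim (fnormal {a} B w)" and ?c = "act_cone (fnormal {a} B w)"
  let ?N = "\<lambda>m. {u :: real ^ 'n. u \<in> cball 0 1 \<and> neg_forms K w u = m}"
  define q where "q m = X0 ^ (m - 1) * X1 ^ (CARD('n) + 1 - m)" for m
  have wK: "\<forall>j\<in>K. 0 < w j" using w by (auto simp: K_def)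
  have P: "polytope ?P" using a w by (intro polytope_pyramid_prism) auto
  have V: "?V > 0" by (rule unit_ball_measure_pos)
  have Nm: "?N m \<in> lmeasurable" for m
  proof -
    have "?N m \<in> fmeasurable lborel" by (rule fmeasurable_sub_cball[OF borel_neg_forms]) auto
    then show ?thesis by (auto simp: fmeasurable_def intro: sets_completionI_sets)
  qed
  have int: "integrable lebesgue (indicat_real (?c S \<inter> cball 0 1))" for S
    using lmeasurable_act_cone_ball[of "fnormal {a} B w" S] by (auto simp: fmeasurable_def)
  have intN: "integrable lebesgue (indicat_real (?N m))" for m
    using Nm[of m] by (auto simp: fmeasurable_def)
  have "coeff (apoly ?P) i = (\<Sum>F\<in>nonempty_faces ?P. if nat (aff_dim F) = i then measure lebesgue (face_cone F ?P \<inter> cball 0 1) / ?V else 0)"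
    unfolding coeff_apoly_faces[OF P]
    by (intro sum.cong refl if_cong interior_angle_eq[OF P]) (auto simp: nonempty_faces_def)
  also have "\<dots> = (\<Sum>S\<in>?R. if ?d S = i then measure lebesgue (?c S \<inter> cball 0 1) / ?V else 0)"
    using sum_faces_hpoly[OF finite_findex, of "\<lambda>n T. if n = i then measure lebesgue (T \<inter> cball 0 1) / ?V else 0" "fnormal {a} B w" fbound B]
    unfolding pyramid_prism_def .
  finally have "?V * coeff (apoly ?P) i = (\<Sum>S\<in>?R. ?V * (if ?d S = i then measure lebesgue (?c S \<inter> cball 0 1) / ?V else 0))"
    by (simp only: sum_distrib_left)
  also have "\<dots> = (\<Sum>S\<in>?R. (if ?d S = i then 1 else 0) * measure lebesgue (?c S \<inter> cball 0 1))"
    using V by (intro sum.cong) auto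
  also have "\<dots> = (\<Sum>S\<in>?R. (if ?d S = i then 1 else 0) * (\<integral>u. indicat_real (?c S \<inter> cball 0 1) u \<partial>lebesgue))"
    by simp
  also have "\<dots> = (\<integral>u. (\<Sum>S\<in>?R. (if ?d S = i then 1 else 0) * indicat_real (?c S \<inter> cball 0 1) u) \<partial>lebesgue)"
    using int by (subst Bochner_Integration.integral_sum) auto
  also have "\<dots> = (\<integral>u. (\<Sum>m\<in>{1..card K}. coeff (q m) i * indicat_real (?N m) u) \<partial>lebesgue)"
  proof (rule integral_cong_AE)
    have "integrable lebesgue (\<lambda>u. \<Sum>S\<in>?R. (if ?d S = i then 1 else 0) * indicat_real (?c S \<inter> cball 0 1) u)"
      using int by (intro Bochner_Integration.integrable_sum) auto
    then show "(\<lambda>u. \<Sum>S\<in>?R. (if ?d S = i then 1 else 0) * indicat_real (?c S \<inter> cball 0 1) u) \<in> borel_measurable lebesgue"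
      by (rule borel_measurable_integrable)
    have "integrable lebesgue (\<lambda>u. \<Sum>m\<in>{1..card K}. coeff (q m) i * indicat_real (?N m) u)"
      using intN by (intro Bochner_Integration.integrable_sum integrable_mult_right)
    then show "(\<lambda>u. \<Sum>m\<in>{1..card K}. coeff (q m) i * indicat_real (?N m) u) \<in> borel_measurable lebesgue"
      by (rule borel_measurable_integrable)
    show "AE u in lebesgue. (\<Sum>S\<in>?R. (if ?d S = i then 1 else 0) * indicat_real (?c S \<inter> cball 0 1) u) =
        (\<Sum>m\<in>{1..card K}. coeff (q m) i * indicat_real (?N m) u)"
    proof (rule AE_I'[OF null_coordinates], rule subsetI, rule ccontr)
      fix u :: "real ^ 'n"
      assume ne: "u \<in> {u \<in> space lebesgue. (\<Sum>S\<in>?R. (if ?d S = i then 1 else 0) * indicat_real (?c S \<inter> cball 0 1) u) \<noteq>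
        (\<Sum>m\<in>{1..card K}. coeff (q m) i * indicat_real (?N m) u)}" and "u \<notin> {u. \<exists>i. u $ i = 0}"
      then have u: "\<forall>i. u $ i \<noteq> 0" by simp
      let ?b = "indicat_real (cball 0 1) u"
      have NK: "neg_forms K w u \<in> {1..card K}" using wK u by (intro neg_forms_range) (auto simp: K_def)
      have "(\<Sum>S\<in>?R. (if ?d S = i then 1 else 0) * indicat_real (?c S \<inter> cball 0 1) u) =
        (\<Sum>S\<in>?R. coeff (X0 ^ ?d S * of_bool (u \<in> ?c S)) i) * ?b"
        unfolding sum_distrib_right
        by (intro sum.cong refl) (auto simp: indicator_def coeff_X0_power)
      also have "(\<Sum>S\<in>?R. coeff (X0 ^ ?d S * of_bool (u \<in> ?c S)) i) = coeff (q (neg_forms K w u)) i"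
        unfolding coeff_sum[symmetric] q_def
        using cone_poly_simplex_cube[OF a w u] unfolding K_def by (rule arg_cong)
      also have "coeff (q (neg_forms K w u)) i * ?b =
          (\<Sum>m\<in>{1..card K}. if m = neg_forms K w u then coeff (q m) i * ?b else 0)"
        using NK by simp
      also have "\<dots> = (\<Sum>m\<in>{1..card K}. coeff (q m) i * indicat_real (?N m) u)"
        by (intro sum.cong refl) (auto simp: indicator_def)
      finally show False using ne by simp
    qed
  qed
  also have "\<dots> = (\<Sum>m\<in>{1..card K}. coeff (q m) i * (\<integral>u. indicat_real (?N m) u \<partial>lebesgue))"
    using intN by (subst Bochner_Integration.integral_sum) (simp_all only: integrable_mult_right integral_mult_right_zero)
  also have "\<dots> = (\<Sum>m\<in>{1..card K}. neg_measure K w m * coeff (q m) i)"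
    using borel_neg_forms[of K w] by (intro sum.cong refl) (simp add: neg_measure_def)
  finally show "coeff (smult ?V (apoly ?P)) i = coeff (\<Sum>m\<in>{1..card K}. smult (neg_measure K w m) (X0 ^ (m - 1) * X1 ^ (CARD('n) + 1 - m))) i"
    by (simp add: coeff_sum q_def)
qed

text \<open>All but one of the \<open>card K + 1\<close> forms are negative. The exception is either
  minus the weighted sum, on a region that does not depend on \<open>w\<close>, or one of the
  \<open>u $ i\<close>; only the second part can vary with the shape.\<close>

lemma neg_measure_card:
  fixes K :: "'n::finite set"
  assumes w: "\<forall>j\<in>K. 0 < w j" and K: "K \<noteq> {}"
  shows "neg_measure K w (card K) = measure lborel {u :: real ^ 'n. u \<in> cball 0 1 \<and> (\<forall>i\<in>K. u $ i < 0)} + (\<Sum>i\<in>K. measure lborel (one_pos K w i))"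
proof -
  let ?N0 = "{u :: real ^ 'n. u \<in> cball 0 1 \<and> (\<forall>i\<in>K. u $ i < 0)}"
  have k0: "card K > 0" using K by (simp add: card_gt_0_iff)
  have eq: "{u \<in> cball 0 1. neg_forms K w u = card K} = ?N0 \<union> (\<Union>i\<in>K. one_pos K w i)"
  proof (intro equalityI subsetI)
    fix u assume "u \<in> {u \<in> cball 0 1. neg_forms K w u = card K}"
    then have u: "u \<in> cball 0 1" "neg_forms K w u = card K" by auto
    show "u \<in> ?N0 \<union> (\<Union>i\<in>K. one_pos K w i)"
    proof (cases "0 < (\<Sum>j\<in>K. w j * u $ j)")
      case True
      then have "Suc (card {i \<in> K. u $ i < 0}) = card K" using u(2) by (simp add: neg_forms_def)
      then have "card (K - {i \<in> K. u $ i < 0}) = 1" by (subst card_Diff_subset) auto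
      then obtain i where i: "K - {i \<in> K. u $ i < 0} = {i}" by (rule card_1_singletonE)
      then have "i \<in> K" "0 \<le> u $ i" "\<forall>j\<in>K - {i}. u $ j < 0" by (auto simp: set_eq_iff)
      then have "u \<in> one_pos K w i" using u(1) True by (simp add: one_pos_def)
      then show ?thesis using \<open>i \<in> K\<close> by blast
    next
      case False
      then have "card {i \<in> K. u $ i < 0} = card K" using u(2) by (simp add: neg_forms_def)
      then have "{i \<in> K. u $ i < 0} = K" by (intro card_subset_eq) auto
      then have "\<forall>i\<in>K. u $ i < 0" by blast
      then show ?thesis using u(1) by simp
    qed
  next
    fix u assume "u \<in> ?N0 \<union> (\<Union>i\<in>K. one_pos K w i)"
    then consider "u \<in> ?N0" | i where "i \<in> K" "u \<in> one_pos K w i" by blast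
    then show "u \<in> {u \<in> cball 0 1. neg_forms K w u = card K}"
    proof cases
      case 1
      then have "{i \<in> K. u $ i < 0} = K" by auto
      moreover have "\<not> 0 < (\<Sum>j\<in>K. w j * u $ j)"
        unfolding not_less using 1 w by (intro sum_nonpos) (auto simp: mult_le_0_iff less_imp_le)
      ultimately show ?thesis using 1 by (simp add: neg_forms_def)
    next
      case 2
      then have "{j \<in> K. u $ j < 0} = K - {i}" by (auto simp: one_pos_def)
      moreover have "0 < (\<Sum>j\<in>K. w j * u $ j)" "u \<in> cball 0 1" using 2 by (auto simp: one_pos_def)
      ultimately show ?thesis using 2(1) k0 by (simp add: neg_forms_def)
    qed
  qed
  have N0: "?N0 \<in> fmeasurable lborel"
  proof (rule fmeasurable_sub_cball)
    have "?N0 = cball 0 1 \<inter> (\<Inter>i\<in>K. {u. u $ i < 0})" by auto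
    also have "\<dots> \<in> sets borel"
      by (intro sets.Int borel_closed closed_cball borel_open open_INT open_Collect_less continuous_intros ballI) auto
    finally show "?N0 \<in> sets borel" .
  qed auto
  have op: "one_pos K w i \<in> fmeasurable lborel" for i
    by (rule fmeasurable_sub_cball[OF borel_one_pos]) (auto simp: one_pos_def)
  have "disjoint_family_on (one_pos K w) K"
    unfolding disjoint_family_on_def
  proof (intro ballI impI equals0I)
    fix i j u assume "i \<in> K" "j \<in> K" "i \<noteq> j" "u \<in> one_pos K w i \<inter> one_pos K w j"
    then have "0 \<le> u $ i" "u $ i < 0" by (auto simp: one_pos_def)
    then show False by simp
  qed
  then have "measure lborel (\<Union>i\<in>K. one_pos K w i) = (\<Sum>i\<in>K. measure lborel (one_pos K w i))"
    using borel_one_pos fmeasurableD2[OF op] by (intro measure_finite_Union) auto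
  moreover have "measure lborel (?N0 \<union> (\<Union>i\<in>K. one_pos K w i)) = measure lborel ?N0 + measure lborel (\<Union>i\<in>K. one_pos K w i)"
  proof (rule measure_Union)
    have U: "(\<Union>i\<in>K. one_pos K w i) \<in> fmeasurable lborel" using op by (intro fmeasurable.finite_UN) auto
    show "emeasure lborel (\<Union>i\<in>K. one_pos K w i) \<noteq> \<infinity>" using fmeasurableD2[OF U] by simp
    show "(\<Union>i\<in>K. one_pos K w i) \<in> sets lborel" using U by (rule fmeasurableD)
    show "emeasure lborel ?N0 \<noteq> \<infinity>" using fmeasurableD2[OF N0] by simp
    show "?N0 \<in> sets lborel" using N0 by (rule fmeasurableD)
    show "?N0 \<inter> (\<Union>i\<in>K. one_pos K w i) = {}" by (force simp: one_pos_def)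
  qed
  ultimately show ?thesis unfolding neg_measure_def eq by simp
qed

text \<open>After division by \<open>X1 ^ j\<close> the terms with \<open>m < k\<close> vanish at
  -1, and the term \<open>m = k\<close> carries the difference of the masses at
  \<open>card K\<close>. The bound on \<open>j\<close> means \<open>k \<ge> 3\<close>; for
  \<open>k = 2\<close> the angle sum of a triangle is fixed.\<close>

lemma apoly_difference:
  assumes j: "1 \<le> j" "j + 2 \<le> CARD('n::finite)"
  obtains P Q :: "(real ^ 'n) set" and h where "polytope P" "polytope Q"
    "aff_dim P = int CARD('n)" "aff_dim Q = int CARD('n)" "fpoly P = fpoly Q"
    "apoly P - apoly Q = X1 ^ j * h" "poly h (-1) \<noteq> 0"
proof -
  define k where "k = CARD('n) + 1 - j"
  have k: "3 \<le> k" "k \<le> CARD('n)" using j by (auto simp: k_def)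
  obtain K :: "'n set" where K: "card K = k" using k(2) obtain_subset_with_card_n[of k UNIV] by auto
  then have Kne: "K \<noteq> {}" using k by auto
  then obtain a where a: "a \<in> K" by blast
  obtain w w' where w: "\<forall>j\<in>K. 0 < w j" "w a = 1" "\<forall>j\<in>K. 0 < w' j" "w' a = 1"
    "(\<Sum>i\<in>K. measure lborel (one_pos K w i)) \<noteq> (\<Sum>i\<in>K. measure lborel (one_pos K w' i))"
    using one_pos_measure_varies[of K a] K k a by metis
  define B where "B = K - {a}"
  have B: "a \<notin> B" "insert a B = K" "{a} \<inter> B = {}" using a by (auto simp: B_def)
  have wB: "\<forall>j\<in>B. 0 < w j" "\<forall>j\<in>B. 0 < w' j" using w by (auto simp: B_def)
  let ?P = "pyramid_prism {a} B w" and ?Q = "pyramid_prism {a} B w'"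
  let ?V = "measure lebesgue (cball 0 1 :: (real ^ 'n) set)"
  have V: "?V > 0" by (rule unit_ball_measure_pos)
  define D where "D m = neg_measure K w m - neg_measure K w' m" for m
  define g where "g = (\<Sum>m\<in>{1..k}. smult (D m) (X0 ^ (m - 1) * X1 ^ (k - m)))"
  have "smult ?V (apoly ?P - apoly ?Q) = (\<Sum>m\<in>{1..k}. smult (D m) (X0 ^ (m - 1) * X1 ^ (CARD('n) + 1 - m)))"
    unfolding smult_diff_right apoly_simplex_cube[OF B(1) wB(1) w(2)] apoly_simplex_cube[OF B(1) wB(2) w(4)] B(2) K
    unfolding sum_subtractf[symmetric] D_def by (simp only: smult_diff_left)
  also have "\<dots> = X1 ^ j * g"
    unfolding g_def sum_distrib_left
  proof (rule sum.cong[OF refl])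
    fix m assume "m \<in> {1..k}"
    then have "CARD('n) + 1 - m = j + (k - m)" using j by (auto simp: k_def)
    then show "smult (D m) (X0 ^ (m - 1) * X1 ^ (CARD('n) + 1 - m)) = X1 ^ j * smult (D m) (X0 ^ (m - 1) * X1 ^ (k - m))"
      by (simp only: power_add mult_smult_right) (simp only: mult.left_commute)
  qed
  finally have "smult (1 / ?V) (smult ?V (apoly ?P - apoly ?Q)) = smult (1 / ?V) (X1 ^ j * g)" by simp
  then have diff: "apoly ?P - apoly ?Q = X1 ^ j * smult (1 / ?V) g" using V by (simp add: mult_smult_right)
  have "poly g (-1) = (\<Sum>m\<in>{1..k}. if m = k then D k * (-1) ^ (k - 1) else 0)"
    unfolding g_def poly_sum
  proof (rule sum.cong[OF refl])
    fix m assume "m \<in> {1..k}"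
    then show "poly (smult (D m) (X0 ^ (m - 1) * X1 ^ (k - m))) (-1) = (if m = k then D k * (-1) ^ (k - 1) else 0)"
      by (auto simp: power_0_left)
  qed
  also have "\<dots> = D k * (-1) ^ (k - 1)" using k by simp
  finally have "poly g (-1) = D k * (-1) ^ (k - 1)" .
  moreover have "D k \<noteq> 0"
    using neg_measure_card[OF w(1) Kne] neg_measure_card[OF w(3) Kne] w(5) K by (simp add: D_def)
  ultimately have "poly (smult (1 / ?V) g) (-1) \<noteq> 0" using V by simp
  moreover have "polytope ?P" "polytope ?Q" "aff_dim ?P = int CARD('n)" "aff_dim ?Q = int CARD('n)" "fpoly ?P = fpoly ?Q"
    using B(3) wB by (auto intro!: polytope_pyramid_prism aff_dim_pyramid_prism fpoly_pyramid_prism_weight)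
  ultimately show ?thesis using that diff by blast
qed

section \<open>The space of affine relations\<close>

lemma bij_pairs_sum:
  fixes idx :: "'m::finite \<Rightarrow> nat" and f :: "nat \<Rightarrow> real"
  assumes "bij_betw idx UNIV {..<2 * d + 2}"
  shows "(\<Sum>k\<in>UNIV. f (idx k)) = (\<Sum>i\<le>d. f i) + (\<Sum>i\<le>d. f (d + 1 + i))"
proof -
  have "(\<Sum>k\<in>UNIV. f (idx k)) = (\<Sum>i\<in>{..<2 * d + 2}. f i)"
    using assms by (rule sum.reindex_bij_betw)
  also have "{..<2 * d + 2} = {..d} \<union> {d + 1..2 * d + 1}" by auto
  also have "sum f \<dots> = sum f {..d} + sum f {d + 1..2 * d + 1}" by (rule sum.union_disjoint) auto
  also have "sum f {d + 1..2 * d + 1} = (\<Sum>i\<le>d. f (d + 1 + i))"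
    by (rule sum.reindex_bij_witness[of _ "\<lambda>i. d + 1 + i" "\<lambda>i. i - (d + 1)"]) auto
  finally show ?thesis .
qed

text \<open>A general combination of the five relations: \<open>a\<close> and \<open>b\<close>
  multiply those of Gram and Euler, \<open>e\<close> the one between facet angles and facet number,
  \<open>a'\<close> and \<open>b'\<close> the normalisations at \<open>d\<close>. Constant terms are
  absent because only differences of vectors matter.\<close>

definition relation_coeff :: "nat \<Rightarrow> real \<times> real \<times> real \<times> real \<times> real \<Rightarrow> nat \<Rightarrow> real" where
  "relation_coeff d = (\<lambda>(a, e, a', b, b') i.
     if i \<le> d then a * (-1) ^ i + (if i = d - 1 then e else 0) + (if i = d then a' else 0)
     else b * (-1) ^ (i - (d + 1)) + (if i - (d + 1) = d - 1 then - e / 2 else 0) + (if i - (d + 1) = d then b' else 0))"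

lemma relation_coeff_low:
  "i \<le> d \<Longrightarrow> relation_coeff d (a, e, a', b, b') i = a * (-1) ^ i + (if i = d - 1 then e else 0) + (if i = d then a' else 0)"
  by (simp add: relation_coeff_def)

lemma relation_coeff_high:
  "relation_coeff d (a, e, a', b, b') (d + 1 + i) = b * (-1) ^ i + (if i = d - 1 then - e / 2 else 0) + (if i = d then b' else 0)"
  by (simp add: relation_coeff_def)

lemma relation_coeff_linear:
  fixes idx :: "'m::finite \<Rightarrow> nat"
  shows "linear (\<lambda>v. (\<chi> k. relation_coeff d v (idx k)) :: real ^ 'm)"
  by (rule linearI) (auto simp: relation_coeff_def vec_eq_iff algebra_simps add_divide_distrib diff_divide_distrib)

text \<open>For \<open>2 \<le> d\<close> the position 0 differs from \<open>d - 1\<close> and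
  \<open>d\<close>, which isolates \<open>a\<close> and \<open>b\<close>; the other parameters
  follow.\<close>

lemma relation_coeff_inj:
  assumes d: "2 \<le> d" and z: "\<And>i. i < 2 * d + 2 \<Longrightarrow> relation_coeff d v i = 0"
  shows "v = 0"
proof -
  obtain a e a' b b' where v: "v = (a, e, a', b, b')" by (metis prod.exhaust)
  have z1: "a * (-1) ^ i + (if i = d - 1 then e else 0) + (if i = d then a' else 0) = 0" if "i \<le> d" for i
    using z[of i] relation_coeff_low[OF that, of a e a' b b'] that v by simp
  have z2: "b * (-1) ^ i + (if i = d - 1 then - e / 2 else 0) + (if i = d then b' else 0) = 0" if "i \<le> d" for i
    using z[of "d + 1 + i"] relation_coeff_high[of d a e a' b b' i] that v by simp
  have dd: "d - 1 \<noteq> d" "d \<noteq> d - 1" using d by auto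
  have "a = 0" using z1[of 0] d by simp
  moreover have "b = 0" using z2[of 0] d by simp
  moreover have "e = 0" using z1[of "d - 1"] \<open>a = 0\<close> d dd by simp
  moreover have "a' = 0" using z1[of d] \<open>a = 0\<close> d dd by simp
  moreover have "b' = 0" using z2[of d] \<open>b = 0\<close> d dd by simp
  ultimately show ?thesis using v by (simp add: zero_prod_def)
qed

lemma polytope_relations:
  fixes P :: "(real ^ 'n::finite) set"
  assumes P: "polytope P" "aff_dim P = int CARD('n)"
  shows "(\<Sum>i\<le>CARD('n). (-1) ^ i * angle_sum i P) = 0"
    and "(\<Sum>i\<le>CARD('n). (-1) ^ i * real (face_number i P)) = 1"
    and "angle_sum CARD('n) P = 1" and "face_number CARD('n) P = 1"
    and "angle_sum (CARD('n) - 1) P = real (face_number (CARD('n) - 1) P) / 2"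
proof -
  have ne: "P \<noteq> {}" using P(2) by auto
  have d: "aff_dim P = int DIM(real ^ 'n)" using P(2) by simp
  show "(\<Sum>i\<le>CARD('n). (-1) ^ i * angle_sum i P) = 0" using gram_relation[OF P(1)] by simp
  show "(\<Sum>i\<le>CARD('n). (-1) ^ i * real (face_number i P)) = 1" using euler_relation[OF P(1) ne] by simp
  show "angle_sum CARD('n) P = 1" using angle_sum_full[OF P(1) d] by simp
  show "face_number CARD('n) P = 1" using face_number_full[OF polytope_imp_convex[OF P(1)] d] by simp
  show "angle_sum (CARD('n) - 1) P = real (face_number (CARD('n) - 1) P) / 2" using angle_sum_facets[OF P(1) d] by simp
qed

lemma sum_split_two:
  fixes f :: "nat \<Rightarrow> real"
  assumes "2 \<le> d" shows "(\<Sum>i\<le>d. f i) = (\<Sum>i\<le>d - 2. f i) + f (d - 1) + f d"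
proof -
  obtain n where "d = Suc (Suc n)" using assms by (metis add_2_eq_Suc le_Suc_ex)
  then show ?thesis by simp
qed

text \<open>Pairs with equal \<open>f\<close> show that \<open>A\<close> alternates up to
  \<open>d - 2\<close>. Gram's relation then evaluates the angle part on every difference through
  the facet number, which leaves a relation between face numbers; the same argument makes its
  coefficients alternate up to \<open>d - 1\<close>.\<close>

lemma relation_imp_coeff:
  fixes A B :: "nat \<Rightarrow> real"
  assumes d: "2 \<le> CARD('n::finite)"
    and AB: "\<And>(P :: (real ^ 'n) set) (Q :: (real ^ 'n) set). polytope P \<Longrightarrow> aff_dim P = int CARD('n) \<Longrightarrow>
      polytope Q \<Longrightarrow> aff_dim Q = int CARD('n) \<Longrightarrow>
      (\<Sum>i\<le>CARD('n). A i * (angle_sum i P - angle_sum i Q)) +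
      (\<Sum>i\<le>CARD('n). B i * (real (face_number i P) - real (face_number i Q))) = 0"
  obtains v where "\<And>i. i \<le> CARD('n) \<Longrightarrow> A i = relation_coeff CARD('n) v i"
    "\<And>i. i \<le> CARD('n) \<Longrightarrow> B i = relation_coeff CARD('n) v (CARD('n) + 1 + i)"
proof -
  let ?d = "CARD('n)"
  define LA where "LA p = (\<Sum>i\<le>?d. A i * coeff p i)" for p :: "real poly"
  define LB where "LB p = (\<Sum>i\<le>?d. B i * coeff p i)" for p :: "real poly"
  have LA_add: "LA (p + q) = LA p + LA q" for p q by (simp add: LA_def distrib_left sum.distrib)
  have LB_add: "LB (p + q) = LB p + LB q" for p q by (simp add: LB_def distrib_left sum.distrib)
  have LA_smult: "LA (smult c p) = c * LA p" for c p by (simp add: LA_def sum_distrib_left mult.left_commute)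
  have LB_smult: "LB (smult c p) = c * LB p" for c p by (simp add: LB_def sum_distrib_left mult.left_commute)
  have LAB: "LA (apoly P - apoly Q) + LB (fpoly P - fpoly Q) = 0"
    if "polytope P" "aff_dim P = int ?d" "polytope Q" "aff_dim Q = int ?d" for P Q :: "(real ^ 'n) set"
    using AB[OF that] by (simp add: LA_def LB_def coeff_apoly coeff_fpoly)
  have LA_monom: "LA (monom 1 i) = A i" if "i \<le> ?d" for i
    using that by (simp add: LA_def if_distrib cong: if_cong)
  have LB_monom: "LB (monom 1 i) = B i" if "i \<le> ?d" for i
    using that by (simp add: LB_def if_distrib cong: if_cong)
  have deg: "degree p \<le> n" if "\<And>i. n < i \<Longrightarrow> coeff p i = 0" for p :: "real poly" and n
    using that by (rule degree_le[OF allI[OF impI]])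
  have vanishA: "LA q = 0" if "degree q \<le> ?d - 2" "poly q (-1) = 0" for q
  proof (rule flag_vanish[where L=LA, OF LA_add LA_smult _ that])
    fix j assume j: "1 \<le> j" "j \<le> ?d - 2"
    then have "j + 2 \<le> ?d" by simp
    obtain P Q :: "(real ^ 'n) set" and h where PQ: "polytope P" "polytope Q"
      "aff_dim P = int ?d" "aff_dim Q = int ?d" "fpoly P = fpoly Q"
      "apoly P - apoly Q = X1 ^ j * h" "poly h (-1) \<noteq> 0"
      using apoly_difference[OF j(1) \<open>j + 2 \<le> ?d\<close>] by metis
    have "LB (fpoly P - fpoly Q) = 0" by (simp add: PQ(5) LB_def)
    then have "LA (X1 ^ j * h) = 0" using LAB[OF PQ(1,3,2,4)] PQ(6) by simp
    \<comment> \<open>Equal facet numbers force equal angle sums at \<open>d - 1\<close>, and at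
      \<open>d\<close> both are 1; so no terms above \<open>d - 2\<close> remain.\<close>
    moreover have "degree (X1 ^ j * h) \<le> ?d - 2"
      unfolding PQ(6)[symmetric]
    proof (rule deg)
      fix i assume "?d - 2 < i"
      then consider "i = ?d - 1" | "i = ?d" | "?d < i" using d by linarith
      then show "coeff (apoly P - apoly Q) i = 0"
      proof cases
        case 1
        have "coeff (fpoly P) (?d - 1) = coeff (fpoly Q) (?d - 1)" by (simp add: PQ(5))
        then have "face_number (?d - 1) P = face_number (?d - 1) Q" by (simp add: coeff_fpoly)
        then show ?thesis using 1 polytope_relations(5)[OF PQ(1,3)] polytope_relations(5)[OF PQ(2,4)] by (simp add: coeff_apoly)
      next
        case 2
        then show ?thesis using polytope_relations(3)[OF PQ(1,3)] polytope_relations(3)[OF PQ(2,4)] by (simp add: coeff_apoly)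
      qed (simp add: coeff_apoly)
    qed
    ultimately show "\<exists>h. poly h (-1) \<noteq> 0 \<and> degree (X1 ^ j * h) \<le> ?d - 2 \<and> LA (X1 ^ j * h) = 0"
      using PQ(7) by blast
  qed
  \<comment> \<open>The polynomial \<open>t ^ i - (-1) ^ i\<close> vanishes at -1, so
    \<open>L\<close> annihilates it.\<close>
  have alt: "L (monom 1 i) = (-1) ^ i * L (monom 1 0)"
    if L: "\<And>p q. L (p + q) = L p + L q" "\<And>c p. L (smult c p) = c * L p"
      "\<And>q. degree q \<le> n \<Longrightarrow> poly q (-1) = 0 \<Longrightarrow> L q = 0" and i: "i \<le> n"
    for L :: "real poly \<Rightarrow> real" and n i
  proof -
    let ?q = "monom 1 i + smult (- ((-1) ^ i)) (monom (1::real) 0)"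
    have "L ?q = 0"
    proof (rule L(3))
      show "degree ?q \<le> n" using i by (intro degree_add_le order_trans[OF degree_smult_le]) (auto simp: degree_monom_eq)
      show "poly ?q (-1) = 0" by (simp add: poly_monom)
    qed
    then show ?thesis unfolding L(1,2) by simp
  qed
  have A_alt: "A i = (-1) ^ i * A 0" if "i \<le> ?d - 2" for i
    using alt[of LA "?d - 2" i, OF LA_add LA_smult vanishA that] LA_monom[of i] LA_monom[of 0] that by simp
  \<comment> \<open>The deviation of \<open>A\<close> from the alternating pattern at
    \<open>d - 1\<close>, hence the multiple of the facet relation that is involved.\<close>
  define e where "e = A (?d - 1) - (-1) ^ (?d - 1) * A 0"
  have LA_diff: "LA (apoly P - apoly Q) = e / 2 * coeff (fpoly P - fpoly Q) (?d - 1)"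
    if P: "polytope P" "aff_dim P = int ?d" and Q: "polytope Q" "aff_dim Q = int ?d" for P Q :: "(real ^ 'n) set"
  proof -
    let ?D = "\<lambda>i. angle_sum i P - angle_sum i Q"
    have Dd: "?D ?d = 0" using polytope_relations(3)[OF P] polytope_relations(3)[OF Q] by simp
    have "(\<Sum>i\<le>?d. (-1) ^ i * ?D i) = 0"
      using polytope_relations(1)[OF P] polytope_relations(1)[OF Q] by (simp add: right_diff_distrib sum_subtractf)
    then have G: "(\<Sum>i\<le>?d - 2. (-1) ^ i * ?D i) = - ((-1) ^ (?d - 1) * ?D (?d - 1))"
      using sum_split_two[OF d, of "\<lambda>i. (-1) ^ i * ?D i"] Dd by simp
    have "LA (apoly P - apoly Q) = (\<Sum>i\<le>?d. A i * ?D i)"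
      by (simp add: LA_def coeff_apoly)
    also have "\<dots> = (\<Sum>i\<le>?d - 2. A i * ?D i) + A (?d - 1) * ?D (?d - 1)"
      using sum_split_two[OF d, of "\<lambda>i. A i * ?D i"] Dd by simp
    also have "(\<Sum>i\<le>?d - 2. A i * ?D i) = A 0 * (\<Sum>i\<le>?d - 2. (-1) ^ i * ?D i)"
      unfolding sum_distrib_left
    proof (rule sum.cong[OF refl])
      fix i assume "i \<in> {..?d - 2}"
      then show "A i * ?D i = A 0 * ((-1) ^ i * ?D i)" using A_alt[of i] by simp
    qed
    finally have "LA (apoly P - apoly Q) = e * ?D (?d - 1)" unfolding G by (simp add: e_def algebra_simps)
    moreover have "?D (?d - 1) = coeff (fpoly P - fpoly Q) (?d - 1) / 2"
      using polytope_relations(5)[OF P] polytope_relations(5)[OF Q] by (simp add: coeff_fpoly diff_divide_distrib)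
    ultimately show ?thesis by simp
  qed
  \<comment> \<open>On a difference of face polynomials the added term equals the value of
    \<open>LA\<close> on the corresponding angle polynomials, by \<open>LA_diff\<close>.\<close>
  define LC where "LC p = LB p + e / 2 * coeff p (?d - 1)" for p
  have LC_add: "LC (p + q) = LC p + LC q" for p q by (simp add: LC_def LB_add algebra_simps add_divide_distrib)
  have LC_smult: "LC (smult c p) = c * LC p" for c p by (simp add: LC_def LB_smult algebra_simps)
  have vanishC: "LC q = 0" if "degree q \<le> ?d - 1" "poly q (-1) = 0" for q
  proof (rule flag_vanish[where L=LC, OF LC_add LC_smult _ that])
    fix j assume j: "1 \<le> j" "j \<le> ?d - 1"
    obtain P Q :: "(real ^ 'n) set" and h where PQ: "polytope P" "polytope Q"
      "aff_dim P = int ?d" "aff_dim Q = int ?d" "fpoly P - fpoly Q = X1 ^ j * h" "poly h (-1) \<noteq> 0"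
      using fpoly_difference[OF d j] by metis
    have "LC (X1 ^ j * h) = 0"
      using LAB[OF PQ(1,3,2,4)] LA_diff[OF PQ(1,3,2,4)] unfolding PQ(5) LC_def by simp
    moreover have "degree (X1 ^ j * h) \<le> ?d - 1"
      unfolding PQ(5)[symmetric]
    proof (rule deg)
      fix i assume "?d - 1 < i"
      then consider "i = ?d" | "?d < i" by linarith
      then show "coeff (fpoly P - fpoly Q) i = 0"
      proof cases
        case 1
        then show ?thesis using polytope_relations(4)[OF PQ(1,3)] polytope_relations(4)[OF PQ(2,4)] by (simp add: coeff_fpoly)
      qed (simp add: coeff_fpoly)
    qed
    ultimately show "\<exists>h. poly h (-1) \<noteq> 0 \<and> degree (X1 ^ j * h) \<le> ?d - 1 \<and> LC (X1 ^ j * h) = 0"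
      using PQ(6) by blast
  qed
  have LC_monom: "LC (monom 1 i) = B i + (if i = ?d - 1 then e / 2 else 0)" if "i \<le> ?d" for i
    using LB_monom[OF that] by (simp add: LC_def)
  have B_alt: "B i + (if i = ?d - 1 then e / 2 else 0) = (-1) ^ i * B 0" if "i \<le> ?d - 1" for i
    using alt[of LC "?d - 1" i, OF LC_add LC_smult vanishC that] LC_monom[of i] LC_monom[of 0] that d by simp
  let ?v = "(A 0, e, A ?d - A 0 * (-1) ^ ?d, B 0, B ?d - B 0 * (-1) ^ ?d)"
  show ?thesis
  proof (rule that[of ?v])
    fix i assume i: "i \<le> ?d"
    then consider "i \<le> ?d - 2" | "i = ?d - 1" | "i = ?d" by linarith
    then show "A i = relation_coeff ?d ?v i"
    proof cases
      case 1
      then have "i \<noteq> ?d - 1" "i \<noteq> ?d" using d by auto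
      then show ?thesis unfolding relation_coeff_low[OF i] using A_alt[OF 1] by simp
    next
      case 2
      then have "i \<noteq> ?d" using d by auto
      then show ?thesis unfolding relation_coeff_low[OF i] using 2 by (simp add: e_def)
    next
      case 3
      then have "i \<noteq> ?d - 1" using d by auto
      then show ?thesis unfolding relation_coeff_low[OF i] using 3 by simp
    qed
  next
    fix i assume i: "i \<le> ?d"
    then consider "i \<le> ?d - 1" | "i = ?d" by linarith
    then show "B i = relation_coeff ?d ?v (?d + 1 + i)"
    proof cases
      case 1
      then have "i \<noteq> ?d" using d by auto
      then show ?thesis unfolding relation_coeff_high using B_alt[OF 1] by (simp add: algebra_simps split: if_splits)
    next
      case 2
      then have "i \<noteq> ?d - 1" using d by auto
      then show ?thesis unfolding relation_coeff_high using 2 by simp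
    qed
  qed
qed

theorem theorem2p3p6:
  fixes idx :: "'m::finite \<Rightarrow> nat"
  assumes "CARD('n::finite) \<ge> 2"
    and "bij_betw idx (UNIV :: 'm set) {..<2 * CARD('n) + 2}"
  shows "aff_dim (affine hull
           {alpha_f_vector idx P | P :: (real ^ 'n) set.
              polytope P \<and> aff_dim P = int CARD('n)}) = 2 * int CARD('n) - 3"
proof -
  let ?d = "CARD('n)"
  let ?S = "{alpha_f_vector idx P | P :: (real ^ 'n) set. polytope P \<and> aff_dim P = int ?d}"
  let ?\<Phi> = "\<lambda>v. (\<chi> k. relation_coeff ?d v (idx k)) :: real ^ 'm"
  note d = assms(1) and bij = assms(2)
  have cardm: "CARD('m) = 2 * ?d + 2" using bij_betw_same_card[OF bij] by simp
  have inner: "c \<bullet> (alpha_f_vector idx P - alpha_f_vector idx Q) =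
      (\<Sum>i\<le>?d. C i * (angle_sum i P - angle_sum i Q)) +
      (\<Sum>i\<le>?d. C (?d + 1 + i) * (real (face_number i P) - real (face_number i Q)))"
    if "\<And>k. c $ k = C (idx k)" for c C and P Q :: "(real ^ 'n) set"
  proof -
    let ?f = "\<lambda>i. C i * ((if i \<le> ?d then angle_sum i P else real (face_number (i - (?d + 1)) P)) -
       (if i \<le> ?d then angle_sum i Q else real (face_number (i - (?d + 1)) Q)))"
    have "c \<bullet> (alpha_f_vector idx P - alpha_f_vector idx Q) = (\<Sum>k\<in>UNIV. ?f (idx k))"
      unfolding inner_vec_def alpha_f_vector_def using that by (intro sum.cong) auto
    also have "\<dots> = (\<Sum>i\<le>?d. ?f i) + (\<Sum>i\<le>?d. ?f (?d + 1 + i))" by (rule bij_pairs_sum[OF bij])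
    also have "\<dots> = (\<Sum>i\<le>?d. C i * (angle_sum i P - angle_sum i Q)) +
      (\<Sum>i\<le>?d. C (?d + 1 + i) * (real (face_number i P) - real (face_number i Q)))"
      by (intro arg_cong2[of _ _ _ _ "(+)"] sum.cong) auto
    finally show ?thesis .
  qed
  obtain A1 :: "'n set" where A1: "card A1 = 1" using d obtain_subset_with_card_n[of 1 "UNIV :: 'n set"] by auto
  define P0 :: "(real ^ 'n) set" where "P0 = pyramid_prism A1 (- A1) (\<lambda>_. 1)"
  have "A1 \<noteq> {}" using A1 by auto
  then have P0: "polytope P0" "aff_dim P0 = int ?d"
    unfolding P0_def by (auto intro!: polytope_pyramid_prism aff_dim_pyramid_prism)
  define x0 where "x0 = alpha_f_vector idx P0"
  have x0: "x0 \<in> ?S" using P0 by (auto simp: x0_def)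
  define D where "D = (\<lambda>x. x - x0) ` ?S"
  \<comment> \<open>The first inclusion yields the lower bound for the dimension, the second the
    upper bound: the complement of the differences has dimension 5 in a space of dimension
    \<open>2 * d + 2\<close>.\<close>
  have orth: "{y. \<forall>x\<in>span D. orthogonal x y} = range ?\<Phi>"
  proof (intro equalityI subsetI)
    fix c assume "c \<in> {y. \<forall>x\<in>span D. orthogonal x y}"
    then have c: "c \<bullet> (x - x0) = 0" if "x \<in> ?S" for x
      using that span_base[of "x - x0" D] by (auto simp: D_def orthogonal_def inner_commute)
    define \<iota> where "\<iota> = inv_into UNIV idx"
    have i1: "\<iota> (idx k) = k" for k using bij by (simp add: \<iota>_def bij_betw_def)
    have "c \<bullet> (alpha_f_vector idx P - alpha_f_vector idx Q) = 0"
      if "polytope P" "aff_dim P = int ?d" "polytope Q" "aff_dim Q = int ?d" for P Q :: "(real ^ 'n) set"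
    proof -
      have "c \<bullet> (alpha_f_vector idx P - x0) = 0" "c \<bullet> (alpha_f_vector idx Q - x0) = 0" using c that by blast+
      then show ?thesis by (simp add: inner_diff_right)
    qed
    then have rel: "(\<Sum>i\<le>?d. c $ \<iota> i * (angle_sum i P - angle_sum i Q)) +
      (\<Sum>i\<le>?d. c $ \<iota> (?d + 1 + i) * (real (face_number i P) - real (face_number i Q))) = 0"
      if "polytope P" "aff_dim P = int ?d" "polytope Q" "aff_dim Q = int ?d" for P Q :: "(real ^ 'n) set"
      using that inner[of c "\<lambda>i. c $ \<iota> i" P Q] i1 by simp
    obtain v where v: "\<And>i. i \<le> ?d \<Longrightarrow> c $ \<iota> i = relation_coeff ?d v i"
      "\<And>i. i \<le> ?d \<Longrightarrow> c $ \<iota> (?d + 1 + i) = relation_coeff ?d v (?d + 1 + i)"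
      using relation_imp_coeff[OF d, of "\<lambda>i. c $ \<iota> i" "\<lambda>i. c $ \<iota> (?d + 1 + i)"] rel by blast
    have "c $ k = relation_coeff ?d v (idx k)" for k
    proof (cases "idx k \<le> ?d")
      case True
      then show ?thesis using v(1)[of "idx k"] i1 by simp
    next
      case False
      have "idx k < 2 * ?d + 2" using bij by (auto simp: bij_betw_def)
      then show ?thesis using v(2)[of "idx k - (?d + 1)"] False i1 by simp
    qed
    then have "c = ?\<Phi> v" by (simp add: vec_eq_iff)
    then show "c \<in> range ?\<Phi>" by blast
  next
    fix c assume "c \<in> range ?\<Phi>"
    then obtain v where "c = ?\<Phi> v" by blast
    then obtain a e a' b b' where c: "c = ?\<Phi> (a, e, a', b, b')" by (metis prod.exhaust)
    have val: "c \<bullet> (alpha_f_vector idx P - x0) = 0" if P: "polytope P" "aff_dim P = int ?d" for P :: "(real ^ 'n) set"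
    proof -
      let ?R = "relation_coeff ?d (a, e, a', b, b')"
      let ?X = "\<lambda>i. angle_sum i P - angle_sum i P0" and ?Y = "\<lambda>i. real (face_number i P) - real (face_number i P0)"
      have X: "(\<Sum>i\<le>?d. (-1) ^ i * ?X i) = 0" and Y: "(\<Sum>i\<le>?d. (-1) ^ i * ?Y i) = 0" and "?X ?d = 0" "?Y ?d = 0"
        and XY: "?X (?d - 1) = ?Y (?d - 1) / 2"
        using polytope_relations[OF P] polytope_relations[OF P0]
        by (simp_all add: right_diff_distrib sum_subtractf diff_divide_distrib)
      have "(\<Sum>i\<le>?d. ?R i * ?X i) = (\<Sum>i\<le>?d. a * ((-1) ^ i * ?X i) + (if i = ?d - 1 then e * ?X i else 0) + (if i = ?d then a' * ?X i else 0))"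
        by (intro sum.cong refl) (auto simp: relation_coeff_low algebra_simps)
      also have "\<dots> = e * ?X (?d - 1)"
        using \<open>?X ?d = 0\<close> X by (simp add: sum.distrib sum_distrib_left[symmetric])
      finally have 1: "(\<Sum>i\<le>?d. ?R i * ?X i) = e * ?X (?d - 1)" .
      have "(\<Sum>i\<le>?d. ?R (?d + 1 + i) * ?Y i) = (\<Sum>i\<le>?d. b * ((-1) ^ i * ?Y i) + (if i = ?d - 1 then - e / 2 * ?Y i else 0) + (if i = ?d then b' * ?Y i else 0))"
      proof (rule sum.cong[OF refl])
        fix i
        show "?R (?d + 1 + i) * ?Y i = b * ((-1) ^ i * ?Y i) + (if i = ?d - 1 then - e / 2 * ?Y i else 0) + (if i = ?d then b' * ?Y i else 0)"
          unfolding relation_coeff_high by (simp add: algebra_simps)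
      qed
      also have "\<dots> = - e / 2 * ?Y (?d - 1)"
        using \<open>?Y ?d = 0\<close> Y by (simp add: sum.distrib sum_distrib_left[symmetric])
      finally have "(\<Sum>i\<le>?d. ?R (?d + 1 + i) * ?Y i) = - e / 2 * ?Y (?d - 1)" .
      then show ?thesis
        unfolding x0_def using inner[of c ?R P P0] 1 XY by (simp add: c)
    qed
    have "D \<subseteq> {x. c \<bullet> x = 0}" using val by (auto simp: D_def)
    then have "span D \<subseteq> {x. c \<bullet> x = 0}" by (rule span_minimal) (rule subspace_hyperplane)
    then show "c \<in> {y. \<forall>x\<in>span D. orthogonal x y}" by (auto simp: orthogonal_def inner_commute)
  qed
  have inj: "inj ?\<Phi>"
    unfolding linear_injective_0[OF relation_coeff_linear]
  proof (intro allI impI)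
    fix v assume z: "?\<Phi> v = 0"
    show "v = 0"
    proof (rule relation_coeff_inj[OF d])
      fix i assume "i < 2 * ?d + 2"
      then have "i \<in> range idx" using bij by (simp add: bij_betw_def)
      then obtain k where "idx k = i" by blast
      moreover have "?\<Phi> v $ k = 0" unfolding z by simp
      ultimately show "relation_coeff ?d v i = 0" by simp
    qed
  qed
  have "dim (range ?\<Phi>) = dim (UNIV :: (real \<times> real \<times> real \<times> real \<times> real) set)"
    using inj by (intro dim_image_eq relation_coeff_linear) (auto intro: inj_on_subset)
  then have d5: "dim (range ?\<Phi>) = 5" by simp
  have "dim {y \<in> UNIV. \<forall>x\<in>span D. orthogonal x y} + dim (span D) = dim (UNIV :: (real ^ 'm) set)"
    by (rule dim_subspace_orthogonal_to_vectors) auto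
  then have "5 + dim D = 2 * ?d + 2" using orth d5 cardm by simp
  moreover have "aff_dim ?S = int (dim D)"
    unfolding D_def using hull_inc[OF x0] by (rule aff_dim_eq_dim_subtract)
  ultimately show ?thesis by simp
qed

end
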